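(* (a) (Exact representation.) There is a family of functions $f:\{0,1\}^n\to\{\pm1\}$ (for infinitely many $n$) whose optimal decision tree size is $s=\Theta(n)$ and such that $\textsc{TopDownDTSize}(f)\ge 2^{\Omega(s)}$. (b) (Approximate representation.) For every $\varepsilon\in(0,\frac12)$ and every function $s(n)\le 2^{\tilde{O}(\sqrt{n})}$, there is an $f:\{0,1\}^n\to\{\pm1\}$ with optimal decision tree size $s$ such that $\textsc{TopDownDTSize}(f,\varepsilon)\ge s^{\tilde{\Omega}(\log s)}$. These lower bounds hold even if ties in $\textsc{BuildTopDownDT}$ are broken in the most favorable way.
   Context: The size of a decision tree is its number of leaves; the optimal decision tree size of $f$ is the least size of a decision tree computing $f$ exactly; logarithms are base 2. The influence of variable $i$ on $g:\{0,1\}^n\to\{\pm1\}$ is $\mathrm{Inf}_i(g)=\Pr_{\mathbf{x}}[g(\mathbf{x})\ne g(\mathbf{x}^{\oplus i})]$, with $\mathbf{x}$ uniform and $\mathbf{x}^{\oplus i}$ denoting $\mathbf{x}$ with coordinate $i$ flipped. A bare tree is a decision tree with unlabeled leaves; for a leaf $\ell$, $f_\ell$ is the restriction of $f$ by the path to $\ell$ and $|\ell|$ its depth. The $f$-completion labels each leaf $\ell$ by $\mathrm{sign}(\mathbb{E}[f_\ell])$. $T$ is an $\varepsilon$-approximation of $f$ if $\Pr_{\mathbf{x}}[T(\mathbf{x})\ne f(\mathbf{x})]\le\varepsilon$. $\textsc{BuildTopDownDT}(f,\varepsilon)$: start with the one-leaf bare tree $T^\circ$; while the $f$-completion of $T^\circ$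 is not an $\varepsilon$-approximation of $f$, for each leaf $\ell$ let $x_{i(\ell)}$ maximize $\mathrm{Inf}_i(f_\ell)$, set $\mathrm{score}(\ell)=2^{-|\ell|}\mathrm{Inf}_{i(\ell)}(f_\ell)$, and replace a highest-score leaf $\ell^\star$ by a query to $x_{i(\ell^\star)}$; output the $f$-completion. $\textsc{TopDownDTSize}(f,\varepsilon)$ is the size of the output, and $\textsc{TopDownDTSize}(f)=\textsc{TopDownDTSize}(f,0)$. *)

theory Defs
  imports "HOL-Probability.Probability" "HOL-Library.Landau_Symbols"
begin

section \<open>Boolean functions\<close>

text \<open>A function $\{0,1\}^n \to \{\pm1\}$ is an \<open>f :: (nat \<Rightarrow> bool) \<Rightarrow> real\<close> with
  \<open>f \<in> cube n \<rightarrow> {-1, 1}\<close>; its values outside \<open>cube n\<close> are never looked at.\<close>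

definition cube :: "nat \<Rightarrow> (nat \<Rightarrow> bool) set" where
  "cube n = {..<n} \<rightarrow>\<^sub>E UNIV"

definition uniform :: "nat \<Rightarrow> (nat \<Rightarrow> bool) pmf" where
  "uniform n = pmf_of_set (cube n)"

definition influence :: "nat \<Rightarrow> nat \<Rightarrow> ((nat \<Rightarrow> bool) \<Rightarrow> real) \<Rightarrow> real" where
  "influence n i g = measure_pmf.prob (uniform n) {x. g x \<noteq> g (x(i := \<not> x i))}"

text \<open>A restriction remains a function on the whole cube that ignores the fixed coordinate. This
  changes neither its mean nor the influences of the free coordinates, and the fixed coordinate
  gets influence 0.\<close>

definition fix_var :: "nat \<Rightarrow> bool \<Rightarrow> ((nat \<Rightarrow> bool) \<Rightarrow> real) \<Rightarrow> (nat \<Rightarrow> bool) \<Rightarrow> real" where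
  "fix_var i b f = (\<lambda>x. f (x(i := b)))"


section \<open>Decision trees\<close>

text \<open>In \<open>Query i l r\<close> the subtree \<open>l\<close> is taken on \<open>x i = False\<close> (i.e. 0) and \<open>r\<close> on
  \<open>x i = True\<close> (i.e. 1).\<close>

datatype (leaf_labels: 'a) dtree = Leaf 'a | Query nat "'a dtree" "'a dtree"

type_synonym bare_tree = "unit dtree"

fun queried :: "'a dtree \<Rightarrow> nat set" where
  "queried (Leaf a) = {}"
| "queried (Query i l r) = insert i (queried l \<union> queried r)"

fun eval_dt :: "'a dtree \<Rightarrow> (nat \<Rightarrow> bool) \<Rightarrow> 'a" where
  "eval_dt (Leaf a) x = a"
| "eval_dt (Query i l r) x = (if x i then eval_dt r x else eval_dt l x)"

fun dt_size :: "'a dtree \<Rightarrow> nat" where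
  "dt_size (Leaf a) = 1"
| "dt_size (Query i l r) = dt_size l + dt_size r"

definition decision_tree :: "nat \<Rightarrow> real dtree \<Rightarrow> bool" where
  "decision_tree n T \<longleftrightarrow> queried T \<subseteq> {..<n} \<and> leaf_labels T \<subseteq> {-1, 1}"

definition computes :: "nat \<Rightarrow> real dtree \<Rightarrow> ((nat \<Rightarrow> bool) \<Rightarrow> real) \<Rightarrow> bool" where
  "computes n T f \<longleftrightarrow> (\<forall>x\<in>cube n. eval_dt T x = f x)"

definition opt_dt_size :: "nat \<Rightarrow> ((nat \<Rightarrow> bool) \<Rightarrow> real) \<Rightarrow> nat" where
  "opt_dt_size n f = Inf {dt_size T | T. decision_tree n T \<and> computes n T f}"

definition approximates :: "nat \<Rightarrow> real \<Rightarrow> real dtree \<Rightarrow> ((nat \<Rightarrow> bool) \<Rightarrow> real) \<Rightarrow> bool" where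
  "approximates n \<epsilon> T f \<longleftrightarrow> measure_pmf.prob (uniform n) {x. eval_dt T x \<noteq> f x} \<le> \<epsilon>"


section \<open>The top-down heuristic\<close>

text \<open>A leaf of a bare tree is identified with the path leading to it, listed from the root; its
  depth is the length of the path.\<close>

type_synonym path = "(nat \<times> bool) list"

fun leaves :: "'a dtree \<Rightarrow> path set" where
  "leaves (Leaf a) = {[]}"
| "leaves (Query i l r) = Cons (i, False) ` leaves l \<union> Cons (i, True) ` leaves r"

fun restrict_path :: "((nat \<Rightarrow> bool) \<Rightarrow> real) \<Rightarrow> path \<Rightarrow> (nat \<Rightarrow> bool) \<Rightarrow> real" where
  "restrict_path f [] = f"
| "restrict_path f ((i, b) # p) = restrict_path (fix_var i b f) p"

text \<open>The library's \<open>sgn\<close> is unsuitable, as it would label balanced leaves with 0. Which of the two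
  labels such a leaf gets is immaterial, since the error there is 1/2 either way.\<close>

definition pm_sign :: "real \<Rightarrow> real" where
  "pm_sign t = (if t \<ge> 0 then 1 else -1)"

fun completion :: "nat \<Rightarrow> ((nat \<Rightarrow> bool) \<Rightarrow> real) \<Rightarrow> bare_tree \<Rightarrow> real dtree" where
  "completion n f (Leaf u) = Leaf (pm_sign (measure_pmf.expectation (uniform n) f))"
| "completion n f (Query i l r) =
     Query i (completion n (fix_var i False f) l) (completion n (fix_var i True f) r)"

fun split_leaf :: "bare_tree \<Rightarrow> path \<Rightarrow> nat \<Rightarrow> bare_tree" where
  "split_leaf (Leaf u) p i = Query i (Leaf ()) (Leaf ())"
| "split_leaf (Query j l r) [] i = Query j l r"
| "split_leaf (Query j l r) ((k, b) # p) i =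
     (if b then Query j l (split_leaf r p i) else Query j (split_leaf l p i) r)"

definition most_influential :: "nat \<Rightarrow> ((nat \<Rightarrow> bool) \<Rightarrow> real) \<Rightarrow> nat \<Rightarrow> bool" where
  "most_influential n g i \<longleftrightarrow> i < n \<and> (\<forall>j<n. influence n j g \<le> influence n i g)"

text \<open>The argument \<open>i\<close> is the variable chosen for the leaf \<open>p\<close>.\<close>

definition score :: "nat \<Rightarrow> ((nat \<Rightarrow> bool) \<Rightarrow> real) \<Rightarrow> path \<Rightarrow> nat \<Rightarrow> real" where
  "score n f p i = (1/2) ^ length p * influence n i (restrict_path f p)"

text \<open>One iteration of the loop, as a relation: it relates a tree to every tree that can result
  under some way of breaking ties, both among variables (\<open>v\<close>) and among leaves (\<open>q\<close>).\<close>

inductive topdown_step :: "nat \<Rightarrow> ((nat \<Rightarrow> bool) \<Rightarrow> real) \<Rightarrow> real \<Rightarrow> bare_tree \<Rightarrow> bare_tree \<Rightarrow> bool"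
  for n f \<epsilon> where
  "\<lbrakk> \<not> approximates n \<epsilon> (completion n f t) f;
     \<forall>p\<in>leaves t. most_influential n (restrict_path f p) (v p);
     q \<in> leaves t;
     \<forall>p\<in>leaves t. score n f p (v p) \<le> score n f q (v q) \<rbrakk>
   \<Longrightarrow> topdown_step n f \<epsilon> t (split_leaf t q (v q))"

definition build_topdown_dt :: "nat \<Rightarrow> ((nat \<Rightarrow> bool) \<Rightarrow> real) \<Rightarrow> real \<Rightarrow> real dtree set" where
  "build_topdown_dt n f \<epsilon> =
     {completion n f t | t. (topdown_step n f \<epsilon>)\<^sup>*\<^sup>* (Leaf ()) t
                          \<and> approximates n \<epsilon> (completion n f t) f}"

text \<open>The size under the most favorable tie-breaking. For \<open>\<epsilon> \<ge> 0\<close> every run terminates, so that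
  the infimum is over a nonempty set: if the completion is not exact then the best score is
  positive, hence each step queries a variable that is new on its path.\<close>

definition topdown_dt_size :: "nat \<Rightarrow> ((nat \<Rightarrow> bool) \<Rightarrow> real) \<Rightarrow> real \<Rightarrow> nat" where
  "topdown_dt_size n f \<epsilon> = Inf (dt_size ` build_topdown_dt n f \<epsilon>)"


section \<open>Soft asymptotic notation\<close>

text \<open>The suppressed factors are polylogarithmic in the displayed function itself, so for
  \<open>g = (\<lambda>m. log 2 (real m))\<close> they are powers of the iterated logarithm.\<close>

definition soft_O :: "(nat \<Rightarrow> real) \<Rightarrow> (nat \<Rightarrow> real) set" where
  "soft_O g = (\<Union>k::nat. O(\<lambda>m. g m * log 2 (g m) ^ k))"

text \<open>One-sided on purpose: the library's \<open>\<Omega>\<close> only bounds the absolute value, so it would admit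
  negative exponents, which make a bound \<open>s powr e\<close> trivial.\<close>

definition soft_Omega :: "(nat \<Rightarrow> real) \<Rightarrow> (nat \<Rightarrow> real) set" where
  "soft_Omega g =
     {h. \<exists>c>0. \<exists>k::nat. \<forall>\<^sub>F m in sequentially. h m \<ge> c * (g m / log 2 (g m) ^ k)}"

end

theory Submission imports Defs "HOL-Real_Asymp.Real_Asymp" begin

text \<open>Exact trees: consider a list of levels, each with two guards and a payload variable, whose value
  is the payload of the first level at which some guard is 0. This has a tree of linear size. But the
  payload of the first level has conditional influence \<open>3/4\<close> and every other variable at most
  \<open>1/2\<close>, so the heuristic queries the payload first, and the whole remaining list has to be
  computed below both answers.

  Approximation: a Tribes-like selector, in which every variable has influence \<open>2 * 2^(-w)\<close>, chooses
  one of about \<open>2^w\<close> disjoint parities of \<open>k\<close> variables, each with probability larger than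
  \<open>2 * 2^(-w)\<close>. As long as a parity has an unqueried variable, flipping that variable changes the
  function whenever the parity is selected; hence the heuristic exhausts all the parities, about
  \<open>k * 2^w\<close> variables, before it touches the selector, and a leaf at which most parities are
  not exhausted is almost unbiased. A small tree queries the selector first and then one parity.

  To get every optimal size \<open>s\<close> exactly, and an error close to \<open>1/2\<close>, several independent copies are
  put at the leaves of a caterpillar whose last leaf, of small measure, computes a function of
  prescribed optimal size. The optimal size is additive over such disjoint subfunctions.\<close>

section \<open>Averages over the cube\<close>

text \<open>Of a run only the final tree is kept: every query in it is most influential and has
  positive influence. This holds under any tie-breaking, so what must be ensured is that all
  comparisons of influences are strict. That is why a level has two guards: with a single guard,
  guard and payload would tie at 1/2. For the same reason a group of several Tribes terms shares one
  index: one term is satisfied with probability only \<open>2^(-w)\<close>, below the influence of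
  its variables.

  The parameters balance as follows. There are about \<open>2^w\<close> terms of width
  \<open>w\<close>, and reading them one after another gives a tree of size about
  \<open>w^(2^w)\<close>, so \<open>log s\<close> is about \<open>w * 2^w\<close>. Parities on
  \<open>2^w\<close> variables fit into this budget. Exhausting a constant fraction of them takes on
  the order of \<open>4^w\<close> queries on one path, which is \<open>(log s)^2\<close> up to
  iterated logarithms. The number of variables is also of order \<open>4^w\<close>, and this is
  where the \<open>sqrt n\<close> in the range of \<open>s\<close> comes from.\<close>

definition dep :: "nat set \<Rightarrow> ((nat \<Rightarrow> bool) \<Rightarrow> 'b) \<Rightarrow> bool" where
  "dep V g \<longleftrightarrow> (\<forall>x y. (\<forall>i\<in>V. x i = y i) \<longrightarrow> g x = g y)"

text \<open>Like \<open>dep\<close>, this quantifies over all assignments and not only over the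
  cube, so that restrictions and compositions preserve it without side conditions and
  \<open>fix_var i b g = g\<close> can hold as an equation of functions.\<close>

definition pm :: "((nat \<Rightarrow> bool) \<Rightarrow> real) \<Rightarrow> bool" where
  "pm f \<longleftrightarrow> (\<forall>x. f x = 1 \<or> f x = -1)"

definition const_on_cube :: "nat \<Rightarrow> ((nat \<Rightarrow> bool) \<Rightarrow> 'b) \<Rightarrow> bool" where
  "const_on_cube n f \<longleftrightarrow> (\<exists>c. \<forall>x\<in>cube n. f x = c)"

abbreviation avg :: "nat \<Rightarrow> ((nat \<Rightarrow> bool) \<Rightarrow> real) \<Rightarrow> real" where
  "avg n f \<equiv> measure_pmf.expectation (uniform n) f"

lemma depD: "dep V g \<Longrightarrow> (\<And>i. i \<in> V \<Longrightarrow> x i = y i) \<Longrightarrow> g x = g y"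
  by (auto simp: dep_def)

lemma dep_upd: "dep V g \<Longrightarrow> i \<notin> V \<Longrightarrow> g (x(i := b)) = g x"
  by (erule depD) auto

lemma dep_mono: "dep V g \<Longrightarrow> V \<subseteq> W \<Longrightarrow> dep W g"
  unfolding dep_def by blast

lemma dep_fix_var: "dep V g \<Longrightarrow> dep (V - {i}) (fix_var i b g)"
  unfolding dep_def fix_var_def by auto

lemma fix_var_dep: "dep V g \<Longrightarrow> i \<notin> V \<Longrightarrow> fix_var i b g = g"
  by (auto simp: fix_var_def dep_upd)

lemma pm_fix_var: "pm f \<Longrightarrow> pm (fix_var i b f)"
  by (auto simp: pm_def fix_var_def)

lemma finite_cube [simp]: "finite (cube n)"
  by (auto simp: cube_def intro: finite_PiE)

lemma card_cube: "card (cube n) = 2 ^ n"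
  by (simp add: cube_def card_PiE)

lemma cube_nonempty [simp]: "cube n \<noteq> {}"
  by (auto simp: cube_def PiE_eq_empty_iff)

lemma cube_upd: "x \<in> cube n \<Longrightarrow> i < n \<Longrightarrow> x(i := b) \<in> cube n"
  by (auto simp: cube_def PiE_def extensional_def)

lemma restrict_in_cube: "restrict x {..<n} \<in> cube n"
  by (auto simp: cube_def)

lemma avg_eq: "avg n f = (\<Sum>x\<in>cube n. f x) / 2 ^ n"
  by (simp add: uniform_def integral_pmf_of_set card_cube)

lemma prob_eq_avg: "measure_pmf.prob (uniform n) {x. P x} = avg n (\<lambda>x. of_bool (P x))"
proof -
  have "measure_pmf.prob (uniform n) {x. P x} = avg n (indicator {x. P x})"
    by simp
  also have "indicator {x. P x} = (\<lambda>x. of_bool (P x) :: real)"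
    by (auto simp: indicator_def)
  finally show ?thesis .
qed

lemma avg_cong: "(\<And>x. x \<in> cube n \<Longrightarrow> f x = g x) \<Longrightarrow> avg n f = avg n g"
  by (simp add: avg_eq)

lemma avg_mono: "(\<And>x. x \<in> cube n \<Longrightarrow> f x \<le> g x) \<Longrightarrow> avg n f \<le> avg n g"
  unfolding avg_eq by (intro divide_right_mono sum_mono) auto

lemma avg_add: "avg n (\<lambda>x. f x + g x) = avg n f + avg n g"
  by (simp add: avg_eq sum.distrib add_divide_distrib)

lemma avg_diff: "avg n (\<lambda>x. f x - g x) = avg n f - avg n g"
  by (simp add: avg_eq sum_subtractf diff_divide_distrib)

lemma avg_minus: "avg n (\<lambda>x. - f x) = - avg n f"
  by (simp add: avg_eq sum_negf)

lemma avg_cmult: "avg n (\<lambda>x. c * f x) = c * avg n f"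
  by (simp add: avg_eq sum_distrib_left)

lemma avg_sum: "avg n (\<lambda>x. \<Sum>a\<in>A. f a x) = (\<Sum>a\<in>A. avg n (f a))"
  unfolding avg_eq by (subst sum.swap) (simp add: sum_divide_distrib)

lemma avg_const: "(\<And>x. x \<in> cube n \<Longrightarrow> f x = c) \<Longrightarrow> avg n f = c"
  by (simp add: avg_eq card_cube)

lemma avg_nonneg: "(\<And>x. x \<in> cube n \<Longrightarrow> 0 \<le> f x) \<Longrightarrow> 0 \<le> avg n f"
  by (simp add: avg_eq sum_nonneg)

lemma avg_eq_0_iff: "(\<And>x. x \<in> cube n \<Longrightarrow> 0 \<le> f x) \<Longrightarrow> avg n f = 0 \<longleftrightarrow> (\<forall>x\<in>cube n. f x = 0)"
  by (simp add: avg_eq sum_nonneg_eq_0_iff)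

lemma avg_flip:
  assumes "i < n"
  shows "avg n (\<lambda>x. f (x(i := \<not> x i))) = avg n f"
proof -
  have "(\<Sum>x\<in>cube n. f (x(i := \<not> x i))) = (\<Sum>x\<in>cube n. f x)"
    by (rule sum.reindex_bij_witness[where i = "\<lambda>x. x(i := \<not> x i)" and j = "\<lambda>x. x(i := \<not> x i)"])
       (use assms in \<open>auto simp: cube_upd\<close>)
  then show ?thesis by (simp add: avg_eq)
qed

lemma avg_split:
  assumes "i < n"
  shows "avg n f = (avg n (fix_var i False f) + avg n (fix_var i True f)) / 2"
proof -
  have "avg n (fix_var i False f) + avg n (fix_var i True f)
      = avg n (\<lambda>x. f (x(i := False)) + f (x(i := True)))"
    by (simp add: avg_add fix_var_def)
  also have "\<dots> = avg n (\<lambda>x. f x + f (x(i := \<not> x i)))"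
  proof (rule avg_cong)
    fix x
    show "f (x(i := False)) + f (x(i := True)) = f x + f (x(i := \<not> x i))"
      by (cases "x i") (auto simp: fun_upd_idem)
  qed
  also have "\<dots> = 2 * avg n f" by (simp add: avg_add avg_flip[OF assms])
  finally show ?thesis by simp
qed

text \<open>Averaging out the coordinates of \<open>V\<close> one at a time with
  \<open>avg_split\<close> never touches \<open>h\<close>; once none is left, \<open>g\<close> is a
  constant that can be pulled out.\<close>

lemma avg_indep:
  assumes "dep V g" "dep W h" "V \<inter> W = {}" "V \<subseteq> {..<n}"
  shows "avg n (\<lambda>x. g x * h x) = avg n g * avg n h"
proof -
  have "finite V" using assms(4) finite_subset by blast
  then show ?thesis using assms
  proof (induction V arbitrary: g rule: finite_induct)
    case empty
    then have c: "g x = g undefined" for x by (auto simp: dep_def)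
    then have "avg n (\<lambda>x. g x * h x) = avg n (\<lambda>x. g undefined * h x)"
      by (intro avg_cong) (subst c, rule refl)
    moreover have "avg n g = g undefined" by (rule avg_const) (rule c)
    ultimately show ?case by (simp add: avg_cmult)
  next
    case (insert i V)
    have i: "i < n" "i \<notin> W" using insert.prems by auto
    have "dep V (fix_var i b g)" for b
      using dep_fix_var[OF insert.prems(1), of i b] insert.hyps by simp
    then have IH: "avg n (\<lambda>x. fix_var i b g x * h x) = avg n (fix_var i b g) * avg n h" for b
      using insert.IH insert.prems by auto
    have eq: "fix_var i b (\<lambda>x. g x * h x) = (\<lambda>x. fix_var i b g x * h x)" for b
      by (simp add: fix_var_def dep_upd[OF insert.prems(2) i(2)])
    have "avg n (\<lambda>x. g x * h x)
        = (avg n (fix_var i False g) * avg n h + avg n (fix_var i True g) * avg n h) / 2"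
      using avg_split[OF i(1), of "\<lambda>x. g x * h x"] IH eq by simp
    also have "\<dots> = (avg n (fix_var i False g) + avg n (fix_var i True g)) / 2 * avg n h"
      by (simp add: field_simps)
    finally show ?case by (simp only: avg_split[OF i(1), of g])
  qed
qed

lemma avg_all_true:
  assumes "V \<subseteq> {..<n}"
  shows "avg n (\<lambda>x. of_bool (\<forall>i\<in>V. x i)) = (1/2) ^ card V"
proof -
  have "finite V" using assms finite_subset by blast
  then show ?thesis using assms
  proof (induction V rule: finite_induct)
    case empty
    then show ?case by (simp add: avg_const)
  next
    case (insert i V)
    have "avg n (fix_var i False (\<lambda>x. of_bool (\<forall>j\<in>insert i V. x j))) = 0"
      by (rule avg_const) (simp add: fix_var_def)
    moreover have "fix_var i True (\<lambda>x. of_bool (\<forall>j\<in>insert i V. x j)) = (\<lambda>x. of_bool (\<forall>j\<in>V. x j))"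
      using insert.hyps by (auto simp: fix_var_def fun_eq_iff)
    ultimately show ?case using avg_split[of i n "\<lambda>x. of_bool (\<forall>j\<in>insert i V. x j)"] insert
      by simp
  qed
qed

lemma const_on_cubeI:
  assumes "\<And>i x. i < n \<Longrightarrow> x \<in> cube n \<Longrightarrow> g (x(i := \<not> x i)) = g x"
  shows "const_on_cube n g"
proof -
  have upd: "g (x(i := b)) = g x" if "i < n" "x \<in> cube n" for i x b
    using assms[OF that] by (cases "b = x i") (auto simp: fun_upd_idem)
  have "g x = g y" if x: "x \<in> cube n" and y: "y \<in> cube n" for x y
  proof -
    \<comment> \<open>Hybrids between \<open>x\<close> and \<open>y\<close>: passing from
      \<open>m\<close> to \<open>Suc m\<close> changes one coordinate and hence not the value. For
      \<open>m = n\<close> the hybrid is \<open>y\<close>, as both points are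
      \<open>undefined\<close> beyond \<open>n\<close>.\<close>
    have "(\<lambda>i. if i < m then y i else x i) \<in> cube n \<and> g (\<lambda>i. if i < m then y i else x i) = g x"
      if "m \<le> n" for m
      using that
    proof (induction m)
      case 0
      then show ?case using x by simp
    next
      case (Suc m)
      have eq: "(\<lambda>i. if i < Suc m then y i else x i) = (\<lambda>i. if i < m then y i else x i)(m := y m)"
        by (auto simp: fun_eq_iff less_Suc_eq)
      show ?case unfolding eq using Suc upd cube_upd by simp
    qed
    from this[of n] have "g (\<lambda>i. if i < n then y i else x i) = g x" by simp
    moreover have "(\<lambda>i. if i < n then y i else x i) = y"
      using x y by (auto simp: cube_def PiE_def extensional_def)
    ultimately show ?thesis by simp
  qed
  moreover obtain x0 where "x0 \<in> cube n" using cube_nonempty[of n] by blast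
  ultimately show ?thesis unfolding const_on_cube_def by blast
qed

section \<open>Influences\<close>

lemma influence_avg: "influence n i g = avg n (\<lambda>x. of_bool (g x \<noteq> g (x(i := \<not> x i))))"
  by (simp add: influence_def prob_eq_avg)

lemma influence_nonneg: "0 \<le> influence n i g"
  by (simp add: influence_def)

lemma influence_eq_0_iff:
  "influence n i g = 0 \<longleftrightarrow> (\<forall>x\<in>cube n. g (x(i := \<not> x i)) = g x)"
proof -
  have "influence n i g = 0 \<longleftrightarrow> (\<forall>x\<in>cube n. of_bool (g x \<noteq> g (x(i := \<not> x i))) = (0::real))"
    unfolding influence_avg by (rule avg_eq_0_iff) simp
  then show ?thesis by auto
qed

lemma const_if_influence_0:
  "(\<And>i. i < n \<Longrightarrow> influence n i g = 0) \<Longrightarrow> const_on_cube n g"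
  by (rule const_on_cubeI) (simp add: influence_eq_0_iff)

section \<open>Runs of the heuristic\<close>

text \<open>The positive influence excludes repeated queries on a path, which termination of the heuristic
  and the decomposition of the error over the leaves both rely on.\<close>

fun greedy :: "nat \<Rightarrow> ((nat \<Rightarrow> bool) \<Rightarrow> real) \<Rightarrow> bare_tree \<Rightarrow> bool" where
  "greedy n f (Leaf u) = True"
| "greedy n f (Query i l r) \<longleftrightarrow> most_influential n f i \<and> influence n i f > 0
     \<and> greedy n (fix_var i False f) l \<and> greedy n (fix_var i True f) r"

fun irredundant :: "'a dtree \<Rightarrow> bool" where
  "irredundant (Leaf u) = True"
| "irredundant (Query i l r) \<longleftrightarrow> i \<notin> queried l \<union> queried r \<and> irredundant l \<and> irredundant r"

lemma greedy_queried: "greedy n f t \<Longrightarrow> queried t \<subseteq> {..<n}"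
  by (induction n f t rule: greedy.induct) (auto simp: most_influential_def)

text \<open>A coordinate that \<open>f\<close> ignores has influence 0, also after every
  restriction, whereas \<open>greedy\<close> demands positive influence. It is applied to a
  coordinate that has just been fixed.\<close>

lemma greedy_fixed_not_queried:
  "greedy n f t \<Longrightarrow> (\<And>x b. f (x(i := b)) = f x) \<Longrightarrow> i \<notin> queried t"
proof (induction n f t rule: greedy.induct)
  case (2 n f j l r)
  have "i \<noteq> j"
  proof
    assume "i = j"
    then have "influence n j f = 0" unfolding influence_eq_0_iff using 2(4) by blast
    then show False using 2(3) by simp
  qed
  have "fix_var j c f (x(i := b)) = fix_var j c f x" for x b c
    unfolding fix_var_def fun_upd_twist[OF \<open>i \<noteq> j\<close>] by (rule 2(4))
  note fixed = this
  have "i \<notin> queried l" by (rule 2(1)[OF _ fixed]) (use 2(3) in simp)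
  moreover have "i \<notin> queried r" by (rule 2(2)[OF _ fixed]) (use 2(3) in simp)
  ultimately show ?case using \<open>i \<noteq> j\<close> by simp
qed simp

lemma greedy_irredundant: "greedy n f t \<Longrightarrow> irredundant t"
proof (induction n f t rule: greedy.induct)
  case (2 n f i l r)
  have "fix_var i c f (x(i := b)) = fix_var i c f x" for x b c
    by (simp add: fix_var_def)
  then show ?case using 2 greedy_fixed_not_queried by auto
qed simp

lemma finite_queried [simp]: "finite (queried t)"
  by (induction t) auto

text \<open>No path repeats a query, so depth is bounded by the number of variables. The resulting
  bound on the size serves only to show that the heuristic terminates.\<close>

lemma dt_size_le_power: "irredundant t \<Longrightarrow> dt_size t \<le> 2 ^ card (queried t)"
proof (induction t)
  case (Query i l r)
  let ?m = "card (queried l \<union> queried r)"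
  have "dt_size l \<le> 2 ^ card (queried l)" "dt_size r \<le> 2 ^ card (queried r)"
    using Query by simp_all
  moreover have "(2::nat) ^ card (queried l) \<le> 2 ^ ?m" "(2::nat) ^ card (queried r) \<le> 2 ^ ?m"
    by (auto intro!: power_increasing card_mono)
  ultimately have "dt_size l + dt_size r \<le> 2 ^ ?m + 2 ^ ?m" by linarith
  then show ?case using Query.prems by simp
qed simp

lemma greedy_size: "greedy n f t \<Longrightarrow> dt_size t \<le> 2 ^ n"
proof -
  assume g: "greedy n f t"
  have "card (queried t) \<le> n"
    using card_mono[OF _ greedy_queried[OF g]] by simp
  then have "(2::nat) ^ card (queried t) \<le> 2 ^ n" by simp
  then show ?thesis using dt_size_le_power[OF greedy_irredundant[OF g]] by linarith
qed

section \<open>Averages and errors over the leaves\<close>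

lemma finite_leaves [simp]: "finite (leaves t)"
  by (induction t) auto

lemma leaves_nonempty [simp]: "leaves t \<noteq> {}"
  by (induction t) auto

lemma sum_leaves_Query:
  "(\<Sum>p\<in>leaves (Query i l r). F p) =
     (\<Sum>p\<in>leaves l. F ((i, False) # p)) + (\<Sum>p\<in>leaves r. F ((i, True) # p))"
proof -
  have "(\<Sum>p\<in>leaves (Query i l r). F p) =
     sum F (Cons (i, False) ` leaves l) + sum F (Cons (i, True) ` leaves r)"
    by (simp, rule sum.union_disjoint) auto
  then show ?thesis by (simp add: sum.reindex)
qed

lemma card_leaves: "card (leaves t) = dt_size t"
proof (induction t)
  case (Query i l r)
  then show ?case using sum_leaves_Query[of "\<lambda>_. 1::nat" i l r] by simp
qed simp

lemma queried_completion [simp]: "queried (completion n f t) = queried t"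
  by (induction n f t rule: completion.induct) auto

lemma dt_size_completion [simp]: "dt_size (completion n f t) = dt_size t"
  by (induction n f t rule: completion.induct) auto

lemma eval_upd: "i \<notin> queried t \<Longrightarrow> eval_dt t (x(i := b)) = eval_dt t x"
  by (induction t) auto

lemma pm_restrict_path: "pm f \<Longrightarrow> pm (restrict_path f p)"
  by (induction f p rule: restrict_path.induct) (auto simp: pm_fix_var)

definition dt_error :: "nat \<Rightarrow> ((nat \<Rightarrow> bool) \<Rightarrow> real) \<Rightarrow> bare_tree \<Rightarrow> real" where
  "dt_error n f t = avg n (\<lambda>x. of_bool (eval_dt (completion n f t) x \<noteq> f x))"

lemma approximates_iff: "approximates n \<epsilon> (completion n f t) f \<longleftrightarrow> dt_error n f t \<le> \<epsilon>"
  by (simp add: approximates_def prob_eq_avg dt_error_def)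

lemma avg_leaves:
  assumes "queried t \<subseteq> {..<n}"
  shows "avg n f = (\<Sum>p\<in>leaves t. (1/2) ^ length p * avg n (restrict_path f p))"
  using assms
proof (induction t arbitrary: f)
  case (Query i l r)
  have "avg n f = (avg n (fix_var i False f) + avg n (fix_var i True f)) / 2"
    by (rule avg_split) (use Query.prems in simp)
  also have "\<dots> = (\<Sum>p\<in>leaves (Query i l r). (1/2) ^ length p * avg n (restrict_path f p))"
    using Query.prems
    by (simp add: sum_leaves_Query Query.IH(1)[of "fix_var i False f"]
        Query.IH(2)[of "fix_var i True f"] sum_divide_distrib add_divide_distrib del: leaves.simps)
  finally show ?case .
qed simp

text \<open>Fixing \<open>i\<close> makes the subtree run on \<open>x(i := b)\<close>, while its own
  error is measured at \<open>x\<close>. The two agree because \<open>irredundant\<close> keeps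
  \<open>i\<close> out of the subtree.\<close>

lemma dt_error_leaves:
  assumes "irredundant t" "queried t \<subseteq> {..<n}"
  shows "dt_error n f t = (\<Sum>p\<in>leaves t. (1/2) ^ length p * dt_error n (restrict_path f p) (Leaf ()))"
  using assms
proof (induction t arbitrary: f)
  case (Leaf u)
  then show ?case by (simp add: dt_error_def)
next
  case (Query i l r)
  have sub: "fix_var i False (\<lambda>x. of_bool (eval_dt (completion n f (Query i l r)) x \<noteq> f x))
      = (\<lambda>x. of_bool (eval_dt (completion n (fix_var i False f) l) x \<noteq> fix_var i False f x) :: real)"
    "fix_var i True (\<lambda>x. of_bool (eval_dt (completion n f (Query i l r)) x \<noteq> f x))
      = (\<lambda>x. of_bool (eval_dt (completion n (fix_var i True f) r) x \<noteq> fix_var i True f x) :: real)"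
    using Query.prems(1) by (auto simp: fix_var_def fun_eq_iff eval_upd)
  have "dt_error n f (Query i l r) =
     (dt_error n (fix_var i False f) l + dt_error n (fix_var i True f) r) / 2"
    unfolding dt_error_def
    by (subst avg_split[of i]) (use Query.prems(2) in simp, subst sub(1), subst sub(2), simp)
  also have "\<dots> = (\<Sum>p\<in>leaves (Query i l r). (1/2) ^ length p * dt_error n (restrict_path f p) (Leaf ()))"
    using Query.prems
    by (simp add: sum_leaves_Query Query.IH(1)[of "fix_var i False f"]
        Query.IH(2)[of "fix_var i True f"] sum_divide_distrib add_divide_distrib del: leaves.simps)
  finally show ?case .
qed

lemma dt_error_nonneg: "0 \<le> dt_error n f t"
  unfolding dt_error_def by (rule avg_nonneg) simp

lemma dt_error_leaf_const:
  assumes "pm g" "const_on_cube n g"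
  shows "dt_error n g (Leaf u) = 0"
proof -
  obtain c where c: "\<And>x. x \<in> cube n \<Longrightarrow> g x = c" using assms(2) by (auto simp: const_on_cube_def)
  obtain x0 where "x0 \<in> cube n" using cube_nonempty[of n] by blast
  then have "c = 1 \<or> c = -1" using c assms(1) by (auto simp: pm_def)
  moreover have "avg n g = c" by (rule avg_const) (rule c)
  ultimately have "pm_sign (avg n g) = c" by (auto simp: pm_sign_def)
  then show ?thesis unfolding dt_error_def by (intro avg_const) (use c in auto)
qed

lemma dt_error_leaf_0_const:
  assumes "dt_error n g (Leaf u) = 0"
  shows "const_on_cube n g"
proof -
  have "\<forall>x\<in>cube n. of_bool (pm_sign (avg n g) \<noteq> g x) = (0::real)"
    using assms unfolding dt_error_def by (subst (asm) avg_eq_0_iff) auto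
  then show ?thesis unfolding const_on_cube_def by (intro exI[of _ "pm_sign (avg n g)"]) auto
qed

text \<open>For signs the indicator of \<open>c \<noteq> g x\<close> is
  \<open>(1 - c * g x) / 2\<close>, so an almost unbiased leaf errs with probability close to 1/2
  under either label.\<close>

lemma dt_error_leaf_ge:
  assumes "pm g"
  shows "(1 - \<bar>avg n g\<bar>) / 2 \<le> dt_error n g (Leaf u)"
proof -
  let ?c = "pm_sign (avg n g)"
  have "of_bool (?c \<noteq> g x) = (1 - ?c * g x) / 2" for x
    using assms by (cases "g x = 1") (auto simp: pm_def pm_sign_def)
  then have "dt_error n g (Leaf u) = avg n (\<lambda>x. 1/2 - (?c / 2) * g x)"
    unfolding dt_error_def by (intro avg_cong) (simp add: field_simps)
  also have "\<dots> = 1/2 - (?c / 2) * avg n g"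
    unfolding avg_diff avg_cmult by (simp add: avg_const)
  finally show ?thesis by (auto simp: pm_sign_def split: if_splits)
qed

section \<open>The loop preserves greediness and terminates\<close>

lemma greedy_split_leaf:
  assumes "greedy n f t" "q \<in> leaves t" "most_influential n (restrict_path f q) i"
    "influence n i (restrict_path f q) > 0"
  shows "greedy n f (split_leaf t q i)"
  using assms by (induction t arbitrary: f q) auto

lemma dt_size_split_leaf: "q \<in> leaves t \<Longrightarrow> dt_size (split_leaf t q i) = dt_size t + 1"
  by (induction t arbitrary: q) auto

lemma most_influential_exists:
  assumes "n > 0"
  shows "\<exists>i. most_influential n g i"
proof -
  have "\<exists>i\<in>{..<n}. influence n i g = Max ((\<lambda>i. influence n i g) ` {..<n})"
    using Max_in[of "(\<lambda>i. influence n i g) ` {..<n}"] assms by fastforce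
  then show ?thesis unfolding most_influential_def by force
qed

lemma topdown_step_exists:
  assumes "n > 0" "\<not> approximates n \<epsilon> (completion n f t) f"
  shows "\<exists>t'. topdown_step n f \<epsilon> t t'"
proof -
  define v where "v p = (SOME i. most_influential n (restrict_path f p) i)" for p
  have v: "most_influential n (restrict_path f p) (v p)" for p
    unfolding v_def using most_influential_exists[OF assms(1)] by (rule someI_ex)
  let ?S = "(\<lambda>p. score n f p (v p)) ` leaves t"
  obtain q where "q \<in> leaves t" "score n f q (v q) = Max ?S"
    using Max_in[of ?S] by fastforce
  then have "topdown_step n f \<epsilon> t (split_leaf t q (v q))"
    by (intro topdown_step.intros) (use assms v in auto)
  then show ?thesis ..
qed

text \<open>If all leaves were constant the error would be 0 and the loop would have stopped. So
  some leaf has a variable of positive influence, its score is positive, and hence so are the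
  maximal score and the influence of the variable queried.\<close>

lemma topdown_step_greedy:
  assumes "pm f" "\<epsilon> \<ge> 0" "greedy n f t" "topdown_step n f \<epsilon> t t'"
  shows "greedy n f t' \<and> dt_size t' = dt_size t + 1"
  using assms(4)
proof cases
  case (1 v q)
  have "\<exists>p\<in>leaves t. \<not> const_on_cube n (restrict_path f p)"
  proof (rule ccontr)
    assume "\<not> ?thesis"
    then have "\<forall>p\<in>leaves t. dt_error n (restrict_path f p) (Leaf ()) = 0"
      using dt_error_leaf_const pm_restrict_path[OF assms(1)] by blast
    then have "dt_error n f t = 0"
      by (subst dt_error_leaves[OF greedy_irredundant[OF assms(3)] greedy_queried[OF assms(3)]]) simp
    then show False using 1(2) assms(2) by (simp add: approximates_iff)
  qed
  then obtain p where p: "p \<in> leaves t" "\<not> const_on_cube n (restrict_path f p)" by blast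
  then obtain i where "i < n" "influence n i (restrict_path f p) \<noteq> 0"
    using const_if_influence_0 by blast
  then have "influence n i (restrict_path f p) > 0" using influence_nonneg by (simp add: order_less_le)
  then have "influence n (v p) (restrict_path f p) > 0"
    using 1(3) p(1) \<open>i < n\<close> unfolding most_influential_def by force
  then have "score n f p (v p) > 0" by (simp add: score_def)
  then have "score n f q (v q) > 0" using 1(5) p(1) by force
  then have "influence n (v q) (restrict_path f q) > 0" by (simp add: score_def zero_less_mult_iff)
  then show ?thesis
    using greedy_split_leaf[OF assms(3) 1(4)] dt_size_split_leaf 1 by auto
qed

lemma topdown_steps_greedy:
  assumes "pm f" "\<epsilon> \<ge> 0" "(topdown_step n f \<epsilon>)\<^sup>*\<^sup>* (Leaf ()) t"
  shows "greedy n f t"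
  using assms(3) by (induction rule: rtranclp_induct) (use assms topdown_step_greedy in auto)

text \<open>A run that never stops would produce greedy trees of every size, against
  \<open>greedy_size\<close>. This makes the infimum in \<open>topdown_dt_size\<close> an attained
  minimum.\<close>

lemma build_topdown_dt_nonempty:
  assumes "pm f" "\<epsilon> \<ge> 0" "n > 0"
  shows "build_topdown_dt n f \<epsilon> \<noteq> {}"
proof
  assume "build_topdown_dt n f \<epsilon> = {}"
  then have no: "\<not> approximates n \<epsilon> (completion n f t) f"
    if "(topdown_step n f \<epsilon>)\<^sup>*\<^sup>* (Leaf ()) t" for t
    using that by (auto simp: build_topdown_dt_def)
  have "\<exists>t. (topdown_step n f \<epsilon>)\<^sup>*\<^sup>* (Leaf ()) t \<and> dt_size t > m" for m
  proof (induction m)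
    case 0
    then show ?case by (intro exI[of _ "Leaf ()"]) simp
  next
    case (Suc m)
    then obtain t where t: "(topdown_step n f \<epsilon>)\<^sup>*\<^sup>* (Leaf ()) t" "dt_size t > m" by blast
    obtain t' where "topdown_step n f \<epsilon> t t'" using topdown_step_exists[OF assms(3) no[OF t(1)]] by blast
    moreover from this have "dt_size t' = dt_size t + 1"
      using topdown_step_greedy[OF assms(1,2)] topdown_steps_greedy[OF assms(1,2) t(1)] by blast
    ultimately show ?case using t by (intro exI[of _ t']) auto
  qed
  from this[of "2 ^ n"] show False
    using greedy_size topdown_steps_greedy[OF assms(1,2)] not_less by blast
qed

text \<open>The only interface to the heuristic for the lower bounds: it suffices to show that every
  greedy tree of small error is large.\<close>

lemma topdown_dt_sizeE:
  assumes "pm f" "\<epsilon> \<ge> 0" "n > 0"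
  obtains t where "greedy n f t" "dt_error n f t \<le> \<epsilon>" "topdown_dt_size n f \<epsilon> = dt_size t"
proof -
  have "Inf (dt_size ` build_topdown_dt n f \<epsilon>) \<in> dt_size ` build_topdown_dt n f \<epsilon>"
    using build_topdown_dt_nonempty[OF assms] by (intro Inf_nat_def1) simp
  then obtain t where "(topdown_step n f \<epsilon>)\<^sup>*\<^sup>* (Leaf ()) t" "dt_error n f t \<le> \<epsilon>"
      "topdown_dt_size n f \<epsilon> = dt_size t"
    by (auto simp: topdown_dt_size_def build_topdown_dt_def approximates_iff)
  then show ?thesis using that topdown_steps_greedy[OF assms(1,2)] by blast
qed

section \<open>Optimal decision trees\<close>

lemma dep_fix_var': "dep V g \<Longrightarrow> dep V (fix_var i b g)"
  by (rule dep_mono[OF dep_fix_var]) auto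

section \<open>Pruned trees and exhaustive trees\<close>

fun prune :: "nat \<Rightarrow> bool \<Rightarrow> 'a dtree \<Rightarrow> 'a dtree" where
  "prune i b (Leaf a) = Leaf a"
| "prune i b (Query j l r) =
     (if j = i then (if b then prune i b r else prune i b l) else Query j (prune i b l) (prune i b r))"

lemma eval_prune: "eval_dt (prune i b T) x = eval_dt T (x(i := b))"
  by (induction T) auto

lemma dt_size_prune: "dt_size (prune i b T) \<le> dt_size T"
  by (induction T) auto

lemma decision_tree_prune: "decision_tree n T \<Longrightarrow> decision_tree n (prune i b T)"
  by (induction T) (auto simp: decision_tree_def)

lemma computes_prune: "computes n T f \<Longrightarrow> i < n \<Longrightarrow> computes n (prune i b T) (fix_var i b f)"
  by (auto simp: computes_def eval_prune fix_var_def cube_upd)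

text \<open>The assignment argument collects the answers on the path; it supplies the values of the
  variables outside the list.\<close>

fun full_tree :: "((nat \<Rightarrow> bool) \<Rightarrow> 'a) \<Rightarrow> nat list \<Rightarrow> (nat \<Rightarrow> bool) \<Rightarrow> 'a dtree" where
  "full_tree f [] x = Leaf (f x)"
| "full_tree f (v # vs) x = Query v (full_tree f vs (x(v := False))) (full_tree f vs (x(v := True)))"

lemma eval_full_tree: "eval_dt (full_tree f vs y) x = f (\<lambda>i. if i \<in> set vs then x i else y i)"
proof (induction vs arbitrary: y)
  case (Cons v vs)
  have "(\<lambda>i. if i \<in> set vs then x i else (y(v := x v)) i)
      = (\<lambda>i. if i \<in> set (v # vs) then x i else y i)" by auto
  then have "eval_dt (full_tree f vs (y(v := x v))) x = f (\<lambda>i. if i \<in> set (v # vs) then x i else y i)"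
    unfolding Cons by (rule arg_cong)
  then show ?case by (cases "x v") simp_all
qed simp

lemma queried_full_tree: "queried (full_tree f vs y) = set vs"
  by (induction vs arbitrary: y) auto

lemma leaf_labels_full_tree: "leaf_labels (full_tree f vs y) \<subseteq> range f"
  by (induction vs arbitrary: y) auto

lemma decision_tree_exists:
  assumes "pm f"
  shows "\<exists>T. decision_tree n T \<and> computes n T f"
proof (intro exI conjI)
  \<comment> \<open>Points of the cube are \<open>undefined\<close> beyond \<open>n\<close>, so with
    this initial assignment the leaf reached by \<open>x\<close> carries exactly
    \<open>f x\<close>.\<close>
  let ?T = "full_tree f [0..<n] (\<lambda>_. undefined)"
  have "range f \<subseteq> {-1, 1}" using assms by (auto simp: pm_def)
  then show "decision_tree n ?T"
    using leaf_labels_full_tree[of f "[0..<n]" "\<lambda>_. undefined"]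
    by (auto simp: decision_tree_def queried_full_tree)
  show "computes n ?T f"
    unfolding computes_def eval_full_tree
    by (auto intro!: arg_cong[of _ _ f] simp: fun_eq_iff cube_def PiE_def extensional_def)
qed

section \<open>Elementary bounds on the optimal size\<close>

lemma opt_dt_size_le: "decision_tree n T \<Longrightarrow> computes n T f \<Longrightarrow> opt_dt_size n f \<le> dt_size T"
  unfolding opt_dt_size_def by (rule cInf_lower) auto

lemma opt_dt_sizeE:
  assumes "pm f"
  obtains T where "decision_tree n T" "computes n T f" "dt_size T = opt_dt_size n f"
proof -
  have "opt_dt_size n f \<in> {dt_size T | T. decision_tree n T \<and> computes n T f}"
    unfolding opt_dt_size_def using decision_tree_exists[OF assms] by (intro Inf_nat_def1) auto
  then show ?thesis using that by auto
qed

lemma dt_size_pos: "0 < dt_size T"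
  by (induction T) auto

lemma opt_dt_size_pos: "pm f \<Longrightarrow> 0 < opt_dt_size n f"
  by (metis opt_dt_sizeE dt_size_pos)

lemma opt_dt_size_const:
  assumes "pm f" "const_on_cube n f"
  shows "opt_dt_size n f = 1"
proof -
  obtain c where c: "\<And>x. x \<in> cube n \<Longrightarrow> f x = c" using assms(2) by (auto simp: const_on_cube_def)
  obtain x0 where "x0 \<in> cube n" using cube_nonempty[of n] by blast
  then have "c \<in> {-1, 1}" using c assms(1) by (auto simp: pm_def)
  then have "opt_dt_size n f \<le> dt_size (Leaf c)"
    by (intro opt_dt_size_le) (auto simp: decision_tree_def computes_def c)
  then show ?thesis using opt_dt_size_pos[OF assms(1), of n] by simp
qed

lemma opt_dt_size_one: "opt_dt_size n (\<lambda>_. 1) = 1"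
  by (rule opt_dt_size_const) (auto simp: pm_def const_on_cube_def)

lemma opt_dt_size_fix_le:
  assumes "pm f" "i < n"
  shows "opt_dt_size n (fix_var i b f) \<le> opt_dt_size n f"
proof -
  obtain T where T: "decision_tree n T" "computes n T f" "dt_size T = opt_dt_size n f"
    using opt_dt_sizeE[OF assms(1)] .
  have "opt_dt_size n (fix_var i b f) \<le> dt_size (prune i b T)"
    using T assms by (intro opt_dt_size_le decision_tree_prune computes_prune)
  then show ?thesis using dt_size_prune[of i b T] T(3) by simp
qed

lemma opt_dt_size_branch_le:
  assumes "pm g" "pm h" "u < n"
  shows "opt_dt_size n (\<lambda>x. if x u then g x else h x) \<le> opt_dt_size n g + opt_dt_size n h"
proof -
  obtain T where T: "decision_tree n T" "computes n T g" "dt_size T = opt_dt_size n g"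
    using opt_dt_sizeE[OF assms(1)] .
  obtain S where S: "decision_tree n S" "computes n S h" "dt_size S = opt_dt_size n h"
    using opt_dt_sizeE[OF assms(2)] .
  have "opt_dt_size n (\<lambda>x. if x u then g x else h x) \<le> dt_size (Query u S T)"
    by (intro opt_dt_size_le) (use T S assms(3) in \<open>auto simp: decision_tree_def computes_def\<close>)
  then show ?thesis using T S by simp
qed

lemma opt_dt_size_split_le:
  assumes "pm f" "i < n"
  shows "opt_dt_size n f \<le> opt_dt_size n (fix_var i False f) + opt_dt_size n (fix_var i True f)"
proof -
  have "(\<lambda>x. if x i then fix_var i True f x else fix_var i False f x) = f"
    by (auto simp: fix_var_def fun_eq_iff fun_upd_idem)
  then show ?thesis
    using opt_dt_size_branch_le[OF pm_fix_var[OF assms(1)] pm_fix_var[OF assms(1)] assms(2),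
        of i True i False] by simp
qed

text \<open>Take the root of an optimal tree. Its subtrees, pruned of further queries of
  \<open>i\<close>, compute the two restrictions, and \<open>opt_dt_size_split_le\<close> gives the
  converse inequality. The two additivity results below are inductions along this recursion.\<close>

lemma opt_dt_size_root:
  assumes "pm f" "\<not> const_on_cube n f"
  obtains i where "i < n"
    "opt_dt_size n f = opt_dt_size n (fix_var i False f) + opt_dt_size n (fix_var i True f)"
proof -
  obtain T where T: "decision_tree n T" "computes n T f" "dt_size T = opt_dt_size n f"
    using opt_dt_sizeE[OF assms(1)] .
  show ?thesis
  proof (cases T)
    case (Leaf c)
    then have "f x = c" if "x \<in> cube n" for x using T(2) that by (simp add: computes_def)
    then show ?thesis using assms(2) by (auto simp: const_on_cube_def)
  next
    case (Query i l r)
    have i: "i < n" using T(1) Query by (auto simp: decision_tree_def)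
    have dt: "decision_tree n l" "decision_tree n r"
      using T(1) Query by (auto simp: decision_tree_def)
    have "computes n (prune i False l) (fix_var i False f)" "computes n (prune i True r) (fix_var i True f)"
      using computes_prune[OF T(2) i, of False] computes_prune[OF T(2) i, of True] Query by simp_all
    then have "opt_dt_size n (fix_var i False f) \<le> dt_size l" "opt_dt_size n (fix_var i True f) \<le> dt_size r"
      using dt opt_dt_size_le[OF decision_tree_prune] dt_size_prune le_trans by metis+
    then have "opt_dt_size n f = opt_dt_size n (fix_var i False f) + opt_dt_size n (fix_var i True f)"
      using T(3) Query opt_dt_size_split_le[OF assms(1) i] by simp
    then show ?thesis using that i by blast
  qed
qed

section \<open>Additivity over disjoint branches\<close>

lemma const_on_cube_fix_var:
  assumes "\<And>b x. x \<in> cube n \<Longrightarrow> fix_var i b g x = c" "x \<in> cube n"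
  shows "g x = c"
  using assms(1)[OF assms(2), of "x i"] by (simp add: fix_var_def fun_upd_idem)

text \<open>If both subfunctions are the same constant, the query of \<open>u\<close> is redundant and the
  equality fails.\<close>

lemma opt_dt_size_branch:
  assumes "pm g" "pm h" "dep G g" "dep H h" "G \<inter> H = {}" "u \<notin> G" "u \<notin> H" "u < n"
    and "\<not> (\<exists>c. \<forall>x\<in>cube n. g x = c \<and> h x = c)"
  shows "opt_dt_size n (\<lambda>x. if x u then g x else h x) = opt_dt_size n g + opt_dt_size n h"
proof -
  have "opt_dt_size n (\<lambda>x. if x u then g x else h x) \<ge> opt_dt_size n g + opt_dt_size n h"
    using assms(1-4,9)
  proof (induction "opt_dt_size n (\<lambda>x. if x u then g x else h x)" arbitrary: g h rule: less_induct)
    case less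
    let ?F = "\<lambda>x. if x u then g x else h x"
    note pm = less.prems(1,2) and dep = less.prems(3,4)
    have pmF: "pm ?F" using pm by (simp add: pm_def)
    have fix_u: "fix_var u True ?F = g" "fix_var u False ?F = h"
      using fix_var_dep[OF dep(1) assms(6)] fix_var_dep[OF dep(2) assms(7)]
      by (auto simp: fix_var_def fun_eq_iff)
    have "\<not> const_on_cube n ?F"
    proof
      assume "const_on_cube n ?F"
      then obtain c where c: "\<And>x. x \<in> cube n \<Longrightarrow> ?F x = c" by (auto simp: const_on_cube_def)
      have "g x = c \<and> h x = c" if "x \<in> cube n" for x
        using c[OF cube_upd[OF that assms(8)], of True] c[OF cube_upd[OF that assms(8)], of False]
          dep_upd[OF dep(1) assms(6)] dep_upd[OF dep(2) assms(7)] by simp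
      then show False using less.prems(5) by blast
    qed
    then obtain i where i: "i < n"
      and root: "opt_dt_size n ?F = opt_dt_size n (fix_var i False ?F) + opt_dt_size n (fix_var i True ?F)"
      using opt_dt_size_root[OF pmF] by blast
    show ?case
    proof (cases "i = u")
      case True
      then show ?thesis using root fix_u by simp
    next
      case False
      have Fb: "fix_var i b ?F = (\<lambda>x. if x u then fix_var i b g x else fix_var i b h x)" for b
        using False by (auto simp: fix_var_def)
      have lt: "opt_dt_size n (fix_var i b ?F) < opt_dt_size n ?F" for b
        using root opt_dt_size_pos[OF pm_fix_var[OF pmF], of n i True]
          opt_dt_size_pos[OF pm_fix_var[OF pmF], of n i False] by (cases b) auto
      \<comment> \<open>For a root \<open>i\<close> other than \<open>u\<close> both restrictions
        have the branching form again. The induction hypothesis applies unless fixing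
        \<open>i\<close> turns both branches into the same constant, which is the case isolated
        here.\<close>
      define bad where
        "bad b \<longleftrightarrow> (\<exists>c. \<forall>x\<in>cube n. fix_var i b g x = c \<and> fix_var i b h x = c)" for b
      have good: "opt_dt_size n (fix_var i b ?F) \<ge> opt_dt_size n (fix_var i b g) + opt_dt_size n (fix_var i b h)"
        if "\<not> bad b" for b
        unfolding Fb
        by (rule less.hyps)
           (use lt[of b] that in \<open>auto simp: Fb bad_def pm pm_fix_var dep dep_fix_var'\<close>)
      have bad1: "opt_dt_size n (fix_var i b g) = 1 \<and> opt_dt_size n (fix_var i b h) = 1" if "bad b" for b
      proof -
        have "const_on_cube n (fix_var i b g)" "const_on_cube n (fix_var i b h)"
          using that by (auto simp: bad_def const_on_cube_def)
        then show ?thesis using opt_dt_size_const[OF pm_fix_var] pm by simp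
      qed
      have pos: "opt_dt_size n (fix_var i b ?F) > 0" for b
        by (rule opt_dt_size_pos[OF pm_fix_var[OF pmF]])
      have not_both: "\<not> (bad False \<and> bad True)"
      proof
        assume b: "bad False \<and> bad True"
        then obtain c d where c: "\<And>x. x \<in> cube n \<Longrightarrow> fix_var i False g x = c \<and> fix_var i False h x = c"
          and d: "\<And>x. x \<in> cube n \<Longrightarrow> fix_var i True g x = d \<and> fix_var i True h x = d"
          by (auto simp: bad_def)
        obtain x0 where x0: "x0 \<in> cube n" using cube_nonempty[of n] by blast
        \<comment> \<open>At most one of \<open>g\<close> and \<open>h\<close> depends on
          \<open>i\<close>; the other one has the same constant value for both answers.\<close>
        have "c = d"
          using c[OF x0] d[OF x0] fix_var_dep[OF dep(1), of i] fix_var_dep[OF dep(2), of i] assms(5)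
          by (metis disjoint_iff)
        then have "fix_var i b g x = c" "fix_var i b h x = c" if "x \<in> cube n" for b x
          using c[OF that] d[OF that] by (cases b; simp; fail)+
        then have "g x = c" "h x = c" if "x \<in> cube n" for x
          using const_on_cube_fix_var[of n i g c x] const_on_cube_fix_var[of n i h c x] that by blast+
        then show False using less.prems(5) by blast
      qed
      have split: "opt_dt_size n g \<le> opt_dt_size n (fix_var i False g) + opt_dt_size n (fix_var i True g)"
        "opt_dt_size n h \<le> opt_dt_size n (fix_var i False h) + opt_dt_size n (fix_var i True h)"
        using opt_dt_size_split_le pm i by blast+
      have mono: "opt_dt_size n (fix_var i b g) \<le> opt_dt_size n g" "opt_dt_size n (fix_var i b h) \<le> opt_dt_size n h" for b
        using opt_dt_size_fix_le pm i by blast+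
      have same: "(\<forall>b. fix_var i b g = g) \<or> (\<forall>b. fix_var i b h = h)"
        using fix_var_dep dep assms(5) by (metis disjoint_iff)
      \<comment> \<open>One of the branches ignores \<open>i\<close> and is already counted in full
        under the answer \<open>\<not> b\<close>. The other has size 1 under \<open>b\<close>, and
        the one leaf that any tree has there pays for it.\<close>
      have badb: "opt_dt_size n (fix_var i b ?F) + opt_dt_size n (fix_var i (\<not> b) ?F) \<ge> opt_dt_size n g + opt_dt_size n h"
        if b: "bad b" for b
      proof -
        have "\<not> bad (\<not> b)" using b not_both by (cases b) auto
        from good[OF this] bad1[OF b] pos[of b] split same show ?thesis
          by (cases b) auto
      qed
      show ?thesis
      proof (cases "bad False \<or> bad True")
        case True
        then show ?thesis using badb[of False] badb[of True] root by auto
      next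
        case False
        then show ?thesis using good[of False] good[of True] root split by simp
      qed
    qed
  qed
  then show ?thesis using opt_dt_size_branch_le[OF assms(1,2,8)] by simp
qed

section \<open>Functions of prescribed optimal size\<close>

lemma eval_map_dtree: "eval_dt (map_dtree F T) x = F (eval_dt T x)"
  by (induction T) auto

lemma queried_map_dtree: "queried (map_dtree F T) = queried T"
  by (induction T) auto

lemma dt_size_map_dtree: "dt_size (map_dtree F T) = dt_size T"
  by (induction T) auto

lemma pm_uminus: "pm h \<Longrightarrow> pm (\<lambda>x. - h x)"
  by (auto simp: pm_def)

lemma opt_dt_size_uminus_le:
  assumes "pm h"
  shows "opt_dt_size n (\<lambda>x. - h x) \<le> opt_dt_size n h"
proof -
  obtain T where T: "decision_tree n T" "computes n T h" "dt_size T = opt_dt_size n h"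
    using opt_dt_sizeE[OF assms] .
  have "opt_dt_size n (\<lambda>x. - h x) \<le> dt_size (map_dtree uminus T)"
    by (intro opt_dt_size_le)
       (use T in \<open>auto simp: decision_tree_def computes_def eval_map_dtree queried_map_dtree dtree.set_map\<close>)
  then show ?thesis using T by (simp add: dt_size_map_dtree)
qed

lemma opt_dt_size_uminus: "pm h \<Longrightarrow> opt_dt_size n (\<lambda>x. - h x) = opt_dt_size n h"
  using opt_dt_size_uminus_le[of h n] opt_dt_size_uminus_le[OF pm_uminus, of h n] by simp

text \<open>The branches \<open>h\<close> and \<open>- h\<close> share their variables, so
  \<open>opt_dt_size_branch\<close> does not apply. But they never agree at any point, and
  restrictions keep this form, so the induction has no exceptional case.\<close>

lemma opt_dt_size_xor:
  assumes "pm h" "dep H h" "u \<notin> H" "u < n"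
  shows "opt_dt_size n (\<lambda>x. if x u then - h x else h x) = 2 * opt_dt_size n h"
proof -
  have "opt_dt_size n (\<lambda>x. if x u then - h x else h x) \<ge> 2 * opt_dt_size n h"
    using assms(1,2)
  proof (induction "opt_dt_size n (\<lambda>x. if x u then - h x else h x)" arbitrary: h rule: less_induct)
    case less
    let ?F = "\<lambda>x. if x u then - h x else h x"
    note pm = less.prems(1) and dep = less.prems(2)
    have pmF: "pm ?F" using pm by (auto simp: pm_def)
    have "\<not> const_on_cube n ?F"
    proof
      assume "const_on_cube n ?F"
      then obtain c where c: "\<And>x. x \<in> cube n \<Longrightarrow> ?F x = c" by (auto simp: const_on_cube_def)
      obtain x where x: "x \<in> cube n" using cube_nonempty[of n] by blast
      have "h x = - h x"
        using c[OF cube_upd[OF x assms(4)], of True] c[OF cube_upd[OF x assms(4)], of False]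
          dep_upd[OF dep assms(3)] by simp
      then show False using pm by (auto simp: pm_def dest: spec[of _ x])
    qed
    then obtain i where i: "i < n"
      and root: "opt_dt_size n ?F = opt_dt_size n (fix_var i False ?F) + opt_dt_size n (fix_var i True ?F)"
      using opt_dt_size_root[OF pmF] by blast
    show ?case
    proof (cases "i = u")
      case True
      have "fix_var u True ?F = (\<lambda>x. - h x)" "fix_var u False ?F = h"
        using dep_upd[OF dep assms(3)] by (auto simp: fix_var_def fun_eq_iff)
      then show ?thesis using True root opt_dt_size_uminus[OF pm, of n] by simp
    next
      case False
      have Fb: "fix_var i b ?F = (\<lambda>x. if x u then - fix_var i b h x else fix_var i b h x)" for b
        using False by (auto simp: fix_var_def)
      have lt: "opt_dt_size n (fix_var i b ?F) < opt_dt_size n ?F" for b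
        using root opt_dt_size_pos[OF pm_fix_var[OF pmF], of n i True]
          opt_dt_size_pos[OF pm_fix_var[OF pmF], of n i False] by (cases b) auto
      have "opt_dt_size n (fix_var i b ?F) \<ge> 2 * opt_dt_size n (fix_var i b h)" for b
        unfolding Fb
        by (rule less.hyps) (use lt[of b] in \<open>auto simp: Fb pm pm_fix_var dep dep_fix_var'\<close>)
      from this[of False] this[of True] show ?thesis
        using root opt_dt_size_split_le[OF pm i] by linarith
    qed
  qed
  moreover have "opt_dt_size n (\<lambda>x. if x u then - h x else h x) \<le> 2 * opt_dt_size n h"
    using opt_dt_size_branch_le[OF pm_uminus[OF assms(1)] assms(1,4)]
    by (simp add: opt_dt_size_uminus[OF assms(1)])
  ultimately show ?thesis by simp
qed

text \<open>Follows the binary digits of \<open>A\<close>: xor with a fresh variable doubles the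
  size, and a branch to a constant on another fresh variable adds 1. Hence two variables per
  digit.\<close>

lemma opt_dt_size_attained:
  assumes "1 \<le> A" "A \<le> 2 ^ m" "off + 2 * m \<le> n"
  shows "\<exists>h. pm h \<and> dep {off..<off + 2 * m} h \<and> opt_dt_size n h = A"
  using assms
proof (induction m arbitrary: A)
  case 0
  then show ?case
    by (intro exI[of _ "\<lambda>_. 1"]) (auto simp: pm_def dep_def opt_dt_size_one)
next
  case (Suc m)
  show ?case
  proof (cases "A = 1")
    case True
    then show ?thesis
      by (intro exI[of _ "\<lambda>_. 1"]) (auto simp: pm_def dep_def opt_dt_size_one)
  next
    case False
    have "1 \<le> A div 2" "A div 2 \<le> 2 ^ m" "off + 2 * m \<le> n" using Suc.prems False by auto
    from Suc.IH[OF this] obtain h where h: "pm h" "dep {off..<off + 2 * m} h" "opt_dt_size n h = A div 2"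
      by blast
    let ?u = "off + 2 * m"
    let ?h2 = "\<lambda>x. if x ?u then - h x else h x"
    have opt2: "opt_dt_size n ?h2 = 2 * (A div 2)"
      using opt_dt_size_xor[OF h(1,2), of ?u n] Suc.prems h(3) by simp
    have pm2: "pm ?h2" using h(1) by (auto simp: pm_def)
    have dep2: "dep {off..<off + 2 * m + 1} ?h2"
    proof (unfold dep_def, intro allI impI)
      fix x y :: "nat \<Rightarrow> bool" assume eq: "\<forall>i\<in>{off..<off + 2 * m + 1}. x i = y i"
      then have "h x = h y" by (intro depD[OF h(2)]) auto
      then show "?h2 x = ?h2 y" using eq by simp
    qed
    show ?thesis
    proof (cases "even A")
      case True
      then show ?thesis using opt2 pm2 dep_mono[OF dep2] by (intro exI[of _ ?h2]) auto
    next
      case odd: False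
      \<comment> \<open>Chosen so that the new leaf and \<open>?h2\<close> are not the same
        constant, the exception in \<open>opt_dt_size_branch\<close>.\<close>
      define c :: real where "c = (if \<forall>x\<in>cube n. ?h2 x = 1 then -1 else 1)"
      obtain x0 where x0: "x0 \<in> cube n" using cube_nonempty[of n] by blast
      have nc: "\<not> (\<exists>d. \<forall>x\<in>cube n. c = d \<and> ?h2 x = d)"
        using x0 by (auto simp: c_def split: if_splits)
      have pmc: "pm (\<lambda>_. c)" by (simp add: pm_def c_def)
      let ?v = "off + 2 * m + 1"
      let ?h3 = "\<lambda>x. if x ?v then c else ?h2 x"
      have "opt_dt_size n ?h3 = opt_dt_size n (\<lambda>_. c) + opt_dt_size n ?h2"
      proof (rule opt_dt_size_branch[OF pmc pm2 _ dep2])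
        show "dep {} (\<lambda>_. c)" by (simp add: dep_def)
        show "\<not> (\<exists>d. \<forall>x\<in>cube n. c = d \<and> ?h2 x = d)" by (rule nc)
      qed (use Suc.prems in auto)
      also have "opt_dt_size n (\<lambda>_. c) = 1"
        by (rule opt_dt_size_const[OF pmc]) (auto simp: const_on_cube_def)
      finally have "opt_dt_size n ?h3 = A" using opt2 odd by simp
      moreover have "pm ?h3" using pm2 pmc by (simp add: pm_def)
      moreover have "dep {off..<off + 2 * Suc m} ?h3"
      proof (unfold dep_def, intro allI impI)
        fix x y :: "nat \<Rightarrow> bool" assume eq: "\<forall>i\<in>{off..<off + 2 * Suc m}. x i = y i"
        then have "?h2 x = ?h2 y" by (intro depD[OF dep2]) auto
        then show "?h3 x = ?h3 y" using eq by simp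
      qed
      ultimately show ?thesis by (intro exI[of _ ?h3] conjI)
    qed
  qed
qed

section \<open>A lower bound from relevant variables\<close>

lemma card_queried_less_dt_size: "card (queried t) < dt_size t"
proof (induction t)
  case (Query i l r)
  have "card (insert i (queried l \<union> queried r)) \<le> Suc (card (queried l \<union> queried r))"
    by (rule card_insert_le_m1) auto
  then show ?case using Query card_Un_le[of "queried l" "queried r"] by simp
qed simp

text \<open>An exact tree queries every variable whose flip can change the value, and a tree has
  fewer inner nodes than leaves.\<close>

lemma relevant_less_opt_dt_size:
  assumes "pm f" "\<And>i. i \<in> V \<Longrightarrow> \<exists>x\<in>cube n. i < n \<and> f (x(i := \<not> x i)) \<noteq> f x"
  shows "card V < opt_dt_size n f"
proof -
  obtain T where T: "decision_tree n T" "computes n T f" "dt_size T = opt_dt_size n f"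
    using opt_dt_sizeE[OF assms(1)] .
  have "i \<in> queried T" if iV: "i \<in> V" for i
  proof (rule ccontr)
    assume no: "i \<notin> queried T"
    obtain x where "x \<in> cube n" "i < n" "f (x(i := \<not> x i)) \<noteq> f x" using assms(2)[OF iV] by blast
    then show False using eval_upd[OF no, of x "\<not> x i"] T(2) cube_upd[of x n i]
      by (auto simp: computes_def)
  qed
  then have "card V \<le> card (queried T)" by (intro card_mono) auto
  then show ?thesis using card_queried_less_dt_size[of T] T(3) by simp
qed

section \<open>Exact representation\<close>

fun chain :: "nat \<Rightarrow> nat \<Rightarrow> (nat \<Rightarrow> bool) \<Rightarrow> real" where
  "chain l 0 x = 1"
| "chain l (Suc m) x =
     (if x (3 * l) \<and> x (3 * l + 1) then chain (Suc l) m x else if x (3 * l + 2) then 1 else -1)"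

lemma pm_chain: "pm (chain l m)"
proof -
  have "chain l m x = 1 \<or> chain l m x = -1" for x
    by (induction m arbitrary: l) auto
  then show ?thesis by (simp add: pm_def)
qed

lemma chain_upd: "i < 3 * l \<Longrightarrow> chain l m (x(i := b)) = chain l m x"
  by (induction m arbitrary: l) auto

text \<open>The shape of the restrictions of \<^term>\<open>chain 0\<close> on the greedy paths that agree with all
  guards they query: \<open>U\<close> holds the unqueried guards of the levels below \<open>l\<close>, where the payload
  variables have all been queried.\<close>

definition chain_state :: "nat \<Rightarrow> nat \<Rightarrow> nat set \<Rightarrow> ((nat \<Rightarrow> bool) \<Rightarrow> real) \<Rightarrow> bool" where
  "chain_state l m U g \<longleftrightarrow> U \<subseteq> {..<3 * l} \<and>
     (\<forall>x. (\<forall>u\<in>U. x u) \<longrightarrow> g x = chain l m x) \<and>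
     (\<forall>x y. (\<forall>u\<in>U. x u = y u) \<longrightarrow> \<not> (\<forall>u\<in>U. x u) \<longrightarrow> g x = g y)"

text \<open>The payload of level \<open>l\<close> decides when all of \<open>U\<close> are 1 and
  some guard of level \<open>l\<close> is 0. This event is the difference of two conjunctions, which
  gives \<open>1 - 1/4 = 3/4\<close> of the probability of the first.\<close>

lemma chain_state_payload_influence:
  assumes "chain_state l (Suc m) U g" "3 * (l + Suc m) \<le> n"
  shows "influence n (3 * l + 2) g \<ge> 3/4 * (1/2) ^ card U"
proof -
  have U: "U \<subseteq> {..<3 * l}" using assms(1) by (simp add: chain_state_def)
  then have fin: "finite U" using finite_subset by blast
  let ?W = "insert (3 * l) (insert (3 * l + 1) U)"
  have "3/4 * (1/2) ^ card U = (1/2 :: real) ^ card U - (1/2) ^ card ?W"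
    using U fin by (auto simp: card_insert_if)
  also have "\<dots> = avg n (\<lambda>x. of_bool (\<forall>i\<in>U. x i) - of_bool (\<forall>i\<in>?W. x i))"
    unfolding avg_diff using U assms(2) by (subst (1 2) avg_all_true) auto
  also have "\<dots> \<le> influence n (3 * l + 2) g"
    unfolding influence_avg
  proof (rule avg_mono)
    fix x
    let ?y = "x(3 * l + 2 := \<not> x (3 * l + 2))"
    have "g x \<noteq> g ?y" if "\<forall>i\<in>U. x i" "\<not> (\<forall>i\<in>?W. x i)"
    proof -
      have "\<forall>i\<in>U. ?y i" using that(1) U by auto
      then have "g x = chain l (Suc m) x" "g ?y = chain l (Suc m) ?y"
        using assms(1) that(1) by (auto simp: chain_state_def)
      then show ?thesis using that by auto
    qed
    then show "of_bool (\<forall>i\<in>U. x i) - of_bool (\<forall>i\<in>?W. x i) \<le> (of_bool (g x \<noteq> g ?y) :: real)"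
      by (cases "\<forall>i\<in>U. x i"; cases "\<forall>i\<in>?W. x i") auto
  qed
  finally show ?thesis .
qed

lemma chain_state_other_influence:
  assumes "chain_state l (Suc m) U g" "3 * (l + Suc m) \<le> n" "v \<notin> U" "v \<noteq> 3 * l + 2"
  shows "influence n v g \<le> 1/2 * (1/2) ^ card U"
proof -
  have U: "U \<subseteq> {..<3 * l}" using assms(1) by (simp add: chain_state_def)
  then have fin: "finite U" using finite_subset by blast
  \<comment> \<open>A guard of level \<open>l\<close> other than \<open>v\<close>. If
    \<open>w\<close> is 0, then, provided \<open>U\<close> holds, the payload of level
    \<open>l\<close> decides whatever \<open>v\<close> is; so \<open>v\<close> can matter only when
    \<open>w\<close> and all of \<open>U\<close> are 1.\<close>
  define w where "w = (if v = 3 * l then 3 * l + 1 else 3 * l)"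
  have w: "w \<noteq> v" "w \<notin> U" "w < n" using U assms(2) by (auto simp: w_def)
  have "influence n v g \<le> avg n (\<lambda>x. of_bool (\<forall>i\<in>insert w U. x i))"
    unfolding influence_avg
  proof (rule avg_mono)
    fix x
    let ?y = "x(v := \<not> x v)"
    have "g x = g ?y" if "\<not> (\<forall>i\<in>insert w U. x i)"
    proof (cases "\<forall>i\<in>U. x i")
      case True
      then have "\<not> x w" using that by auto
      have "\<forall>i\<in>U. ?y i" using True assms(3) by auto
      then have "g x = chain l (Suc m) x" "g ?y = chain l (Suc m) ?y"
        using assms(1) True by (auto simp: chain_state_def)
      moreover have "chain l (Suc m) x = (if x (3 * l + 2) then 1 else -1)"
        using \<open>\<not> x w\<close> by (auto simp: w_def split: if_splits)
      moreover have "chain l (Suc m) ?y = (if x (3 * l + 2) then 1 else -1)"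
        using \<open>\<not> x w\<close> assms(4) by (auto simp: w_def split: if_splits)
      ultimately show ?thesis by simp
    next
      case False
      moreover have "\<forall>u\<in>U. x u = ?y u" using assms(3) by auto
      ultimately show ?thesis using assms(1) unfolding chain_state_def by blast
    qed
    then show "of_bool (g x \<noteq> g ?y) \<le> (of_bool (\<forall>i\<in>insert w U. x i) :: real)"
      by (cases "\<forall>i\<in>insert w U. x i") auto
  qed
  also have "\<dots> = (1/2) ^ card (insert w U)"
    by (rule avg_all_true) (use w U assms(2) in auto)
  finally show ?thesis using w fin by simp
qed

lemma chain_state_fix_guard:
  assumes "chain_state l m U g" "u \<in> U"
  shows "chain_state l m (U - {u}) (fix_var u True g)"
proof -
  have U: "U \<subseteq> {..<3 * l}" using assms(1) by (simp add: chain_state_def)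
  have 1: "fix_var u True g x = chain l m x" if "\<forall>v\<in>U - {u}. x v" for x
  proof -
    have "\<forall>v\<in>U. (x(u := True)) v" using that by auto
    then have "g (x(u := True)) = chain l m (x(u := True))"
      using assms(1) unfolding chain_state_def by blast
    then show ?thesis using chain_upd U assms(2) by (auto simp: fix_var_def)
  qed
  have 2: "fix_var u True g x = fix_var u True g y"
    if "\<forall>v\<in>U - {u}. x v = y v" "\<not> (\<forall>v\<in>U - {u}. x v)" for x y
  proof -
    have "\<forall>v\<in>U. (x(u := True)) v = (y(u := True)) v" "\<not> (\<forall>v\<in>U. (x(u := True)) v)"
      using that by auto
    then show ?thesis using assms(1) unfolding chain_state_def fix_var_def by blast
  qed
  show ?thesis unfolding chain_state_def using U 1 2 by blast
qed

lemma chain_state_fix_payload: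
  assumes "chain_state l (Suc m) U g"
  shows "chain_state (Suc l) m (insert (3 * l) (insert (3 * l + 1) U)) (fix_var (3 * l + 2) b g)"
proof -
  let ?v = "3 * l + 2" and ?W = "insert (3 * l) (insert (3 * l + 1) U)"
  have U: "U \<subseteq> {..<3 * l}" using assms by (simp add: chain_state_def)
  have all: "g (x(?v := b)) = chain l (Suc m) (x(?v := b))" if "\<forall>u\<in>U. x u" for x
  proof -
    have "\<forall>u\<in>U. (x(?v := b)) u" using that U by auto
    then show ?thesis using assms unfolding chain_state_def by blast
  qed
  have 1: "fix_var ?v b g x = chain (Suc l) m x" if "\<forall>v\<in>?W. x v" for x
    using all[of x] that by (simp add: fix_var_def chain_upd)
  have 2: "fix_var ?v b g x = fix_var ?v b g y"
    if "\<forall>v\<in>?W. x v = y v" "\<not> (\<forall>v\<in>?W. x v)" for x y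
  proof (cases "\<forall>u\<in>U. x u")
    case True
    then have "\<forall>u\<in>U. y u" using that by auto
    moreover have "\<not> (x (3 * l) \<and> x (3 * l + 1))" "\<not> (y (3 * l) \<and> y (3 * l + 1))"
      using that True by auto
    ultimately show ?thesis using all[of x] all[of y] True by (auto simp: fix_var_def)
  next
    case False
    have "?v \<notin> U" using U by auto
    then have "(\<forall>u\<in>U. (x(?v := b)) u) \<longleftrightarrow> (\<forall>u\<in>U. x u)"
      by (intro ball_cong) auto
    then have "\<forall>u\<in>U. (x(?v := b)) u = (y(?v := b)) u" "\<not> (\<forall>u\<in>U. (x(?v := b)) u)"
      using that(1) False by auto
    then show ?thesis using assms unfolding chain_state_def fix_var_def by blast
  qed
  have 3: "?W \<subseteq> {..<3 * Suc l}" using U by auto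
  show ?thesis unfolding chain_state_def using 1 2 3 by blast
qed

text \<open>If the root queries an old guard, only the subtree for answer 1 is followed, where the
  state persists with one guard less. Otherwise the strict gap between 3/4 and 1/2 forces the next
  payload, and both subtrees are left with \<open>m - 1\<close> levels: this is the doubling. A leaf
  with \<open>m > 0\<close> is impossible since the payload still has positive influence.\<close>

lemma chain_greedy_size:
  assumes "greedy n g t" "\<And>p. p \<in> leaves t \<Longrightarrow> const_on_cube n (restrict_path g p)"
    "chain_state l m U g" "3 * (l + m) \<le> n"
  shows "2 ^ m \<le> dt_size t"
  using assms
proof (induction t arbitrary: g l m U)
  case (Leaf a)
  show ?case
  proof (cases m)
    case (Suc m')
    have "const_on_cube n g" using Leaf.prems(2)[of "[]"] by simp
    moreover have "3 * l + 2 < n" using Leaf.prems(4) Suc by simp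
    ultimately have "influence n (3 * l + 2) g = 0"
      unfolding influence_eq_0_iff const_on_cube_def using cube_upd by metis
    moreover have "3/4 * (1/2) ^ card U \<le> influence n (3 * l + 2) g"
      by (rule chain_state_payload_influence) (use Leaf.prems(3,4) Suc in auto)
    moreover have "0 < (1/2 :: real) ^ card U" by simp
    ultimately show ?thesis by linarith
  qed simp
next
  case (Query i t0 t1)
  have i: "most_influential n g i" and gr: "greedy n (fix_var i False g) t0" "greedy n (fix_var i True g) t1"
    using Query.prems(1) by auto
  have lv: "p \<in> leaves t0 \<Longrightarrow> const_on_cube n (restrict_path (fix_var i False g) p)"
    "p \<in> leaves t1 \<Longrightarrow> const_on_cube n (restrict_path (fix_var i True g) p)" for p
    using Query.prems(2)[of "(i, False) # p"] Query.prems(2)[of "(i, True) # p"] by auto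
  show ?case
  proof (cases m)
    case 0
    then show ?thesis using dt_size_pos[of t0] by simp
  next
    case (Suc m')
    show ?thesis
    proof (cases "i \<in> U")
      case True
      have "2 ^ m \<le> dt_size t1"
        by (rule Query.IH(2)[OF gr(2) lv(2) chain_state_fix_guard[OF Query.prems(3) True] Query.prems(4)])
      then show ?thesis by simp
    next
      case False
      note st = Query.prems(3)[unfolded Suc] and n = Query.prems(4)[unfolded Suc]
      have pos: "(1/2 :: real) ^ card U > 0" by simp
      have "i = 3 * l + 2"
      proof (rule ccontr)
        assume "i \<noteq> 3 * l + 2"
        then have "influence n i g \<le> 1/2 * (1/2) ^ card U"
          using chain_state_other_influence[OF st n False] by simp
        moreover have "influence n (3 * l + 2) g \<le> influence n i g"
          using i n by (simp add: most_influential_def)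
        ultimately show False using chain_state_payload_influence[OF st n] pos by linarith
      qed
      then have st': "chain_state (Suc l) m' (insert (3 * l) (insert (3 * l + 1) U)) (fix_var i b g)" for b
        using chain_state_fix_payload[OF st] by simp
      have n': "3 * (Suc l + m') \<le> n" using n by simp
      have "2 ^ m' \<le> dt_size t0" "2 ^ m' \<le> dt_size t1"
        using Query.IH(1)[OF gr(1) lv(1) st' n'] Query.IH(2)[OF gr(2) lv(2) st' n'] by auto
      then show ?thesis using Suc by simp
    qed
  qed
qed

lemma topdown_dt_size_chain:
  assumes "m > 0"
  shows "2 ^ m \<le> topdown_dt_size (3 * m) (chain 0 m) 0"
proof -
  obtain t where t: "greedy (3 * m) (chain 0 m) t" "dt_error (3 * m) (chain 0 m) t \<le> 0"
    "topdown_dt_size (3 * m) (chain 0 m) 0 = dt_size t"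
    using topdown_dt_sizeE[OF pm_chain, of 0 "3 * m" 0 m] assms by auto
  have "dt_error (3 * m) (chain 0 m) t = 0" using t(2) dt_error_nonneg by (simp add: order_antisym)
  then have "(\<Sum>p\<in>leaves t. (1/2) ^ length p * dt_error (3 * m) (restrict_path (chain 0 m) p) (Leaf ())) = 0"
    using dt_error_leaves[OF greedy_irredundant[OF t(1)] greedy_queried[OF t(1)]] by metis
  then have "\<forall>p\<in>leaves t. (1/2) ^ length p * dt_error (3 * m) (restrict_path (chain 0 m) p) (Leaf ()) = 0"
    by (subst (asm) sum_nonneg_eq_0_iff) (auto simp: dt_error_nonneg)
  then have "const_on_cube (3 * m) (restrict_path (chain 0 m) p)" if "p \<in> leaves t" for p
    using that dt_error_leaf_0_const by auto
  moreover have "chain_state 0 m {} (chain 0 m)" by (simp add: chain_state_def)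
  ultimately show ?thesis using chain_greedy_size[OF t(1), of 0 m "{}"] t(3) by simp
qed

section \<open>Optimal size of the chain\<close>

lemma opt_dt_size_literal_le:
  assumes "i < n"
  shows "opt_dt_size n (\<lambda>x. if x i then 1 else -1) \<le> 2"
proof -
  have c: "pm (\<lambda>_. 1)" "pm (\<lambda>_. -1)" by (auto simp: pm_def)
  have "opt_dt_size n (\<lambda>_. -1) = 1"
    by (rule opt_dt_size_const[OF c(2)]) (auto simp: const_on_cube_def)
  then show ?thesis using opt_dt_size_branch_le[OF c assms] by (simp add: opt_dt_size_one)
qed

text \<open>Guards are queried before payloads, so each level adds two copies of a literal with two
  leaves each.\<close>

lemma opt_dt_size_chain_le:
  assumes "3 * (l + m) \<le> n"
  shows "opt_dt_size n (chain l m) \<le> 4 * m + 1"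
  using assms
proof (induction m arbitrary: l)
  case 0
  then show ?case using opt_dt_size_one by simp
next
  case (Suc m)
  let ?y = "\<lambda>x. if x (3 * l + 2) then 1 else (-1::real)"
  let ?g = "\<lambda>x. if x (3 * l + 1) then chain (Suc l) m x else ?y x"
  have pm: "pm ?y" "pm ?g" using pm_chain[of "Suc l" m] by (auto simp: pm_def)
  have eq: "chain l (Suc m) = (\<lambda>x. if x (3 * l) then ?g x else ?y x)" by auto
  have y: "opt_dt_size n ?y \<le> 2" by (rule opt_dt_size_literal_le) (use Suc.prems in simp)
  have 1: "opt_dt_size n (chain l (Suc m)) \<le> opt_dt_size n ?g + opt_dt_size n ?y"
    unfolding eq by (rule opt_dt_size_branch_le) (use pm Suc.prems in auto)
  have 2: "opt_dt_size n ?g \<le> opt_dt_size n (chain (Suc l) m) + opt_dt_size n ?y"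
    by (rule opt_dt_size_branch_le) (use pm pm_chain Suc.prems in auto)
  have 3: "opt_dt_size n (chain (Suc l) m) \<le> 4 * m + 1"
    using Suc.IH[of "Suc l"] Suc.prems by simp
  have "a \<le> b + d \<Longrightarrow> b \<le> c + d \<Longrightarrow> c \<le> 4 * m + 1 \<Longrightarrow> d \<le> 2 \<Longrightarrow> a \<le> 4 * Suc m + 1" for a b c d :: nat
    by simp
  from this[OF 1 2 3 y] show ?case .
qed

lemma chain_eval:
  "(\<And>j. 3 * l \<le> j \<Longrightarrow> j < 3 * (l + i) \<Longrightarrow> x j) \<Longrightarrow> \<not> x (3 * (l + i)) \<Longrightarrow> i < m \<Longrightarrow>
   chain l m x = (if x (3 * (l + i) + 2) then 1 else -1)"
proof (induction m arbitrary: l i)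
  case (Suc m)
  show ?case
  proof (cases i)
    case 0
    then show ?thesis using Suc.prems by simp
  next
    case (Suc i')
    have "x (3 * l)" "x (3 * l + 1)" using Suc.prems(1) Suc by auto
    moreover have "chain (Suc l) m x = (if x (3 * (Suc l + i') + 2) then 1 else -1)"
      by (rule Suc.IH) (use Suc.prems Suc in auto)
    ultimately show ?thesis using Suc by simp
  qed
qed simp

lemma opt_dt_size_chain_gt: "m < opt_dt_size (3 * m) (chain 0 m)"
proof -
  have "card ((\<lambda>i. 3 * i + 2) ` {..<m}) < opt_dt_size (3 * m) (chain 0 m)"
  proof (rule relevant_less_opt_dt_size[OF pm_chain])
    fix v assume "v \<in> (\<lambda>i. 3 * i + 2) ` {..<m}"
    then obtain i where i: "i < m" "v = 3 * i + 2" by auto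
    \<comment> \<open>All earlier levels pass, and level \<open>i\<close> stops at its first guard,
      so the value is the payload \<open>v\<close>.\<close>
    let ?x = "restrict (\<lambda>j. j < 3 * i) {..<3 * m}"
    let ?y = "?x(v := \<not> ?x v)"
    have "chain 0 m ?x = (if ?x (3 * (0 + i) + 2) then 1 else -1)"
      by (rule chain_eval) (use i in auto)
    moreover have "chain 0 m ?y = (if ?y (3 * (0 + i) + 2) then 1 else -1)"
      by (rule chain_eval) (use i in auto)
    ultimately have "chain 0 m ?y \<noteq> chain 0 m ?x" using i by simp
    then show "\<exists>x\<in>cube (3 * m). v < 3 * m \<and> chain 0 m (x(v := \<not> x v)) \<noteq> chain 0 m x"
      using i by (intro bexI[of _ ?x]) (auto simp: restrict_in_cube)
  qed
  then show ?thesis by (simp add: card_image inj_on_def)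
qed

lemma exact_lower_bound:
  "\<exists>(N :: nat set) (f :: nat \<Rightarrow> (nat \<Rightarrow> bool) \<Rightarrow> real).
     infinite N \<and>
     (\<forall>n\<in>N. f n \<in> cube n \<rightarrow> {-1, 1}) \<and>
     (\<lambda>n. real (opt_dt_size n (f n))) \<in> \<Theta>[sequentially \<sqinter> principal N](\<lambda>n. real n) \<and>
     (\<exists>c>0. \<forall>n\<in>N. real (topdown_dt_size n (f n) 0) \<ge> 2 powr (c * real (opt_dt_size n (f n))))"
proof (intro exI conjI)
  let ?N = "(\<lambda>m. 3 * m) ` {0<..} :: nat set" and ?f = "\<lambda>n. chain 0 (n div 3)"
  have "inj (\<lambda>m::nat. 3 * m)" by (simp add: inj_def)
  then show "infinite ?N" using infinite_Ioi[of "0::nat"] by (auto dest: finite_imageD inj_on_subset)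
  show "\<forall>n\<in>?N. ?f n \<in> cube n \<rightarrow> {-1, 1}" using pm_chain by (auto simp: pm_def)
  have bounds: "m < opt_dt_size (3 * m) (chain 0 m)" "opt_dt_size (3 * m) (chain 0 m) \<le> 4 * m + 1" for m
    using opt_dt_size_chain_gt opt_dt_size_chain_le[of 0 m "3 * m"] by auto
  show "(\<lambda>n. real (opt_dt_size n (?f n))) \<in> \<Theta>[sequentially \<sqinter> principal ?N](\<lambda>n. real n)"
  proof (rule bigthetaI)
    have "norm (real (opt_dt_size n (?f n))) \<le> 2 * norm (real n)" if "n \<in> ?N" for n
    proof -
      from that obtain m where "n = 3 * m" "m > 0" by auto
      then show ?thesis using bounds(2)[of m] by simp
    qed
    then show "(\<lambda>n. real (opt_dt_size n (?f n))) \<in> O[sequentially \<sqinter> principal ?N](\<lambda>n. real n)"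
      by (intro bigoI[of _ 2]) (auto simp: eventually_inf_principal)
    have "norm (real n) \<le> 3 * norm (real (opt_dt_size n (?f n)))" if "n \<in> ?N" for n
    proof -
      from that obtain m where "n = 3 * m" "m > 0" by auto
      then show ?thesis using bounds(1)[of m] by simp
    qed
    then have "(\<lambda>n. real n) \<in> O[sequentially \<sqinter> principal ?N](\<lambda>n. real (opt_dt_size n (?f n)))"
      by (intro bigoI[of _ 3]) (auto simp: eventually_inf_principal)
    then show "(\<lambda>n. real (opt_dt_size n (?f n))) \<in> \<Omega>[sequentially \<sqinter> principal ?N](\<lambda>n. real n)"
      by (simp add: bigomega_iff_bigo)
  qed
  \<comment> \<open>The constant comes from \<open>4 * m + 1 \<le> 5 * m\<close> for
    \<open>m > 0\<close>.\<close>
  show "(1/5::real) > 0" by simp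
  show "\<forall>n\<in>?N. real (topdown_dt_size n (?f n) 0) \<ge> 2 powr (1/5 * real (opt_dt_size n (?f n)))"
  proof
    fix n assume "n \<in> ?N"
    then obtain m where n: "n = 3 * m" "m > 0" by auto
    then have "1/5 * real (opt_dt_size n (?f n)) \<le> real m" using bounds(2)[of m] by simp
    then have "2 powr (1/5 * real (opt_dt_size n (?f n))) \<le> 2 powr real m" by simp
    also have "\<dots> = real (2 ^ m)" by (simp add: powr_realpow)
    also have "\<dots> \<le> real (topdown_dt_size n (?f n) 0)"
      using topdown_dt_size_chain[OF n(2)] n(1) by (simp del: of_nat_power)
    finally show "2 powr (1/5 * real (opt_dt_size n (?f n))) \<le> real (topdown_dt_size n (?f n) 0)" .
  qed
qed

section \<open>Cascades of selected parities\<close>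

definition parity :: "nat set \<Rightarrow> (nat \<Rightarrow> bool) \<Rightarrow> real" where
  "parity S x = (\<Prod>v\<in>S. if x v then -1 else 1)"

lemma pm_parity: "pm (parity S)"
proof -
  have "parity S x = 1 \<or> parity S x = -1" for x
    unfolding parity_def by (induction S rule: infinite_finite_induct) auto
  then show ?thesis by (simp add: pm_def)
qed

lemma dep_parity: "dep S (parity S)"
  unfolding dep_def parity_def by (auto intro!: prod.cong)

lemma parity_flip:
  assumes "finite S" "v \<in> S"
  shows "parity S (x(v := \<not> x v)) = - parity S x"
proof -
  have "(\<Prod>w\<in>S - {v}. if (x(v := \<not> x v)) w then -1 else 1) = (\<Prod>w\<in>S - {v}. if x w then -1 else (1::real))"
    by (rule prod.cong) auto
  then show ?thesis unfolding parity_def using assms by (simp add: prod.remove)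
qed

text \<open>Expresses a restriction as \<open>f\<close> evaluated at a modified input. With
  \<open>foldr\<close> an earlier entry of the path overrides a later one, as in
  \<open>restrict_path\<close>.\<close>

definition assign :: "path \<Rightarrow> (nat \<Rightarrow> bool) \<Rightarrow> nat \<Rightarrow> bool" where
  "assign p x = foldr (\<lambda>(i, b) y. y(i := b)) p x"

lemma assign_Nil [simp]: "assign [] x = x"
  and assign_Cons: "assign (e # p) x = (assign p x)(fst e := snd e)"
  by (simp_all add: assign_def case_prod_beta)

definition path_vars :: "path \<Rightarrow> nat set" where
  "path_vars p = fst ` set p"

lemma restrict_path_assign: "restrict_path f p x = f (assign p x)"
proof (induction f p rule: restrict_path.induct)
  case (2 f i b p)
  then show ?case unfolding restrict_path.simps assign_Cons fst_conv snd_conv by (simp only: fix_var_def)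
qed simp

lemma assign_cong: "x v = y v \<Longrightarrow> assign p x v = assign p y v"
  by (induction p) (simp_all add: assign_Cons)

lemma assign_free: "v \<notin> path_vars p \<Longrightarrow> assign p x v = x v"
  by (induction p) (auto simp: path_vars_def assign_Cons)

lemma assign_upd: "v \<notin> path_vars p \<Longrightarrow> assign p (x(v := b)) = (assign p x)(v := b)"
  by (induction p) (auto simp: path_vars_def assign_Cons fun_upd_twist)

lemma dep_comp:
  assumes "dep S g"
  shows "dep S (\<lambda>x. F (g x))"
  unfolding dep_def using depD[OF assms] by (intro allI impI arg_cong[of _ _ F]) blast

lemma dep_assign:
  assumes "dep S g"
  shows "dep S (\<lambda>x. g (assign p x))"
  unfolding dep_def
proof (intro allI impI)
  fix x y :: "nat \<Rightarrow> bool" assume "\<forall>i\<in>S. x i = y i"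
  then show "g (assign p x) = g (assign p y)"
    by (intro depD[OF assms] assign_cong) simp
qed

lemma dep_assign_free: "dep S g \<Longrightarrow> S \<inter> path_vars p = {} \<Longrightarrow> g (assign p x) = g x"
  by (erule depD, rule assign_free) blast

lemma card_path_vars: "card (path_vars p) \<le> length p"
  unfolding path_vars_def by (metis card_image_le card_length finite_set le_trans)

lemma finite_path_vars [simp]: "finite (path_vars p)"
  by (simp add: path_vars_def)

lemma leaves_path_vars: "p \<in> leaves t \<Longrightarrow> path_vars p \<subseteq> queried t"
  by (induction t arbitrary: p) (fastforce simp: path_vars_def)+

lemma greedy_prefix:
  "greedy n f t \<Longrightarrow> p @ (v, b) # p' \<in> leaves t \<Longrightarrow> most_influential n (restrict_path f p) v"
proof (induction t arbitrary: f p)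
  case (Query i l r)
  then show ?case by (cases p) auto
qed simp

lemma sum_of_bool_le_1:
  assumes "finite A" "\<And>x y. x \<in> A \<Longrightarrow> y \<in> A \<Longrightarrow> P x \<Longrightarrow> P y \<Longrightarrow> x = y"
  shows "(\<Sum>x\<in>A. of_bool (P x)) \<le> (1::real)"
proof -
  have "card (A \<inter> {x. P x}) \<le> 1"
    using assms by (auto simp: card_le_Suc0_iff_eq)
  then show ?thesis using assms(1) by (simp add: sum_of_bool_eq)
qed

lemma assign_append: "assign (p @ p') x = assign p (assign p' x)"
  by (simp add: assign_def)

text \<open>Both halves of a nonnegative average are nonnegative, so a zero average stays zero under
  every further restriction.\<close>

lemma avg_restrict_path_0:
  assumes "avg n f = 0" "\<And>x. 0 \<le> f x" "path_vars p \<subseteq> {..<n}"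
  shows "avg n (restrict_path f p) = 0"
  using assms
proof (induction f p rule: restrict_path.induct)
  case (2 f i b p)
  have i: "i < n" using 2(4) by (simp add: path_vars_def)
  have nn: "0 \<le> avg n (fix_var i c f)" for c by (rule avg_nonneg) (simp add: fix_var_def 2(3))
  have "avg n (fix_var i b f) = 0"
    using avg_split[OF i, of f] nn[of False] nn[of True] 2(2) by (cases b) auto
  then show ?case using 2 by (simp add: path_vars_def fix_var_def)
qed simp

section \<open>The cascade and its dependencies\<close>

datatype vclass = Switch nat | Selector nat | Block nat nat | Filler

text \<open>Collects what the argument needs of the selectors \<open>\<tau> i\<close>. A selector
  variable has influence at most \<open>\<gamma>\<close>, and each index has probability strictly
  above \<open>\<gamma>\<close> (so that no tie can favour the selector) and at most
  \<open>q\<close> (so that exhausting a few parities does not help much); \<open>\<eta>\<close>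
  bounds the probability that no index is selected. The map \<open>cls\<close> gives each variable
  one class, which makes the variable sets of switches, selectors, blocks and filler
  disjoint.\<close>

locale cascade =
  fixes n a M k :: nat and cls :: "nat \<Rightarrow> vclass" and u :: "nat \<Rightarrow> nat"
    and \<tau> :: "nat \<Rightarrow> (nat \<Rightarrow> bool) \<Rightarrow> nat" and h :: "(nat \<Rightarrow> bool) \<Rightarrow> real"
    and \<gamma> q \<eta> :: real
  assumes switch: "i < a \<Longrightarrow> u i < n \<and> cls (u i) = Switch i"
    and card_block: "i < a \<Longrightarrow> j < M \<Longrightarrow> card {v. v < n \<and> cls v = Block i j} = k"
    and dep_\<tau>: "i < a \<Longrightarrow> dep {v. v < n \<and> cls v = Selector i} (\<tau> i)"
    and pm_h: "pm h" and dep_h: "dep {v. v < n \<and> cls v = Filler} h"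
    and infl_\<tau>: "i < a \<Longrightarrow> cls v = Selector i \<Longrightarrow> influence n v (\<lambda>x. real (\<tau> i x)) \<le> \<gamma>"
    and prob_\<tau>_gt: "i < a \<Longrightarrow> j < M \<Longrightarrow> \<gamma> < avg n (\<lambda>x. of_bool (\<tau> i x = j))"
    and prob_\<tau>_le: "i < a \<Longrightarrow> j < M \<Longrightarrow> avg n (\<lambda>x. of_bool (\<tau> i x = j)) \<le> q"
    and prob_none: "i < a \<Longrightarrow> avg n (\<lambda>x. of_bool (\<not> \<tau> i x < M)) \<le> \<eta>"
    and k_pos: "0 < k" and M_pos: "0 < M" and \<gamma>_nonneg: "0 \<le> \<gamma>"
begin

definition Z :: "nat \<Rightarrow> nat set" where "Z i = {v. v < n \<and> cls v = Selector i}"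
definition Y :: "nat \<Rightarrow> nat \<Rightarrow> nat set" where "Y i j = {v. v < n \<and> cls v = Block i j}"

definition core :: "nat \<Rightarrow> (nat \<Rightarrow> bool) \<Rightarrow> real" where
  "core i x = (if \<tau> i x < M then parity (Y i (\<tau> i x)) x else 1)"

fun casc :: "nat \<Rightarrow> (nat \<Rightarrow> bool) \<Rightarrow> real" where
  "casc 0 x = h x"
| "casc (Suc i) x = (if x (u i) then casc i x else core i x)"

text \<open>Switches are read from \<open>a - 1\<close> downwards, as in the recursion of
  \<open>casc\<close>; this is the event that core \<open>i\<close> decides the value.\<close>

definition reach :: "nat \<Rightarrow> (nat \<Rightarrow> bool) \<Rightarrow> bool" where
  "reach i x \<longleftrightarrow> \<not> x (u i) \<and> (\<forall>j. i < j \<and> j < a \<longrightarrow> x (u j))"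

definition grp :: "nat \<Rightarrow> nat set" where
  "grp i = {v. v < n \<and> (cls v = Selector i \<or> (\<exists>j. cls v = Block i j))}"

definition below :: "nat \<Rightarrow> nat set" where
  "below i = {v. v < n \<and> (cls v = Filler \<or> (\<exists>j<i. cls v = Switch j \<or> cls v = Selector j \<or> (\<exists>l. cls v = Block j l)))}"

lemma finite_Y [simp]: "finite (Y i j)"
  by (simp add: Y_def)

lemma dep_core:
  assumes "i < a"
  shows "dep (grp i) (core i)"
  unfolding dep_def
proof (intro allI impI)
  fix x y :: "nat \<Rightarrow> bool" assume eq: "\<forall>v\<in>grp i. x v = y v"
  have "\<tau> i x = \<tau> i y" by (rule depD[OF dep_\<tau>[OF assms]]) (use eq in \<open>auto simp: grp_def\<close>)
  moreover have "parity (Y i j) x = parity (Y i j) y" for j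
    by (rule depD[OF dep_parity]) (use eq in \<open>auto simp: grp_def Y_def\<close>)
  ultimately show "core i x = core i y" by (simp add: core_def)
qed

lemma dep_casc: "i \<le> a \<Longrightarrow> dep (below i) (casc i)"
proof (induction i)
  case 0
  have "dep (below 0) h" by (rule dep_mono[OF dep_h]) (auto simp: below_def)
  moreover have "casc 0 = h" by auto
  ultimately show ?case by simp
next
  case (Suc i)
  have 1: "dep (below (Suc i)) (casc i)"
    by (rule dep_mono[OF Suc.IH]) (use Suc.prems in \<open>auto simp: below_def less_Suc_eq\<close>)
  have 2: "dep (below (Suc i)) (core i)"
    by (rule dep_mono[OF dep_core]) (use Suc.prems in \<open>auto simp: below_def grp_def\<close>)
  have 3: "u i \<in> below (Suc i)" using switch[of i] Suc.prems by (auto simp: below_def)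
  show ?case unfolding dep_def
  proof (intro allI impI)
    fix x y :: "nat \<Rightarrow> bool" assume eq: "\<forall>v\<in>below (Suc i). x v = y v"
    have "casc i x = casc i y" "core i x = core i y" "x (u i) = y (u i)"
      using depD[OF 1, of x y] depD[OF 2, of x y] eq 3 by blast+
    then show "casc (Suc i) x = casc (Suc i) y" by simp
  qed
qed

lemma pm_core: "pm (core i)"
  using pm_parity by (auto simp: pm_def core_def)

lemma pm_casc: "pm (casc i)"
proof -
  have "casc i x = 1 \<or> casc i x = -1" for x
    by (induction i) (use pm_h pm_core in \<open>auto simp: pm_def\<close>)
  then show ?thesis by (simp add: pm_def)
qed

lemma casc_reach: "i < a \<Longrightarrow> reach i x \<Longrightarrow> casc a x = core i x"
proof -
  assume i: "i < a" "reach i x"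
  have "casc m x = core i x" if "i < m" "m \<le> a" for m
    using that
  proof (induction m)
    case (Suc m)
    show ?case
    proof (cases "m = i")
      case True
      then show ?thesis using i by (simp add: reach_def)
    next
      case False
      then have "x (u m)" using i Suc.prems by (auto simp: reach_def)
      then show ?thesis using Suc False by simp
    qed
  qed simp
  then show ?thesis using i by simp
qed

lemma casc_not_reach: "(\<And>i. i < a \<Longrightarrow> x (u i)) \<Longrightarrow> casc a x = h x"
proof -
  assume x: "\<And>i. i < a \<Longrightarrow> x (u i)"
  have "casc m x = h x" if "m \<le> a" for m
    using that by (induction m) (use x in auto)
  then show ?thesis by simp
qed

lemma reach_unique: "reach i x \<Longrightarrow> reach i' x \<Longrightarrow> i < a \<Longrightarrow> i' < a \<Longrightarrow> i = i'"
  unfolding reach_def by (metis linorder_neqE_nat)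

lemma reach_exists:
  assumes "\<not> (\<forall>i<a. x (u i))"
  shows "\<exists>i<a. reach i x"
proof -
  let ?S = "{i. i < a \<and> \<not> x (u i)}"
  have S: "finite ?S" "?S \<noteq> {}" using assms by auto
  have m: "Max ?S \<in> ?S" by (rule Max_in[OF S])
  have "x (u j)" if "Max ?S < j" "j < a" for j
  proof (rule ccontr)
    assume "\<not> x (u j)"
    then have "j \<le> Max ?S" using that by (intro Max_ge[OF S(1)]) simp
    then show False using that by simp
  qed
  then have "reach (Max ?S) x" unfolding reach_def using m by blast
  then show ?thesis using m by blast
qed

lemma dep_reach:
  assumes "i < a"
  shows "dep (u ` {..<a}) (reach i)"
  unfolding dep_def
proof (intro allI impI)
  fix x y :: "nat \<Rightarrow> bool" assume "\<forall>v\<in>u ` {..<a}. x v = y v"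
  then have "x (u j) = y (u j)" if "j < a" for j using that by simp
  then show "reach i x = reach i y" unfolding reach_def using assms by blast
qed

lemma switch_not_selector: "u ` {..<a} \<inter> Z i = {}"
  using switch by (auto simp: Z_def)

lemma switch_bound: "u ` {..<a} \<subseteq> {..<n}"
  using switch by auto

lemma casc_flip_selector:
  assumes "i < a" "v \<in> Z i" "casc a (x(v := \<not> x v)) \<noteq> casc a x"
  shows "reach i x \<and> \<tau> i x \<noteq> \<tau> i (x(v := \<not> x v))"
proof -
  let ?y = "x(v := \<not> x v)"
  have v: "v < n" "cls v = Selector i" using assms(2) by (auto simp: Z_def)
  have r: "reach i' ?y = reach i' x" if "i' < a" for i'
    by (rule dep_upd[OF dep_reach[OF that]]) (use switch v in auto)
  show ?thesis
  proof (cases "\<forall>j<a. x (u j)")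
    case True
    then have "\<forall>j<a. ?y (u j)" using switch v by auto
    moreover have "h ?y = h x" by (rule dep_upd[OF dep_h]) (simp add: v)
    ultimately show ?thesis using True assms(3) casc_not_reach[of x] casc_not_reach[of ?y] by simp
  next
    case False
    then obtain i' where i': "i' < a" "reach i' x" using reach_exists by blast
    then have neq: "core i' ?y \<noteq> core i' x" using assms(3) casc_reach r by metis
    have "i' = i"
    proof (rule ccontr)
      assume "i' \<noteq> i"
      then have "core i' ?y = core i' x"
        by (intro dep_upd[OF dep_core[OF i'(1)]]) (auto simp: grp_def v)
      then show False using neq by simp
    qed
    moreover have "parity (Y i j) ?y = parity (Y i j) x" for j
      by (rule dep_upd[OF dep_parity]) (auto simp: Y_def v)
    moreover have "core i ?y = core i x" if "\<tau> i ?y = \<tau> i x"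
      using that calculation(2) by (simp add: core_def)
    ultimately show ?thesis using neq i' by metis
  qed
qed

lemma casc_flip_block:
  assumes "i < a" "j < M" "v \<in> Y i j" "reach i x" "\<tau> i x = j"
  shows "casc a (x(v := \<not> x v)) = - casc a x"
    "reach i (x(v := \<not> x v))" "\<tau> i (x(v := \<not> x v)) = j"
proof -
  let ?y = "x(v := \<not> x v)"
  have v: "cls v = Block i j" using assms(3) by (auto simp: Y_def)
  show r: "reach i ?y"
  proof -
    have "v \<notin> u ` {..<a}" using switch v by auto
    then show ?thesis using dep_upd[OF dep_reach[OF assms(1)], of v x "\<not> x v"] assms(4) by simp
  qed
  show t: "\<tau> i ?y = j"
    using dep_upd[OF dep_\<tau>[OF assms(1)], of v x "\<not> x v"] v assms(5) by simp
  show "casc a ?y = - casc a x"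
    using casc_reach[OF assms(1) r] casc_reach[OF assms(1,4)] t assms
    by (simp add: core_def parity_flip)
qed

section \<open>The cascade conditioned on a path\<close>

definition R :: "nat \<Rightarrow> path \<Rightarrow> real" where
  "R i p = avg n (\<lambda>x. of_bool (reach i (assign p x)))"

definition sel :: "path \<Rightarrow> nat \<Rightarrow> nat \<Rightarrow> (nat \<Rightarrow> bool) \<Rightarrow> real" where
  "sel p i j x = of_bool (reach i (assign p x) \<and> \<tau> i (assign p x) = j)"

lemma R_nonneg: "0 \<le> R i p"
  unfolding R_def by (rule avg_nonneg) simp

text \<open>\<open>R i p\<close> is the probability, given the path \<open>p\<close>, that core
  \<open>i\<close> decides. While \<open>p\<close> has not touched the selector of core
  \<open>i\<close>, this event depends only on the switches and is independent of the selector,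
  which keeps its unconditional distribution.\<close>

lemma avg_selector:
  assumes "i < a" "Z i \<inter> path_vars p = {}" "dep (Z i) g"
  shows "avg n (\<lambda>x. of_bool (reach i (assign p x)) * g (assign p x)) = R i p * avg n g"
proof -
  have "avg n (\<lambda>x. of_bool (reach i (assign p x)) * g (assign p x))
      = avg n (\<lambda>x. of_bool (reach i (assign p x)) * g x)"
    using dep_assign_free[OF assms(3,2)] by simp
  also have "\<dots> = R i p * avg n g"
    unfolding R_def
  proof (rule avg_indep[OF _ assms(3) switch_not_selector switch_bound])
    show "dep (u ` {..<a}) (\<lambda>x. of_bool (reach i (assign p x)) :: real)"
      by (rule dep_comp[OF dep_assign[OF dep_reach[OF assms(1)]]])
  qed
  finally show ?thesis .
qed

lemma avg_sel:
  assumes "i < a" "Z i \<inter> path_vars p = {}"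
  shows "avg n (sel p i j) = R i p * avg n (\<lambda>x. of_bool (\<tau> i x = j))"
proof -
  have "dep (Z i) (\<lambda>x. of_bool (\<tau> i x = j) :: real)"
    unfolding Z_def by (rule dep_comp[OF dep_\<tau>[OF assms(1)]])
  from avg_selector[OF assms this] show ?thesis by (simp add: sel_def[abs_def] of_bool_conj)
qed

lemma influence_block_ge:
  assumes "i < a" "j < M" "v \<in> Y i j" "v \<notin> path_vars p"
  shows "avg n (sel p i j) \<le> influence n v (restrict_path (casc a) p)"
  unfolding influence_avg
proof (rule avg_mono)
  fix x
  show "sel p i j x \<le> of_bool (restrict_path (casc a) p x \<noteq> restrict_path (casc a) p (x(v := \<not> x v)))"
  proof (cases "reach i (assign p x) \<and> \<tau> i (assign p x) = j")
    case True
    have "assign p (x(v := \<not> x v)) = (assign p x)(v := \<not> assign p x v)"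
      using assign_upd[OF assms(4)] assign_free[OF assms(4)] by simp
    moreover have "casc a ((assign p x)(v := \<not> assign p x v)) = - casc a (assign p x)"
      using casc_flip_block(1)[OF assms(1-3)] True by blast
    moreover have "casc a (assign p x) \<noteq> 0" using pm_casc[of a] by (auto simp: pm_def dest: spec[of _ "assign p x"])
    ultimately show ?thesis by (simp add: restrict_path_assign sel_def)
  next
    case False
    then have "sel p i j x = 0" by (auto simp: sel_def)
    then show ?thesis by simp
  qed
qed

lemma influence_selector_le:
  assumes "i < a" "v \<in> Z i" "Z i \<inter> path_vars p = {}"
  shows "influence n v (restrict_path (casc a) p) \<le> R i p * \<gamma>"
proof -
  have v: "v \<notin> path_vars p" "cls v = Selector i" "v < n" using assms by (auto simp: Z_def)
  define g where "g x = (of_bool (real (\<tau> i x) \<noteq> real (\<tau> i (x(v := \<not> x v)))) :: real)" for x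
  have dep: "dep (Z i) g"
    unfolding dep_def
  proof (intro allI impI)
    fix x y :: "nat \<Rightarrow> bool" assume eq: "\<forall>w\<in>Z i. x w = y w"
    have "\<tau> i x = \<tau> i y" "\<tau> i (x(v := \<not> x v)) = \<tau> i (y(v := \<not> y v))"
      by (rule depD[OF dep_\<tau>[OF assms(1)]]; use eq assms(2) in \<open>auto simp: Z_def\<close>)+
    then show "g x = g y" by (simp add: g_def)
  qed
  have "influence n v (restrict_path (casc a) p)
      \<le> avg n (\<lambda>x. of_bool (reach i (assign p x)) * g (assign p x))"
    unfolding influence_avg
  proof (rule avg_mono)
    fix x
    have "assign p (x(v := \<not> x v)) = (assign p x)(v := \<not> assign p x v)"
      using assign_upd[OF v(1)] assign_free[OF v(1)] by simp
    then show "of_bool (restrict_path (casc a) p x \<noteq> restrict_path (casc a) p (x(v := \<not> x v)))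
        \<le> of_bool (reach i (assign p x)) * g (assign p x)"
      using casc_flip_selector[OF assms(1,2), of "assign p x"]
      by (auto simp: restrict_path_assign g_def of_bool_def)
  qed
  also have "\<dots> = R i p * avg n g" by (rule avg_selector[OF assms(1,3) dep])
  also have "avg n g = influence n v (\<lambda>x. real (\<tau> i x))"
    by (simp add: g_def[abs_def] influence_avg)
  also have "R i p * \<dots> \<le> R i p * \<gamma>"
    by (rule mult_left_mono[OF infl_\<tau>[OF assms(1) v(2)] R_nonneg])
  finally show ?thesis .
qed

text \<open>A greedy path exhausts all parities of a core before it queries the selector of that core:
  an unqueried parity variable is at least as influential as its selection is likely, which beats
  every selector variable.\<close>

lemma greedy_blocks_first:
  assumes "greedy n (casc a) t" "p \<in> leaves t" "i < a"
  shows "R i p = 0 \<or> Z i \<inter> path_vars p = {} \<or> (\<forall>j<M. Y i j \<subseteq> path_vars p)"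
proof (rule ccontr)
  assume "\<not> ?thesis"
  then have R: "R i p \<noteq> 0" and Z: "Z i \<inter> path_vars p \<noteq> {}"
    and "\<exists>j<M. \<exists>y\<in>Y i j. y \<notin> path_vars p" by auto
  then obtain j y where y: "j < M" "y \<in> Y i j" "y \<notin> path_vars p" by blast
  have "\<exists>e\<in>set p. fst e \<in> Z i" using Z by (auto simp: path_vars_def)
  \<comment> \<open>\<open>p1\<close> is the part of the path before the first query to the
    selector, so the selector still has its original distribution there.\<close>
  then obtain p1 e p2 where p: "p = p1 @ e # p2" "fst e \<in> Z i" "\<forall>e'\<in>set p1. fst e' \<notin> Z i"
    by (elim split_list_first_propE)
  obtain v b where e: "e = (v, b)" by (cases e)
  have free: "Z i \<inter> path_vars p1 = {}" using p(3) by (auto simp: path_vars_def)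
  have y1: "y \<notin> path_vars p1" using y(3) p(1) by (auto simp: path_vars_def)
  have "most_influential n (restrict_path (casc a) p1) v"
    using greedy_prefix[OF assms(1), of p1 v b p2] assms(2) p(1) e by simp
  moreover have "y < n" using y(2) by (simp add: Y_def)
  ultimately have "influence n y (restrict_path (casc a) p1) \<le> influence n v (restrict_path (casc a) p1)"
    by (simp add: most_influential_def)
  also have "\<dots> \<le> R i p1 * \<gamma>"
    using influence_selector_le[OF assms(3) _ free] p(2) e by simp
  finally have "R i p1 * avg n (\<lambda>x. of_bool (\<tau> i x = j)) \<le> R i p1 * \<gamma>"
    using influence_block_ge[OF assms(3) y(1,2) y1] avg_sel[OF assms(3) free, of j] by linarith
  \<comment> \<open>The index \<open>j\<close> has probability larger than \<open>\<gamma>\<close>,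
    so a positive \<open>R i p1\<close> would contradict the inequality just derived.\<close>
  then have "R i p1 = 0"
    using prob_\<tau>_gt[OF assms(3) y(1)] R_nonneg[of i p1]
    by (metis leD mult_less_cancel_left_pos order_less_le)
  \<comment> \<open>A core that is unreachable after \<open>p1\<close> stays unreachable on the rest
    of the path.\<close>
  then have "avg n (restrict_path (\<lambda>x. of_bool (reach i x)) p1) = 0"
    by (simp add: R_def restrict_path_assign[abs_def])
  then have "avg n (restrict_path (restrict_path (\<lambda>x. of_bool (reach i x)) p1) (e # p2)) = 0"
  proof (rule avg_restrict_path_0)
    show "path_vars (e # p2) \<subseteq> {..<n}"
      using leaves_path_vars[OF assms(2)] greedy_queried[OF assms(1)] p(1) by (auto simp: path_vars_def)
  qed (simp add: restrict_path_assign)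
  then have "R i p = 0"
    by (simp add: R_def p(1) assign_append restrict_path_assign[abs_def])
  then show False using R by simp
qed

text \<open>Flipping the free parity variable \<open>v\<close> preserves the measure and the event
  that this parity decides, and negates the value; so the average is its own negative.\<close>

lemma avg_casc_sel_0:
  assumes "i < a" "j < M" "v \<in> Y i j" "v \<notin> path_vars p"
  shows "avg n (\<lambda>x. casc a (assign p x) * sel p i j x) = 0"
proof -
  let ?g = "\<lambda>x. casc a (assign p x) * sel p i j x"
  have v: "v < n" using assms(3) by (simp add: Y_def)
  have "?g (x(v := \<not> x v)) = - ?g x" for x
  proof -
    let ?x = "assign p x" and ?y = "(assign p x)(v := \<not> assign p x v)"
    have y: "assign p (x(v := \<not> x v)) = ?y"
      using assign_upd[OF assms(4)] assign_free[OF assms(4)] by simp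
    have yy: "?y(v := \<not> ?y v) = ?x" by auto
    show ?thesis
    proof (cases "reach i ?x \<and> \<tau> i ?x = j")
      case True
      then show ?thesis using casc_flip_block[OF assms(1-3), of ?x] by (simp add: sel_def y)
    next
      case False
      then have "\<not> (reach i ?y \<and> \<tau> i ?y = j)"
        using casc_flip_block(2,3)[OF assms(1-3), of ?y] unfolding yy by blast
      then have "sel p i j (x(v := \<not> x v)) = 0" "sel p i j x = 0"
        using False by (auto simp: sel_def y)
      then show ?thesis by simp
    qed
  qed
  then have "avg n ?g = - avg n ?g"
    using avg_flip[OF v, of ?g] by (simp add: avg_minus)
  then show ?thesis by simp
qed

lemma exhausted_card:
  assumes "i < a"
  shows "card {j. j < M \<and> Y i j \<subseteq> path_vars p} * k \<le> length p"
proof -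
  let ?E = "{j. j < M \<and> Y i j \<subseteq> path_vars p}"
  have "card (\<Union>j\<in>?E. Y i j) = (\<Sum>j\<in>?E. card (Y i j))"
    by (rule card_UN_disjoint) (auto simp: Y_def)
  also have "\<dots> = card ?E * k" using card_block[OF assms] by (simp add: Y_def)
  finally have "card ?E * k \<le> card (path_vars p)"
    by (metis (no_types, lifting) UN_least card_mono finite_path_vars mem_Collect_eq)
  then show ?thesis using card_path_vars le_trans by blast
qed

text \<open>Let \<open>S\<close> indicate that an unexhausted parity decides. There the value is
  perfectly balanced, so the bias is at most the probability of the complement of \<open>S\<close>.
  Given that core \<open>i\<close> decides, \<open>S\<close> fails only if no index is selected, at
  cost \<open>\<eta>\<close>, or an exhausted one is, at cost \<open>\<theta>\<close>.\<close>

lemma leaf_bias: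
  assumes gr: "greedy n (casc a) t" "p \<in> leaves t" and len: "length p \<le> D" "D < k * M"
    and \<theta>: "real D * q \<le> \<theta> * real k" and "0 \<le> q"
  shows "\<bar>avg n (restrict_path (casc a) p)\<bar> \<le> 1 - (1 - \<eta> - \<theta>) * (\<Sum>i<a. R i p)"
proof -
  let ?F = "\<lambda>x. casc a (assign p x)"
  define W where "W i = {j. j < M \<and> \<not> Y i j \<subseteq> path_vars p}" for i
  have finW [simp]: "finite (W i)" for i by (simp add: W_def)
  define S where "S x = (\<Sum>i<a. \<Sum>j\<in>W i. sel p i j x)" for x
  have S1: "S x \<le> 1" for x
  proof -
    have "S x = (\<Sum>e\<in>(SIGMA i:{..<a}. W i). sel p (fst e) (snd e) x)"
      unfolding S_def by (subst sum.Sigma) (auto simp: case_prod_beta)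
    also have "\<dots> \<le> 1"
      unfolding sel_def by (rule sum_of_bool_le_1) (auto dest: reach_unique)
    finally show ?thesis .
  qed
  have "avg n (\<lambda>x. ?F x * S x) = (\<Sum>i<a. \<Sum>j\<in>W i. avg n (\<lambda>x. ?F x * sel p i j x))"
    unfolding S_def sum_distrib_left avg_sum ..
  also have "\<dots> = 0"
  proof (intro sum.neutral ballI)
    fix i j assume "i \<in> {..<a}" "j \<in> W i"
    moreover from this obtain v where "v \<in> Y i j" "v \<notin> path_vars p" by (auto simp: W_def)
    ultimately show "avg n (\<lambda>x. ?F x * sel p i j x) = 0"
      by (intro avg_casc_sel_0) (auto simp: W_def)
  qed
  finally have zero: "avg n (\<lambda>x. ?F x * S x) = 0" .
  have "avg n ?F = avg n (\<lambda>x. ?F x * S x) + avg n (\<lambda>x. ?F x * (1 - S x))"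
    unfolding avg_add[symmetric] by (simp add: algebra_simps)
  then have "avg n ?F = avg n (\<lambda>x. ?F x * (1 - S x))" using zero by simp
  moreover have b: "?F x * (1 - S x) \<le> 1 - S x" "- (?F x * (1 - S x)) \<le> 1 - S x" for x
  proof -
    have "?F x = 1 \<or> ?F x = -1" using pm_casc[of a] by (simp add: pm_def)
    then show "?F x * (1 - S x) \<le> 1 - S x" "- (?F x * (1 - S x)) \<le> 1 - S x"
      using S1[of x] by auto
  qed
  ultimately have abs: "\<bar>avg n ?F\<bar> \<le> avg n (\<lambda>x. 1 - S x)"
    using avg_mono[of n "\<lambda>x. ?F x * (1 - S x)" "\<lambda>x. 1 - S x"]
      avg_mono[of n "\<lambda>x. - (?F x * (1 - S x))" "\<lambda>x. 1 - S x"] b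
    by (simp add: avg_minus abs_le_iff)
  have "(1 - \<eta> - \<theta>) * (\<Sum>i<a. R i p) \<le> avg n S"
    unfolding S_def avg_sum sum_distrib_left
  proof (rule sum_mono)
    fix i assume "i \<in> {..<a}"
    then have i: "i < a" by simp
    have sel_nonneg: "0 \<le> avg n (sel p i j)" for j by (rule avg_nonneg) (simp add: sel_def)
    show "(1 - \<eta> - \<theta>) * R i p \<le> (\<Sum>j\<in>W i. avg n (sel p i j))"
    proof (cases "R i p = 0")
      case True
      then show ?thesis using sel_nonneg by (simp add: sum_nonneg)
    next
      case False
      let ?E = "{j. j < M \<and> Y i j \<subseteq> path_vars p}"
      have E: "card ?E * k \<le> D" using exhausted_card[OF i, of p] len(1) by simp
      have "\<not> (\<forall>j<M. Y i j \<subseteq> path_vars p)"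
      proof
        assume "\<forall>j<M. Y i j \<subseteq> path_vars p"
        then have "?E = {..<M}" by auto
        then show False using E len(2) by (simp add: mult.commute)
      qed
      \<comment> \<open>A path of length less than \<open>k * M\<close> cannot exhaust all blocks of
        a core, so the remaining alternative of \<open>greedy_blocks_first\<close> is an untouched
        selector.\<close>
      then have free: "Z i \<inter> path_vars p = {}"
        using greedy_blocks_first[OF gr i] False by blast
      let ?q = "\<lambda>j. avg n (\<lambda>x. of_bool (\<tau> i x = j))"
      have "(\<Sum>j<M. ?q j) = avg n (\<lambda>x. 1 - of_bool (\<not> \<tau> i x < M))"
        unfolding avg_sum[symmetric]
        by (rule avg_cong) (auto simp: of_bool_def sum.delta split: if_splits)
      also have "\<dots> \<ge> 1 - \<eta>" using prob_none[OF i] by (simp add: avg_diff avg_const)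
      finally have total: "1 - \<eta> \<le> (\<Sum>j<M. ?q j)" .
      have "(\<Sum>j<M. ?q j) = (\<Sum>j\<in>W i. ?q j) + (\<Sum>j\<in>?E. ?q j)"
      proof -
        have "{..<M} = W i \<union> ?E" by (auto simp: W_def)
        then show ?thesis by (simp add: sum.union_disjoint W_def disjoint_iff)
      qed
      moreover have "(\<Sum>j\<in>?E. ?q j) \<le> real (card ?E) * q"
        by (rule sum_bounded_above) (use prob_\<tau>_le[OF i] in auto)
      \<comment> \<open>At most \<open>D / k\<close> parities are exhausted, each selected with
        probability at most \<open>q\<close>.\<close>
      moreover have "real (card ?E) * q \<le> \<theta>"
      proof -
        have "real (card ?E) * q * real k = real (card ?E * k) * q" by simp
        also have "\<dots> \<le> real D * q" using E \<open>0 \<le> q\<close> by (intro mult_right_mono) (simp_all del: of_nat_mult)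
        also have "\<dots> \<le> \<theta> * real k" by (rule \<theta>)
        finally show ?thesis using k_pos by simp
      qed
      ultimately have "1 - \<eta> - \<theta> \<le> (\<Sum>j\<in>W i. ?q j)" using total by linarith
      then have "R i p * (1 - \<eta> - \<theta>) \<le> R i p * (\<Sum>j\<in>W i. ?q j)"
        by (rule mult_left_mono[OF _ R_nonneg])
      then show ?thesis using avg_sel[OF i free] by (simp add: sum_distrib_left mult.commute)
    qed
  qed
  then show ?thesis using abs by (simp add: avg_diff avg_const restrict_path_assign[abs_def])
qed

section \<open>The error of small greedy trees\<close>

lemma sum_R_le_1: "(\<Sum>i<a. R i p) \<le> 1"
proof -
  have "(\<Sum>i<a. of_bool (reach i y)) \<le> (1::real)" for y
    by (rule sum_of_bool_le_1) (auto dest: reach_unique)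
  then have "avg n (\<lambda>x. \<Sum>i<a. of_bool (reach i (assign p x))) \<le> avg n (\<lambda>_. 1)"
    by (intro avg_mono)
  also have "\<dots> = 1" by (rule avg_const) simp
  finally show ?thesis unfolding R_def avg_sum .
qed

lemma sum_reach: "(\<Sum>i<a. avg n (\<lambda>x. of_bool (reach i x))) \<ge> 1 - (1/2) ^ a"
proof -
  have inj: "inj_on u {..<a}" using switch by (metis inj_onI lessThan_iff vclass.inject(1))
  have "1 - (1/2) ^ a = avg n (\<lambda>x. 1 - of_bool (\<forall>v\<in>u ` {..<a}. x v))"
    by (simp only: avg_diff avg_all_true[OF switch_bound] card_image[OF inj]) (simp add: avg_const)
  also have "\<dots> \<le> avg n (\<lambda>x. \<Sum>i<a. of_bool (reach i x))"
  proof (rule avg_mono)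
    fix x
    show "1 - of_bool (\<forall>v\<in>u ` {..<a}. x v) \<le> (\<Sum>i<a. of_bool (reach i x) :: real)"
    proof (cases "\<forall>i<a. x (u i)")
      case True
      then show ?thesis by (simp add: sum_nonneg)
    next
      case False
      then obtain i where "i < a" "reach i x" using reach_exists by blast
      then have "(1::real) \<le> (\<Sum>i<a. of_bool (reach i x))"
        using member_le_sum[of i "{..<a}" "\<lambda>i. of_bool (reach i x) :: real"] by simp
      then show ?thesis by (simp add: of_bool_def)
    qed
  qed
  also have "\<dots> = (\<Sum>i<a. avg n (\<lambda>x. of_bool (reach i x)))" by (rule avg_sum)
  finally show ?thesis .
qed

text \<open>Leaves of depth at most \<open>D\<close> err by \<open>leaf_bias\<close>. A deeper leaf
  has weight at most \<open>1 / 2 ^ D\<close>, so ignoring these costs at most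
  \<open>dt_size t / 2 ^ D\<close>. Averaged over the leaves, \<open>R i p\<close> becomes the
  unconditional probability that core \<open>i\<close> decides, and these sum to at least
  \<open>1 - (1/2) ^ a\<close>.\<close>

lemma greedy_error:
  assumes gr: "greedy n (casc a) t" and D: "D < k * M"
    and \<theta>: "real D * q \<le> \<theta> * real k" and "0 \<le> q" "\<eta> + \<theta> \<le> 1" "0 \<le> \<eta>" "0 \<le> \<theta>"
  shows "(1 - \<eta> - \<theta>) / 2 * (1 - (1/2) ^ a - real (dt_size t) / 2 ^ D) \<le> dt_error n (casc a) t"
proof -
  let ?\<kappa> = "1 - \<eta> - \<theta>"
  have \<kappa>: "0 \<le> ?\<kappa>" using assms by simp
  note q = greedy_queried[OF gr]
  \<comment> \<open>The loss is charged to every leaf, shallow ones included, so that one bound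
    covers both cases and the charges sum to a multiple of the size.\<close>
  have leaf_term: "(1/2) ^ length p * (?\<kappa> / 2 * (\<Sum>i<a. R i p)) - ?\<kappa> / 2 * (1/2) ^ D
      \<le> (1/2) ^ length p * dt_error n (restrict_path (casc a) p) (Leaf ())"
    if p: "p \<in> leaves t" for p
  proof (cases "length p \<le> D")
    case True
    have "?\<kappa> / 2 * (\<Sum>i<a. R i p) \<le> (1 - \<bar>avg n (restrict_path (casc a) p)\<bar>) / 2"
      using leaf_bias[OF gr p True D \<theta> \<open>0 \<le> q\<close>] by (simp add: field_simps)
    also have "\<dots> \<le> dt_error n (restrict_path (casc a) p) (Leaf ())"
      by (rule dt_error_leaf_ge[OF pm_restrict_path[OF pm_casc]])
    finally have "(1/2) ^ length p * (?\<kappa> / 2 * (\<Sum>i<a. R i p))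
        \<le> (1/2) ^ length p * dt_error n (restrict_path (casc a) p) (Leaf ())"
      by (rule mult_left_mono) simp
    moreover have "0 \<le> ?\<kappa> / 2 * (1/2) ^ D" using \<kappa> by simp
    ultimately show ?thesis by linarith
  next
    case False
    have "(1/2) ^ length p * (?\<kappa> / 2 * (\<Sum>i<a. R i p)) \<le> (1/2) ^ D * (?\<kappa> / 2 * 1)"
      using False \<kappa> sum_R_le_1[of p] R_nonneg
      by (intro mult_mono power_decreasing mult_nonneg_nonneg sum_nonneg) auto
    moreover have "0 \<le> (1/2) ^ length p * dt_error n (restrict_path (casc a) p) (Leaf ())"
      by (simp add: dt_error_nonneg)
    moreover have "(1/2) ^ D * (?\<kappa> / 2 * 1) = ?\<kappa> / 2 * (1/2) ^ D" by simp
    ultimately show ?thesis by linarith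
  qed
  have "(\<Sum>p\<in>leaves t. (1/2) ^ length p * (?\<kappa> / 2 * (\<Sum>i<a. R i p)))
      = ?\<kappa> / 2 * (\<Sum>i<a. \<Sum>p\<in>leaves t. (1/2) ^ length p * R i p)"
    by (subst sum.swap) (simp add: sum_distrib_left mult_ac)
  also have "(\<Sum>i<a. \<Sum>p\<in>leaves t. (1/2) ^ length p * R i p) = (\<Sum>i<a. avg n (\<lambda>x. of_bool (reach i x)))"
    by (rule sum.cong[OF refl])
       (simp add: avg_leaves[OF q, of "\<lambda>x. of_bool (reach _ x)"] R_def restrict_path_assign[abs_def])
  finally have "(\<Sum>p\<in>leaves t. (1/2) ^ length p * (?\<kappa> / 2 * (\<Sum>i<a. R i p)))
      \<ge> ?\<kappa> / 2 * (1 - (1/2) ^ a)"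
    using mult_left_mono[OF sum_reach, of "?\<kappa> / 2"] \<kappa> by simp
  moreover have "(\<Sum>p\<in>leaves t. ?\<kappa> / 2 * (1/2) ^ D) = ?\<kappa> / 2 * (real (dt_size t) / 2 ^ D)"
    by (simp add: card_leaves power_one_over)
  ultimately have "?\<kappa> / 2 * (1 - (1/2) ^ a - real (dt_size t) / 2 ^ D)
      \<le> (\<Sum>p\<in>leaves t. (1/2) ^ length p * (?\<kappa> / 2 * (\<Sum>i<a. R i p)) - ?\<kappa> / 2 * (1/2) ^ D)"
    unfolding sum_subtractf right_diff_distrib by linarith
  also have "\<dots> \<le> dt_error n (casc a) t"
    unfolding dt_error_leaves[OF greedy_irredundant[OF gr] q] by (rule sum_mono) (rule leaf_term)
  finally show ?thesis .
qed

section \<open>Optimal size of the cascade\<close>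

lemma core_not_const:
  assumes "i < a"
  shows "\<not> const_on_cube n (core i)"
proof
  assume "const_on_cube n (core i)"
  then obtain c where c: "\<And>x. x \<in> cube n \<Longrightarrow> core i x = c" by (auto simp: const_on_cube_def)
  have "0 < avg n (\<lambda>x. of_bool (\<tau> i x = 0))" using prob_\<tau>_gt[OF assms M_pos] \<gamma>_nonneg by simp
  moreover have "avg n (\<lambda>x. of_bool (\<tau> i x = 0)) = 0" if "\<forall>x\<in>cube n. \<tau> i x \<noteq> 0"
    by (rule avg_const) (use that in simp)
  ultimately obtain x where x: "x \<in> cube n" "\<tau> i x = 0" by force
  have "card (Y i 0) \<noteq> 0" using card_block[OF assms M_pos] k_pos by (simp add: Y_def)
  then have "Y i 0 \<noteq> {}" by (metis card.empty)
  then obtain v where v: "v \<in> Y i 0" by blast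
  let ?y = "x(v := \<not> x v)"
  have "\<tau> i ?y = 0"
    using dep_upd[OF dep_\<tau>[OF assms], of v x "\<not> x v"] v x by (simp add: Y_def)
  then have "core i ?y = - core i x" using x v M_pos by (simp add: core_def parity_flip)
  moreover have "?y \<in> cube n" using v x by (intro cube_upd) (auto simp: Y_def)
  ultimately show False using c[of x] c[of ?y] x pm_core[of i] by (auto simp: pm_def dest: spec[of _ x])
qed

text \<open>Nonconstant cores rule out the exception in \<open>opt_dt_size_branch\<close>, so the
  sizes add exactly. Thus the cascade can be brought to any large enough size through
  \<open>h\<close> alone, without knowing the optimal sizes of the cores.\<close>

lemma opt_casc: "m \<le> a \<Longrightarrow> opt_dt_size n (casc m) = opt_dt_size n h + (\<Sum>i<m. opt_dt_size n (core i))"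
proof (induction m)
  case 0
  have "casc 0 = h" by auto
  then show ?case by simp
next
  case (Suc m)
  then have m: "m < a" by simp
  have "opt_dt_size n (casc (Suc m)) = opt_dt_size n (\<lambda>x. if x (u m) then casc m x else core m x)"
    by (rule arg_cong[of _ _ "opt_dt_size n"]) auto
  also have "\<dots> = opt_dt_size n (casc m) + opt_dt_size n (core m)"
  proof (rule opt_dt_size_branch[OF pm_casc pm_core dep_casc dep_core])
    show "below m \<inter> grp m = {}" by (auto simp: below_def grp_def)
    show "\<not> (\<exists>c. \<forall>x\<in>cube n. casc m x = c \<and> core m x = c)"
      using core_not_const[OF m] by (auto simp: const_on_cube_def)
  qed (use m switch[OF m] in \<open>auto simp: below_def grp_def\<close>)
  finally show ?case using Suc.IH m by (simp del: casc.simps)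
qed

end

section \<open>Tribes as selectors\<close>

text \<open>The index of the group, of \<open>r\<close> terms each, of the last satisfied term; a term is the
  conjunction of \<open>w\<close> variables. If no term is satisfied the value is the non-index \<open>M\<close>.\<close>

fun tribe :: "nat \<Rightarrow> nat \<Rightarrow> nat \<Rightarrow> nat \<Rightarrow> nat \<Rightarrow> (nat \<Rightarrow> bool) \<Rightarrow> nat" where
  "tribe w r M off 0 x = M"
| "tribe w r M off (Suc t) x =
     (if \<forall>v\<in>{off + t * w..<off + t * w + w}. x v then t div r else tribe w r M off t x)"

section \<open>Distribution and influences of the selector\<close>

lemma dep_tribe: "dep {off..<off + t * w} (tribe w r M off t)"
proof (induction t)
  case 0
  show ?case by (simp add: dep_def)
next
  case (Suc t)
  show ?case unfolding dep_def
  proof (intro allI impI)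
    fix x y :: "nat \<Rightarrow> bool" assume eq: "\<forall>v\<in>{off..<off + Suc t * w}. x v = y v"
    have "tribe w r M off t x = tribe w r M off t y"
      by (rule depD[OF Suc.IH]) (use eq in simp)
    moreover have "(\<forall>v\<in>{off + t * w..<off + t * w + w}. x v) = (\<forall>v\<in>{off + t * w..<off + t * w + w}. y v)"
      using eq by (intro ball_cong) auto
    ultimately show "tribe w r M off (Suc t) x = tribe w r M off (Suc t) y" by simp
  qed
qed

text \<open>Term \<open>t\<close> has its own variables: with probability \<open>(1/2) ^ w\<close>
  it is satisfied and overrides the earlier terms, otherwise they decide, independently of
  it.\<close>

lemma prob_tribe_Suc:
  assumes "off + Suc t * w \<le> n"
  shows "avg n (\<lambda>x. of_bool (Q (tribe w r M off (Suc t) x)))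
    = (1/2) ^ w * of_bool (Q (t div r)) + (1 - (1/2) ^ w) * avg n (\<lambda>x. of_bool (Q (tribe w r M off t x)))"
proof -
  let ?V = "{off + t * w..<off + t * w + w}"
  let ?A = "\<lambda>x. of_bool (\<forall>v\<in>?V. x v) :: real" and ?B = "\<lambda>x. of_bool (Q (tribe w r M off t x)) :: real"
  have V: "?V \<subseteq> {..<n}" using assms by auto
  have A: "avg n ?A = (1/2) ^ w" using avg_all_true[OF V] by simp
  have depA: "dep ?V ?A" by (rule dep_comp[where F = of_bool]) (simp add: dep_def)
  have depB: "dep {off..<off + t * w} ?B"
    by (rule dep_comp[where F = "\<lambda>i. of_bool (Q i)"]) (rule dep_tribe)
  have AB: "avg n (\<lambda>x. ?A x * ?B x) = (1/2) ^ w * avg n ?B"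
    unfolding A[symmetric] by (rule avg_indep[OF depA depB _ V]) auto
  have "avg n (\<lambda>x. of_bool (Q (tribe w r M off (Suc t) x)))
      = avg n (\<lambda>x. of_bool (Q (t div r)) * ?A x + (?B x - ?A x * ?B x))"
    by (rule avg_cong) (simp add: of_bool_def)
  also have "\<dots> = of_bool (Q (t div r)) * avg n ?A + (avg n ?B - avg n (\<lambda>x. ?A x * ?B x))"
    by (simp only: avg_add avg_cmult avg_diff)
  finally show ?thesis by (simp only: A AB) (simp add: algebra_simps)
qed

lemma prob_tribe_none:
  assumes "t \<le> r * M" "off + t * w \<le> n"
  shows "avg n (\<lambda>x. of_bool (\<not> tribe w r M off t x < M)) = (1 - (1/2) ^ w) ^ t"
  using assms
proof (induction t)
  case 0
  then show ?case by (simp add: avg_const)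
next
  case (Suc t)
  have "t div r < M" using Suc.prems(1) by (simp add: less_mult_imp_div_less mult.commute)
  then show ?case using prob_tribe_Suc[OF Suc.prems(2), of "\<lambda>i. \<not> i < M" r M] Suc by simp
qed

text \<open>Each of the \<open>c\<close> terms belonging to index \<open>j\<close> wins with
  probability \<open>(1/2) ^ w\<close> times the probability that all later terms fail, and the
  latter lies between \<open>(1 - (1/2) ^ w) ^ t\<close> and 1.\<close>

lemma prob_tribe_bounds:
  fixes w r M off t n j
  defines "P \<equiv> avg n (\<lambda>x. of_bool (tribe w r M off t x = j))" and "c \<equiv> card {t'. t' < t \<and> t' div r = j}"
  assumes "off + t * w \<le> n" "j < M"
  shows "(1/2) ^ w * (1 - (1/2) ^ w) ^ t * real c \<le> P" "P \<le> (1/2) ^ w * real c"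
proof -
  let ?p = "(1/2 :: real) ^ w"
  have p: "0 \<le> ?p" "?p \<le> 1" by (simp_all add: power_le_one)
  have "?p * (1 - ?p) ^ t * real (card {t'. t' < t \<and> t' div r = j})
      \<le> avg n (\<lambda>x. of_bool (tribe w r M off t x = j)) \<and>
    avg n (\<lambda>x. of_bool (tribe w r M off t x = j)) \<le> ?p * real (card {t'. t' < t \<and> t' div r = j})"
    using assms(3)
  proof (induction t)
    case 0
    have "avg n (\<lambda>x. of_bool (tribe w r M off 0 x = j)) = 0" using assms(4) by (intro avg_const) simp
    then show ?case by simp
  next
    case (Suc t)
    let ?P = "avg n (\<lambda>x. of_bool (tribe w r M off t x = j))"
    let ?c = "real (card {t'. t' < t \<and> t' div r = j})" and ?d = "of_bool (t div r = j) :: real"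
    have IH: "?p * (1 - ?p) ^ t * ?c \<le> ?P" "?P \<le> ?p * ?c" using Suc by auto
    have step: "avg n (\<lambda>x. of_bool (tribe w r M off (Suc t) x = j)) = ?p * ?d + (1 - ?p) * ?P"
      by (rule prob_tribe_Suc[OF Suc.prems, of "\<lambda>i. i = j"])
    have "{t'. t' < Suc t \<and> t' div r = j} = {t'. t' < t \<and> t' div r = j} \<union> (if t div r = j then {t} else {})"
      by (auto simp: less_Suc_eq)
    then have card: "real (card {t'. t' < Suc t \<and> t' div r = j}) = ?c + ?d" by (simp add: card_insert_if)
    have "(1 - ?p) ^ Suc t * ?d \<le> 1 * ?d"
      using p by (intro mult_right_mono power_le_one) auto
    then have "?p * ((1 - ?p) ^ Suc t * ?d) \<le> ?p * ?d" using p by (intro mult_left_mono) auto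
    moreover have "(1 - ?p) * (?p * (1 - ?p) ^ t * ?c) \<le> (1 - ?p) * ?P"
      using p IH(1) by (intro mult_left_mono) auto
    ultimately have 1: "?p * (1 - ?p) ^ Suc t * (?c + ?d) \<le> ?p * ?d + (1 - ?p) * ?P"
      by (simp add: algebra_simps)
    have "0 \<le> ?p * ?P" using p by (intro mult_nonneg_nonneg avg_nonneg) auto
    moreover have "(1 - ?p) * ?P = ?P - ?p * ?P" "?p * (?c + ?d) = ?p * ?c + ?p * ?d"
      by (simp_all add: algebra_simps)
    ultimately have 2: "?p * ?d + (1 - ?p) * ?P \<le> ?p * (?c + ?d)" using IH(2) by linarith
    show ?case using 1 2 by (simp only: step card)
  qed
  then show "?p * (1 - ?p) ^ t * real c \<le> P" "P \<le> ?p * real c" by (simp_all add: P_def c_def)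
qed

lemma card_group:
  assumes "0 < r" "j < M"
  shows "card {t. t < r * M \<and> t div r = j} = r"
proof -
  have "{t. t < r * M \<and> t div r = j} = {j * r..<j * r + r}"
  proof (intro set_eqI iffI)
    fix t assume t: "t \<in> {j * r..<j * r + r}"
    then have "t div r = j" by (intro div_nat_eqI) (auto simp: mult.commute)
    moreover have "j * r + r \<le> r * M" using assms(2) mult_le_mono2[of "Suc j" M r] by (simp add: algebra_simps)
    ultimately show "t \<in> {t. t < r * M \<and> t div r = j}" using t by simp
  next
    fix t assume t: "t \<in> {t. t < r * M \<and> t div r = j}"
    then show "t \<in> {j * r..<j * r + r}"
      using div_mult_mod_eq[of t r] mod_less_divisor[OF assms(1), of t] div_times_less_eq_dividend[of t r]
      by auto
  qed
  then show ?thesis by simp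
qed

lemma tribe_flip:
  assumes "v \<in> {off + s * w..<off + s * w + w}" "v' \<in> {off + s * w..<off + s * w + w}" "v' \<noteq> v" "\<not> x v'"
  shows "tribe w r M off t (x(v := b)) = tribe w r M off t x"
proof (induction t)
  case (Suc t)
  have "(\<forall>i\<in>{off + t * w..<off + t * w + w}. (x(v := b)) i) = (\<forall>i\<in>{off + t * w..<off + t * w + w}. x i)"
  proof (cases "t = s")
    case True
    have "(x(v := b)) v' = x v'" using assms(3) by simp
    then show ?thesis using assms(2,4) True by blast
  next
    case False
    have "v \<notin> {off + t * w..<off + t * w + w}"
    proof
      assume v: "v \<in> {off + t * w..<off + t * w + w}"
      have "(v - off) div w = t" using v by (intro div_nat_eqI) (auto simp: mult.commute)
      moreover have "(v - off) div w = s" using assms(1) by (intro div_nat_eqI) (auto simp: mult.commute)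
      ultimately show False using False by simp
    qed
    then show ?thesis by (intro ball_cong) auto
  qed
  then show ?case unfolding tribe.simps using Suc by presburger
qed simp

text \<open>A flip of \<open>v\<close> matters only if the other \<open>w - 1\<close> variables of
  its term are all 1.\<close>

lemma influence_tribe_le:
  assumes "v \<in> {off + s * w..<off + s * w + w}" "off + s * w + w \<le> n"
  shows "influence n v (\<lambda>x. real (tribe w r M off t x)) \<le> 2 * (1/2) ^ w"
proof -
  let ?V = "{off + s * w..<off + s * w + w} - {v}"
  have "influence n v (\<lambda>x. real (tribe w r M off t x)) \<le> avg n (\<lambda>x. of_bool (\<forall>i\<in>?V. x i))"
    unfolding influence_avg
  proof (rule avg_mono)
    fix x
    show "of_bool (real (tribe w r M off t x) \<noteq> real (tribe w r M off t (x(v := \<not> x v))))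
        \<le> (of_bool (\<forall>i\<in>?V. x i) :: real)"
    proof (cases "\<forall>i\<in>?V. x i")
      case False
      then obtain v' where "v' \<in> {off + s * w..<off + s * w + w}" "v' \<noteq> v" "\<not> x v'" by blast
      then have "tribe w r M off t (x(v := \<not> x v)) = tribe w r M off t x"
        by (rule tribe_flip[OF assms(1)])
      then show ?thesis by simp
    qed simp
  qed
  also have "\<dots> = (1/2) ^ card ?V" by (rule avg_all_true) (use assms(2) in auto)
  also have "card ?V = w - 1" using assms(1) by simp
  also have "(1/2 :: real) ^ (w - 1) = 2 * (1/2) ^ w" using assms(1) by (cases w) auto
  finally show ?thesis .
qed

section \<open>Upper bounds on the optimal size of a core\<close>

lemma opt_dt_size_conj_le:
  assumes "pm g" "pm h" "off + w \<le> n"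
  shows "opt_dt_size n (\<lambda>x. if \<forall>v\<in>{off..<off + w}. x v then g x else h x)
    \<le> opt_dt_size n g + w * opt_dt_size n h"
  using assms(3)
proof (induction w)
  case 0
  then show ?case by simp
next
  case (Suc w)
  let ?F = "\<lambda>x. if \<forall>v\<in>{off..<off + w}. x v then g x else h x"
  have eq: "(\<lambda>x. if \<forall>v\<in>{off..<off + Suc w}. x v then g x else h x) = (\<lambda>x. if x (off + w) then ?F x else h x)"
    by (auto simp: fun_eq_iff atLeastLessThanSuc)
  have pmF: "pm ?F" using assms(1,2) by (simp add: pm_def)
  have "opt_dt_size n (\<lambda>x. if x (off + w) then ?F x else h x) \<le> opt_dt_size n ?F + opt_dt_size n h"
    by (rule opt_dt_size_branch_le[OF pmF assms(2)]) (use Suc.prems in simp)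
  moreover have "opt_dt_size n ?F \<le> opt_dt_size n g + w * opt_dt_size n h" using Suc by simp
  ultimately show ?case unfolding eq by simp
qed

lemma opt_dt_size_parity_le:
  assumes "finite S" "S \<subseteq> {..<n}"
  shows "opt_dt_size n (parity S) \<le> 2 ^ card S"
  using assms
proof (induction S rule: finite_induct)
  case empty
  have "parity {} = (\<lambda>_. 1)" by (auto simp: parity_def)
  then show ?case by (simp add: opt_dt_size_one)
next
  case (insert v S)
  have "parity (insert v S) = (\<lambda>x. if x v then - parity S x else parity S x)"
    using insert.hyps by (auto simp: parity_def fun_eq_iff)
  then show ?case
    using opt_dt_size_branch_le[OF pm_uminus[OF pm_parity[of S]] pm_parity[of S], of v n] insert
    by (simp add: opt_dt_size_uminus[OF pm_parity])
qed

text \<open>Reading the terms from the last one down gives the recurrence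
  \<open>T(t + 1) \<le> 2^k + w * T(t)\<close>: one exit to a parity, and \<open>w\<close> exits to
  the remaining terms.\<close>

lemma opt_dt_size_tribe_le:
  assumes "\<And>j. opt_dt_size n (parity (S j)) \<le> 2 ^ k" "off + t * w \<le> n" "t \<le> r * M"
  shows "opt_dt_size n (\<lambda>x. if tribe w r M off t x < M then parity (S (tribe w r M off t x)) x else 1)
    \<le> (w + 1) ^ t * 2 ^ k"
  using assms(2,3)
proof (induction t)
  case 0
  then show ?case by (simp add: opt_dt_size_one)
next
  case (Suc t)
  let ?h = "\<lambda>x. if tribe w r M off t x < M then parity (S (tribe w r M off t x)) x else 1"
  have div: "t div r < M" using Suc.prems(2) by (simp add: less_mult_imp_div_less mult.commute)
  have eq: "(\<lambda>x. if tribe w r M off (Suc t) x < M then parity (S (tribe w r M off (Suc t) x)) x else 1)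
      = (\<lambda>x. if \<forall>v\<in>{off + t * w..<off + t * w + w}. x v then parity (S (t div r)) x else ?h x)"
    using div by (auto simp: fun_eq_iff)
  have pmh: "pm ?h" using pm_parity by (auto simp: pm_def)
  have "opt_dt_size n (\<lambda>x. if \<forall>v\<in>{off + t * w..<off + t * w + w}. x v then parity (S (t div r)) x else ?h x)
      \<le> opt_dt_size n (parity (S (t div r))) + w * opt_dt_size n ?h"
    by (rule opt_dt_size_conj_le[OF pm_parity pmh]) (use Suc.prems in simp)
  also have "\<dots> \<le> 2 ^ k + w * ((w + 1) ^ t * 2 ^ k)"
    using Suc by (intro add_mono mult_le_mono assms(1)) auto
  also have "\<dots> \<le> (w + 1) ^ t * 2 ^ k + w * ((w + 1) ^ t * 2 ^ k)" by simp
  also have "\<dots> = (w + 1) ^ Suc t * 2 ^ k" by (simp add: algebra_simps)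
  finally show ?case unfolding eq .
qed

text \<open>The first \<open>a\<close> intervals of length \<open>m\<close> each hold a switch, then \<open>z\<close> selector variables,
  then blocks of \<open>k\<close> parity variables; the rest is filler.\<close>

definition layout :: "nat \<Rightarrow> nat \<Rightarrow> nat \<Rightarrow> nat \<Rightarrow> nat \<Rightarrow> vclass" where
  "layout a m z k v = (let i = v div m; e = v mod m in
     if a \<le> i then Filler else if e = 0 then Switch i else if e \<le> z then Selector i
     else Block i ((e - 1 - z) div k))"

lemma layout_eq:
  "e < m \<Longrightarrow> layout a m z k (i * m + e) = (if a \<le> i then Filler else if e = 0 then Switch i
     else if e \<le> z then Selector i else Block i ((e - 1 - z) div k))"
  by (simp add: layout_def Let_def)

lemma layout_cases:
  fixes v m :: nat
  assumes "0 < m"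
  obtains i e where "v = i * m + e" "e < m"
  using that[of "v div m" "v mod m"] assms by simp

text \<open>The last assumption says that a group of \<open>r\<close> terms is selected with
  probability larger than \<open>2 * (1/2) ^ w\<close>, the bound on the influence of a selector
  variable; it yields \<open>prob_\<tau>_gt\<close>.\<close>

lemma tribe_cascade:
  fixes n a M k w r :: nat and h :: "(nat \<Rightarrow> bool) \<Rightarrow> real"
  defines "z \<equiv> r * M * w"
  defines "m \<equiv> 1 + z + M * k"
  assumes "0 < k" "0 < M" "0 < r" "a * m \<le> n" "pm h" "dep {a * m..<n} h"
    and "2 < real r * (1 - (1/2) ^ w) ^ (r * M)"
  shows "cascade n a M k (layout a m z k) (\<lambda>i. i * m) (\<lambda>i. tribe w r M (i * m + 1) (r * M)) h
    (2 * (1/2) ^ w) ((1/2) ^ w * real r) ((1 - (1/2) ^ w) ^ (r * M))"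
proof
  have m: "0 < m" by (simp add: m_def)
  have next_le: "i * m + m \<le> n" if "i < a" for i
    using mult_le_mono1[of "Suc i" a m] that assms(6) by simp
  show "i * m < n \<and> layout a m z k (i * m) = Switch i" if "i < a" for i
    using next_le[OF that] m layout_eq[OF m, of a z k i] that by simp
  have zm: "i * m + 1 + z \<le> n" if "i < a" for i
    using next_le[OF that] by (simp add: m_def)
  show "card {v. v < n \<and> layout a m z k v = Block i j} = k" if "i < a" "j < M" for i j
  proof -
    have jk: "j * k + k \<le> M * k" using that(2) mult_le_mono1[of "Suc j" M k] by simp
    have "{v. v < n \<and> layout a m z k v = Block i j} = {i * m + 1 + z + j * k..<i * m + 1 + z + j * k + k}"
    proof (intro set_eqI iffI)
      fix v assume v: "v \<in> {i * m + 1 + z + j * k..<i * m + 1 + z + j * k + k}"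
      define e where "e = v - i * m"
      have e: "v = i * m + e" "1 + z + j * k \<le> e" "e < 1 + z + j * k + k" using v by (auto simp: e_def)
      then have "e < m" using jk by (simp add: m_def)
      moreover have "(e - 1 - z) div k = j" using e by (intro div_nat_eqI) (auto simp: mult.commute)
      ultimately show "v \<in> {v. v < n \<and> layout a m z k v = Block i j}"
        using e that layout_eq[of e m a z k i] next_le[OF that(1)] by auto
    next
      fix v assume v: "v \<in> {v. v < n \<and> layout a m z k v = Block i j}"
      obtain i' e where e: "v = i' * m + e" "e < m" by (rule layout_cases[OF m])
      then have "i' = i" "z < e" "(e - 1 - z) div k = j"
        using v layout_eq[OF e(2), of a z k i'] by (auto split: if_splits)
      moreover have "j * k \<le> e - 1 - z" "e - 1 - z < j * k + k"
        using calculation(3) assms(3) div_times_less_eq_dividend[of "e - 1 - z" k]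
          dividend_less_div_times[of k "e - 1 - z"] by auto
      ultimately have "i' = i" "1 + z + j * k \<le> e" "e < 1 + z + j * k + k" by linarith+
      then show "v \<in> {i * m + 1 + z + j * k..<i * m + 1 + z + j * k + k}" using e by simp
    qed
    then show ?thesis by simp
  qed
  show "dep {v. v < n \<and> layout a m z k v = Selector i} (tribe w r M (i * m + 1) (r * M))" if "i < a" for i
  proof (rule dep_mono[OF dep_tribe])
    show "{i * m + 1..<i * m + 1 + r * M * w} \<subseteq> {v. v < n \<and> layout a m z k v = Selector i}"
    proof
      fix v assume v: "v \<in> {i * m + 1..<i * m + 1 + r * M * w}"
      define e where "e = v - i * m"
      have e: "v = i * m + e" "1 \<le> e" "e \<le> z" using v by (auto simp: e_def z_def)
      then have "e < m" by (simp add: m_def)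
      then show "v \<in> {v. v < n \<and> layout a m z k v = Selector i}"
        using e that layout_eq[of e m a z k i] zm[OF that] by auto
    qed
  qed
  show "dep {v. v < n \<and> layout a m z k v = Filler} h"
  proof (rule dep_mono[OF assms(8)])
    show "{a * m..<n} \<subseteq> {v. v < n \<and> layout a m z k v = Filler}"
    proof
      fix v assume v: "v \<in> {a * m..<n}"
      then have "a \<le> v div m" using m by (simp add: less_eq_div_iff_mult_less_eq)
      then show "v \<in> {v. v < n \<and> layout a m z k v = Filler}" using v by (simp add: layout_def)
    qed
  qed
  show "influence n v (\<lambda>x. real (tribe w r M (i * m + 1) (r * M) x)) \<le> 2 * (1/2) ^ w"
    if "i < a" "layout a m z k v = Selector i" for i v
  proof -
    obtain i' e where e: "v = i' * m + e" "e < m" by (rule layout_cases[OF m])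
    then have i': "i' = i" "e \<noteq> 0" "e \<le> z"
      using that(2) layout_eq[OF e(2), of a z k i'] by (auto split: if_splits)
    \<comment> \<open>The term containing \<open>v\<close>: offset 0 of an interval is its switch,
      so the selector variables start at offset 1.\<close>
    define s where "s = (e - 1) div w"
    have "0 < w" using i' by (cases "w = 0") (auto simp: z_def)
    then have s: "s * w \<le> e - 1" "e - 1 < s * w + w"
      using div_times_less_eq_dividend[of "e - 1" w] dividend_less_div_times[of w "e - 1"] by (auto simp: s_def)
    have "s < r * M" unfolding s_def by (rule less_mult_imp_div_less) (use i' in \<open>simp add: z_def\<close>)
    then have "s * w + w \<le> z" unfolding z_def using mult_le_mono1[of "Suc s" "r * M" w] by simp
    then show ?thesis
      using s e i' zm[OF that(1)] by (intro influence_tribe_le[where s = s]) auto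
  qed
  let ?p = "(1/2 :: real) ^ w"
  have bound: "?p * (1 - ?p) ^ (r * M) * real r \<le> avg n (\<lambda>x. of_bool (tribe w r M (i * m + 1) (r * M) x = j))"
    "avg n (\<lambda>x. of_bool (tribe w r M (i * m + 1) (r * M) x = j)) \<le> ?p * real r"
    if "i < a" "j < M" for i j
    using prob_tribe_bounds[of "i * m + 1" "r * M" w n j M r] zm[OF that(1)] that(2) card_group[OF assms(5) that(2)]
    by (simp_all add: z_def)
  show "2 * ?p < avg n (\<lambda>x. of_bool (tribe w r M (i * m + 1) (r * M) x = j))" if "i < a" "j < M" for i j
  proof -
    have "?p * 2 < ?p * (real r * (1 - ?p) ^ (r * M))" using assms(9) by (intro mult_strict_left_mono) auto
    also have "\<dots> = ?p * (1 - ?p) ^ (r * M) * real r" by (simp only: mult_ac)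
    also note bound(1)[OF that]
    finally show ?thesis by (simp only: mult.commute)
  qed
  show "avg n (\<lambda>x. of_bool (tribe w r M (i * m + 1) (r * M) x = j)) \<le> ?p * real r" if "i < a" "j < M" for i j
    by (rule bound(2)[OF that])
  show "avg n (\<lambda>x. of_bool (\<not> tribe w r M (i * m + 1) (r * M) x < M)) \<le> (1 - ?p) ^ (r * M)" if "i < a" for i
    using prob_tribe_none[of "r * M" r M "i * m + 1" w n] zm[OF that] by (simp add: z_def)
qed (use assms in auto)

lemma tribe_cascade_hard:
  fixes n a M k w r b D s :: nat and \<theta> \<epsilon> :: real
  defines "\<eta> \<equiv> (1 - (1/2) ^ w :: real) ^ (r * M)"
  assumes "0 < k" "0 < M" "0 < r" and n: "a * (1 + r * M * w + M * k) + 2 * b \<le> n" and "0 < n"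
    and r: "2 < real r * \<eta>"
    and s: "a * ((w + 1) ^ (r * M) * 2 ^ k) < s" "s \<le> 2 ^ b"
    and D: "D < k * M" "real D * ((1/2) ^ w * real r) \<le> \<theta> * real k"
    and "0 \<le> \<theta>" "\<eta> + \<theta> \<le> 1" "0 \<le> \<epsilon>"
  shows "\<exists>f. pm f \<and> opt_dt_size n f = s \<and>
    (1 - \<eta> - \<theta>) / 2 * (1 - (1/2) ^ a - real (topdown_dt_size n f \<epsilon>) / 2 ^ D) \<le> \<epsilon>"
proof -
  define z where "z = r * M * w"
  define m where "m = 1 + z + M * k"
  have am: "a * m + 2 * b \<le> n" using n by (simp add: m_def z_def)
  note casc = tribe_cascade[OF assms(2-4), of a w n, folded z_def, folded m_def \<eta>_def]
  define Y where "Y i j = {v. v < n \<and> layout a m z k v = Block i j}" for i j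
  define core where "core i x = (if tribe w r M (i * m + 1) (r * M) x < M
      then parity (Y i (tribe w r M (i * m + 1) (r * M) x)) x else 1)" for i x
  \<comment> \<open>A preliminary instance with trivial filler. It gives access to the block sizes
    before \<open>h\<close> is chosen; the cores are the same in both instances.\<close>
  have c1: "cascade n a M k (layout a m z k) (\<lambda>i. i * m) (\<lambda>i. tribe w r M (i * m + 1) (r * M)) (\<lambda>_. 1)
    (2 * (1/2) ^ w) ((1/2) ^ w * real r) \<eta>"
    by (rule casc) (use am r in \<open>auto simp: pm_def dep_def\<close>)
  interpret c1: cascade n a M k "layout a m z k" "\<lambda>i. i * m" "\<lambda>i. tribe w r M (i * m + 1) (r * M)" "\<lambda>_. 1"
    "2 * (1/2) ^ w" "(1/2) ^ w * real r" \<eta>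
    by (rule c1)
  have core_le: "opt_dt_size n (core i) \<le> (w + 1) ^ (r * M) * 2 ^ k" if "i < a" for i
  proof -
    \<comment> \<open>\<open>opt_dt_size_tribe_le\<close> asks for a bound at every index, so
      indices outside the range get the empty parity.\<close>
    define S where "S j = (if j < M then Y i j else {})" for j
    have par: "opt_dt_size n (parity (S j)) \<le> 2 ^ k" for j
    proof (cases "j < M")
      case True
      then have "card (S j) = k" using c1.card_block[OF that] by (simp add: S_def Y_def)
      moreover have "finite (S j)" "S j \<subseteq> {..<n}" by (auto simp: S_def Y_def)
      ultimately show ?thesis using opt_dt_size_parity_le[of "S j" n] by simp
    next
      case False
      then have "opt_dt_size n (parity (S j)) \<le> 1"
        using opt_dt_size_parity_le[of "S j" n] by (simp add: S_def)
      also have "(1::nat) \<le> 2 ^ k" by simp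
      finally show ?thesis .
    qed
    have "i * m + m \<le> a * m" using that mult_le_mono1[of "Suc i" a m] by simp
    then have "i * m + 1 + r * M * w \<le> n" using am by (simp add: m_def z_def)
    from opt_dt_size_tribe_le[where S = S, OF par this]
    have "opt_dt_size n (\<lambda>x. if tribe w r M (i * m + 1) (r * M) x < M
      then parity (S (tribe w r M (i * m + 1) (r * M) x)) x else 1) \<le> (w + 1) ^ (r * M) * 2 ^ k" by simp
    also have "(\<lambda>x. if tribe w r M (i * m + 1) (r * M) x < M
      then parity (S (tribe w r M (i * m + 1) (r * M) x)) x else 1) = core i"
      by (auto simp: core_def S_def fun_eq_iff)
    finally show ?thesis .
  qed
  have "(\<Sum>i<a. opt_dt_size n (core i)) \<le> a * ((w + 1) ^ (r * M) * 2 ^ k)"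
    using sum_bounded_above[of "{..<a}" "\<lambda>i. opt_dt_size n (core i)"] core_le by simp
  \<comment> \<open>What the cores leave of \<open>s\<close> is positive, hence a possible optimal
    size for the filler.\<close>
  then have A: "1 \<le> s - (\<Sum>i<a. opt_dt_size n (core i))" "s - (\<Sum>i<a. opt_dt_size n (core i)) \<le> 2 ^ b"
    and sum_lt: "(\<Sum>i<a. opt_dt_size n (core i)) < s"
    using s by auto
  obtain h where h: "pm h" "dep {a * m..<a * m + 2 * b} h"
    "opt_dt_size n h = s - (\<Sum>i<a. opt_dt_size n (core i))"
    using opt_dt_size_attained[OF A am] by blast
  interpret c: cascade n a M k "layout a m z k" "\<lambda>i. i * m" "\<lambda>i. tribe w r M (i * m + 1) (r * M)" h
    "2 * (1/2) ^ w" "(1/2) ^ w * real r" \<eta>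
    by (rule casc) (use am r h(1) dep_mono[OF h(2)] in auto)
  have "c.core i = core i" for i 
    by (rule ext) (simp only: c.core_def core_def c.Y_def Y_def)
  then have opt: "opt_dt_size n (c.casc a) = s" using c.opt_casc[of a] h(3) sum_lt by simp
  obtain t where t: "greedy n (c.casc a) t" "dt_error n (c.casc a) t \<le> \<epsilon>"
    "topdown_dt_size n (c.casc a) \<epsilon> = dt_size t"
    using topdown_dt_sizeE[OF c.pm_casc assms(14) \<open>0 < n\<close>] by metis
  have "0 \<le> \<eta>" by (simp add: \<eta>_def power_le_one)
  then have "(1 - \<eta> - \<theta>) / 2 * (1 - (1/2) ^ a - real (dt_size t) / 2 ^ D) \<le> \<epsilon>"
    using c.greedy_error[OF t(1) D] assms(12,13) t(2) by simp
  then show ?thesis using opt t(3) c.pm_casc by metis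
qed

section \<open>Choice of parameters\<close>

text \<open>Two uses of Bernoulli's inequality, with \<open>p = (1/2) ^ w\<close>. For the upper
  bound it is applied to \<open>1 / (1 - p) = 1 + p / (1 - p)\<close>. For the lower bound it is
  applied with half the exponent, where it gives 1/2 (with the full exponent it would only give 0),
  and the result is squared.\<close>

lemma one_minus_inverse_power_bounds:
  assumes "1 \<le> w"
  shows "(1 - (1/2) ^ w :: real) ^ (2 ^ w) \<le> 1/2" "1/4 \<le> (1 - (1/2) ^ w :: real) ^ (2 ^ w)"
proof -
  let ?p = "(1/2 :: real) ^ w"
  have W: "real (2 ^ w) * ?p = 1" by (simp add: power_one_over)
  have p: "0 < ?p" "?p \<le> 1/2" using power_decreasing[OF assms, of "1/2 :: real"] by auto
  have "1 + real (2 ^ w) * (?p / (1 - ?p)) \<le> (1 + ?p / (1 - ?p)) ^ (2 ^ w)"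
    by (rule Bernoulli_inequality) (use p in \<open>simp add: field_simps\<close>)
  also have "1 + ?p / (1 - ?p) = inverse (1 - ?p)" using p by (simp add: field_simps)
  also have "real (2 ^ w) * (?p / (1 - ?p)) = 1 / (1 - ?p)" using W by (metis times_divide_eq_right)
  finally have "1 + 1 / (1 - ?p) \<le> inverse (1 - ?p) ^ (2 ^ w)" .
  moreover have "1 \<le> 1 / (1 - ?p)" using p by simp
  ultimately have "2 \<le> inverse ((1 - ?p) ^ (2 ^ w))" unfolding power_inverse by linarith
  then show "(1 - ?p) ^ (2 ^ w) \<le> 1/2"
    using p by (simp add: field_simps)
  obtain v where v: "w = Suc v" using assms by (cases w) auto
  have "1 + real (2 ^ v) * (- ?p) \<le> (1 + (- ?p)) ^ (2 ^ v)"
    by (rule Bernoulli_inequality) (use p in simp)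
  moreover have "real (2 ^ v) * ?p = 1/2" using W v by simp
  ultimately have "1/2 \<le> (1 - ?p) ^ (2 ^ v)" by simp
  then have "(1/2)\<^sup>2 \<le> ((1 - ?p) ^ (2 ^ v))\<^sup>2" by (rule power_mono) simp
  also have "((1 - ?p) ^ (2 ^ v))\<^sup>2 = (1 - ?p) ^ (2 ^ w)"
    by (simp add: v power_mult[symmetric] mult.commute)
  finally show "1/4 \<le> (1 - ?p) ^ (2 ^ w)" by (simp add: power2_eq_square)
qed

text \<open>There are \<open>c\<close> cores. The lower bound on \<open>s\<close> pays for
  \<open>c\<close> trees of size \<open>(w + 1) ^ (c * 2 ^ w) * 2 ^ (2 ^ w)\<close>. In the bound on
  \<open>n\<close>, the first summand pays for the variables of the cores and \<open>2 * b\<close>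
  for the filler.\<close>

lemma hard_functions:
  fixes \<epsilon> :: real
  assumes "0 < \<epsilon>" "\<epsilon> < 1/2"
  shows "\<exists>c::nat. \<exists>\<beta>>0. 1 \<le> c \<and> \<beta> \<le> 1 \<and> (\<forall>w n b s.
    2 * c + 2 \<le> w \<longrightarrow> 2 ^ (3 * c * w * 2 ^ w) \<le> s \<longrightarrow> s \<le> 2 ^ b \<longrightarrow> 3 * c\<^sup>2 * 4 ^ w + 2 * b \<le> n \<longrightarrow>
    (\<exists>f. pm f \<and> opt_dt_size n f = s \<and>
      real (topdown_dt_size n f \<epsilon>) \<ge> \<beta> * 2 ^ nat \<lfloor>\<beta> * 4 ^ w / 4 ^ (c + 1)\<rfloor>))"
proof -
  \<comment> \<open>Four quantities will be bounded by \<open>\<beta>\<close>: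
    \<open>\<eta>\<close>, \<open>\<theta>\<close>, the probability \<open>(1/2) ^ c\<close> of
    reaching the filler, and the weight of the deep leaves. The error is then at least
    \<open>(1 - 2 * \<beta>)\<^sup>2 / 2\<close>, which exceeds
    \<open>(1 - 4 * \<beta>) / 2 = \<epsilon>\<close>.\<close>
  define \<beta> where "\<beta> = (1 - 2 * \<epsilon>) / 4"
  have \<beta>: "0 < \<beta>" "\<beta> \<le> 1/4" using assms by (auto simp: \<beta>_def)
  \<comment> \<open>\<open>c\<close> has two uses: as the number of cores, and as the factor in the
    number \<open>c * 2 ^ w\<close> of terms of a selector, which makes
    \<open>\<eta> \<le> (1/2) ^ c\<close>.\<close>
  obtain c where c: "(1/2) ^ c < \<beta>" using real_arch_pow_inv[of \<beta> "1/2"] \<beta> by auto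
  have c1: "1 \<le> c" using c \<beta> by (cases c) auto
  have "\<exists>f. pm f \<and> opt_dt_size n f = s \<and> real (topdown_dt_size n f \<epsilon>) \<ge> \<beta> * 2 ^ nat \<lfloor>\<beta> * 4 ^ w / 4 ^ (c + 1)\<rfloor>"
    if w: "2 * c + 2 \<le> w" and s: "2 ^ (3 * c * w * 2 ^ w) \<le> s" "s \<le> 2 ^ b" and n: "3 * c\<^sup>2 * 4 ^ w + 2 * b \<le> n"
    for w n b s
  proof -
    \<comment> \<open>Since \<open>\<eta> \<ge> (1/4) ^ c\<close>, this makes
      \<open>r * \<eta>\<close> at least 4, above the required 2.\<close>
    define r where "r = (4::nat) ^ (c + 1)"
    \<comment> \<open>Makes \<open>r * M = c * 2 ^ w\<close>; the exponent is a true difference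
      because \<open>2 * c + 2 \<le> w\<close>.\<close>
    define M where "M = c * 2 ^ (w - (2 * c + 2))"
    \<comment> \<open>The largest integer depth with \<open>D * q \<le> \<beta> * k\<close>, for
      \<open>k = 2 ^ w\<close> and \<open>q = (1/2) ^ w * r\<close>.\<close>
    define D where "D = nat \<lfloor>\<beta> * 4 ^ w / 4 ^ (c + 1)\<rfloor>"
    define \<eta> where "\<eta> = (1 - (1/2) ^ w :: real) ^ (r * M)"
    have r2: "r = 2 ^ (2 * c + 2)" by (simp add: r_def power_mult power_add)
    have "2 ^ (2 * c + 2) * (2::nat) ^ (w - (2 * c + 2)) = 2 ^ w"
      using w by (simp add: power_add[symmetric] del: power_Suc)
    then have rM: "r * M = c * 2 ^ w" by (simp add: r2 M_def mult_ac)
    have \<eta>_eq: "\<eta> = ((1 - (1/2) ^ w) ^ (2 ^ w)) ^ c"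
      unfolding \<eta>_def rM by (simp add: power_mult[symmetric] mult.commute)
    have w1: "1 \<le> w" using w by simp
    have "(0::real) \<le> (1 - (1/2) ^ w) ^ (2 ^ w)" by (simp add: power_le_one)
    then have \<eta>_le: "\<eta> \<le> (1/2) ^ c"
      unfolding \<eta>_eq by (rule power_mono[OF one_minus_inverse_power_bounds(1)[OF w1]])
    have \<eta>_ge: "(1/4) ^ c \<le> \<eta>"
      unfolding \<eta>_eq by (rule power_mono[OF one_minus_inverse_power_bounds(2)[OF w1]]) simp
    have "(2::real) < real r * (1/4) ^ c" by (simp add: r_def power_one_over)
    also have "\<dots> \<le> real r * \<eta>" using \<eta>_ge by (intro mult_left_mono) auto
    finally have r\<eta>: "2 < real r * \<eta>" .
    have wlt: "w + 1 \<le> 2 ^ w" unfolding Suc_eq_plus1[symmetric] Suc_le_eq by (rule less_exp)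
    have four: "(4::nat) ^ w = 2 ^ w * 2 ^ w" by (simp add: power_mult_distrib[symmetric])
    have size: "c * ((w + 1) ^ (r * M) * 2 ^ (2 ^ w)) < s"
    proof -
      have "c * ((w + 1) ^ (r * M) * 2 ^ (2 ^ w)) < 2 ^ c * ((2 ^ w) ^ (r * M) * 2 ^ (2 ^ w))"
        by (intro mult_less_le_imp_less less_exp mult_le_mono power_mono wlt) auto
      also have "\<dots> = 2 ^ (c + (w * (c * 2 ^ w) + 2 ^ w))"
        by (simp add: rM power_mult power_add)
      also have "\<dots> \<le> 2 ^ (3 * c * w * 2 ^ w)"
      proof (rule power_increasing)
        have "c \<le> c * w * 2 ^ w" "2 ^ w \<le> c * w * 2 ^ w" using c1 w1 by simp_all
        moreover have "w * (c * 2 ^ w) = c * w * 2 ^ w" "3 * c * w * 2 ^ w = 3 * (c * w * 2 ^ w)" by simp_all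
        ultimately show "c + (w * (c * 2 ^ w) + 2 ^ w) \<le> 3 * c * w * 2 ^ w" by linarith
      qed simp
      finally show ?thesis using s(1) by simp
    qed
    have vars: "c * (1 + r * M * w + M * 2 ^ w) + 2 * b \<le> n"
    proof -
      have "1 \<le> c * 4 ^ w" using c1 by simp
      moreover have "c * 2 ^ w * w \<le> c * 4 ^ w" unfolding four using wlt by simp
      moreover have "M * 2 ^ w \<le> c * 4 ^ w"
        unfolding four M_def mult.assoc by (intro mult_le_mono power_increasing) auto
      ultimately have "1 + r * M * w + M * 2 ^ w \<le> 3 * (c * 4 ^ w)" unfolding rM by linarith
      then have "c * (1 + r * M * w + M * 2 ^ w) \<le> c * (3 * (c * 4 ^ w))" by (rule mult_le_mono2)
      then show ?thesis using n by (simp add: power2_eq_square)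
    qed
    have "(0::nat) < 3 * c\<^sup>2 * 4 ^ w" using c1 by simp
    then have "0 < n" using n by linarith
    have D_le: "real D \<le> \<beta> * 4 ^ w / real r"
      unfolding D_def r_def using \<beta> by (simp add: of_nat_nat)
    have r0: "0 < real r" by (simp add: r_def)
    have D_lt: "D < 2 ^ w * M"
    proof -
      have "real D * real r \<le> \<beta> * 4 ^ w" using D_le r0 by (simp add: field_simps)
      also have "\<dots> < 1 * 4 ^ w" using \<beta> by (intro mult_strict_right_mono) auto
      also have "\<dots> \<le> real c * 4 ^ w" using c1 by simp
      also have "\<dots> = real (r * M * 2 ^ w)" unfolding rM by (simp add: four[symmetric, THEN arg_cong[of _ _ real], simplified])
      finally have "real (D * r) < real (2 ^ w * M * r)" by (simp add: mult_ac)
      then have "D * r < 2 ^ w * M * r" by (simp only: of_nat_less_iff)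
      then show ?thesis by simp
    qed
    have D\<theta>: "real D * ((1/2) ^ w * real r) \<le> \<beta> * real (2 ^ w)"
    proof -
      have "real D * ((1/2) ^ w * real r) \<le> \<beta> * 4 ^ w / real r * ((1/2) ^ w * real r)"
        by (rule mult_right_mono[OF D_le]) simp
      also have "\<dots> = \<beta> * (4 ^ w * (1/2) ^ w)" using r0 by simp
      also have "(4::real) ^ w * (1/2) ^ w = 2 ^ w" by (simp flip: power_mult_distrib)
      finally show ?thesis by simp
    qed
    have M0: "0 < M" using c1 by (simp add: M_def)
    have r0': "0 < r" by (simp add: r_def)
    have \<eta>\<beta>: "\<eta> \<le> \<beta>" using \<eta>_le c by linarith
    then have "\<eta> + \<beta> \<le> 1" using \<beta> by simp
    from tribe_cascade_hard[of "2 ^ w" M r c w b n s D \<beta> \<epsilon>, folded \<eta>_def, OF _ M0 r0' vars \<open>0 < n\<close> r\<eta> size s(2) D_lt D\<theta> _ this]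
    obtain f where f: "pm f" "opt_dt_size n f = s"
      and err: "(1 - \<eta> - \<beta>) / 2 * (1 - (1/2) ^ c - real (topdown_dt_size n f \<epsilon>) / 2 ^ D) \<le> \<epsilon>"
      using \<beta> assms(1) by auto
    have "\<beta> \<le> real (topdown_dt_size n f \<epsilon>) / 2 ^ D"
    proof (rule ccontr)
      assume "\<not> ?thesis"
      then have "1 - 2 * \<beta> < 1 - (1/2) ^ c - real (topdown_dt_size n f \<epsilon>) / 2 ^ D" using c by linarith
      then have "(1 - 2 * \<beta>) / 2 * (1 - 2 * \<beta>)
          < (1 - \<eta> - \<beta>) / 2 * (1 - (1/2) ^ c - real (topdown_dt_size n f \<epsilon>) / 2 ^ D)"
        using \<eta>\<beta> \<beta> by (intro mult_le_less_imp_less) auto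
      moreover have "(1 - 2 * \<beta>) / 2 * (1 - 2 * \<beta>) \<ge> \<epsilon>"
      proof -
        have "(1 - 2 * \<beta>) / 2 * (1 - 2 * \<beta>) = (1 - 4 * \<beta>) / 2 + 2 * \<beta>\<^sup>2"
          by (simp add: power2_eq_square algebra_simps add_divide_distrib diff_divide_distrib)
        moreover have "(1 - 4 * \<beta>) / 2 = \<epsilon>" by (simp add: \<beta>_def field_simps)
        ultimately show ?thesis by simp
      qed
      ultimately show False using err by linarith
    qed
    then have "\<beta> * 2 ^ D \<le> real (topdown_dt_size n f \<epsilon>)" by (simp add: field_simps)
    then show ?thesis using f unfolding D_def by blast
  qed
  then show ?thesis using \<beta> c1 by (intro exI[of _ c] exI[of _ \<beta>]) auto
qed

lemma log_ge_if_powr_le: "0 < (x::real) \<Longrightarrow> 2 powr y \<le> x \<Longrightarrow> y \<le> log 2 x"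
  by (simp add: le_log_iff)

lemma approximate_lower_bound:
  fixes \<epsilon> :: real and s :: "nat \<Rightarrow> nat"
  assumes \<epsilon>: "0 < \<epsilon>" "\<epsilon> < 1/2" and s1: "\<And>n. s n \<ge> 1"
    and b: "b \<in> soft_O (\<lambda>n. sqrt (real n))" "\<And>n. real (s n) \<le> 2 powr b n"
  shows "\<exists>e \<in> soft_Omega (\<lambda>m. log 2 (real m)).
    \<forall>\<^sub>F n in sequentially. \<exists>f. pm f \<and> opt_dt_size n f = s n \<and>
      real (topdown_dt_size n f \<epsilon>) \<ge> real (s n) powr e (s n)"
proof -
  obtain c :: nat and \<beta> :: real where \<beta>: "0 < \<beta>" "\<beta> \<le> 1" and c1: "1 \<le> c"
    and hard: "\<And>w n b s. 2 * c + 2 \<le> w \<Longrightarrow> 2 ^ (3 * c * w * 2 ^ w) \<le> s \<Longrightarrow> s \<le> 2 ^ b \<Longrightarrow>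
      3 * c\<^sup>2 * 4 ^ w + 2 * b \<le> n \<Longrightarrow> \<exists>f. pm f \<and> opt_dt_size n f = s \<and>
        real (topdown_dt_size n f \<epsilon>) \<ge> \<beta> * 2 ^ nat \<lfloor>\<beta> * 4 ^ w / 4 ^ (c + 1)\<rfloor>"
    using hard_functions[OF \<epsilon>] by metis
  obtain \<kappa> where \<kappa>: "b \<in> O(\<lambda>n. sqrt (real n) * log 2 (sqrt (real n)) ^ \<kappa>)"
    using b(1) by (auto simp: soft_O_def)
  obtain C where C: "0 < C"
    "\<forall>\<^sub>F n in sequentially. norm (b n) \<le> C * norm (sqrt (real n) * log 2 (sqrt (real n)) ^ \<kappa>)"
    using landau_o.bigE[OF \<kappa>] by blast
  \<comment> \<open>Below, \<open>d\<close> is \<open>log s\<close> and \<open>2 ^ w\<close> is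
    about \<open>\<psi> d\<close>. Two of the logarithmic factors removed by \<open>\<psi>\<close>
    absorb \<open>3 * c\<close> and \<open>w\<close> in the size requirement. The full power
    \<open>\<kappa> + 2\<close> cancels the factor allowed by \<open>soft_O\<close> and leaves
    \<open>4 ^ w\<close> of smaller order than \<open>n\<close>.\<close>
  define K where "K = \<kappa> + 2"
  define \<psi> where "\<psi> d = d / log 2 d ^ K" for d :: real
  \<comment> \<open>With \<open>(\<psi> d)\<^sup>2 \<le> 4 * 4 ^ w\<close>, this puts
    \<open>2 * e0 * (\<psi> d)\<^sup>2\<close> below the argument of the floor in
    \<open>hard\<close>. The factor 2 is slack that absorbs the floor and the constant
    \<open>\<beta>\<close>.\<close>
  define e0 where "e0 = \<beta> / (32 * 4 ^ c)"
  have e0: "0 < e0" using \<beta> by (simp add: e0_def)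
  have \<psi>_lim: "filterlim \<psi> at_top at_top" unfolding \<psi>_def by real_asymp
  have "\<forall>\<^sub>F d in at_top. \<psi> d \<ge> max (2 ^ (2 * c + 2)) (1 + (1 - log 2 \<beta>) / e0)"
    by (rule \<psi>_lim[unfolded filterlim_at_top, rule_format])
  moreover have "\<forall>\<^sub>F d in at_top. log 2 d \<ge> max 1 (3 * real c)" by real_asymp
  ultimately have "\<forall>\<^sub>F d in at_top. d \<ge> 1 \<and> \<psi> d \<ge> max (2 ^ (2 * c + 2)) (1 + (1 - log 2 \<beta>) / e0)
      \<and> log 2 d \<ge> max 1 (3 * real c)"
    using eventually_ge_at_top[of 1] by eventually_elim auto
  then obtain d0 :: real where "\<And>d. d \<ge> d0 \<Longrightarrow> d \<ge> 1 \<and>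
      \<psi> d \<ge> max (2 ^ (2 * c + 2)) (1 + (1 - log 2 \<beta>) / e0) \<and> log 2 d \<ge> max 1 (3 * real c)"
    unfolding eventually_at_top_linorder by blast
  then have d0: "d \<ge> 1" "\<psi> d \<ge> 2 ^ (2 * c + 2)" "\<psi> d \<ge> 1 + (1 - log 2 \<beta>) / e0" "log 2 d \<ge> 1" "log 2 d \<ge> 3 * real c"
    if "d \<ge> d0" for d using that by auto
  \<comment> \<open>\<open>s powr e s\<close> equals
    \<open>2 powr (e0 * (\<psi> d)\<^sup>2)\<close>, whence the exponent \<open>2 * K\<close>. Below
    the threshold \<open>d0\<close> the exponent is 0, because \<open>s n\<close> may be small even
    for large \<open>n\<close>; there the bound is trivial and only the exact size has to be
    attained.\<close>
  define e where "e m = (if log 2 (real m) < d0 then 0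
      else e0 * (log 2 (real m) / log 2 (log 2 (real m)) ^ (2 * K)))" for m :: nat
  have "e \<in> soft_Omega (\<lambda>m. log 2 (real m))"
  proof -
    have "\<forall>\<^sub>F m in sequentially. log 2 (real m) \<ge> d0" by real_asymp
    then have "\<forall>\<^sub>F m in sequentially. e m \<ge> e0 * (log 2 (real m) / log 2 (log 2 (real m)) ^ (2 * K))"
      by eventually_elim (simp add: e_def)
    then show ?thesis unfolding soft_Omega_def using e0 by blast
  qed
  moreover have "\<forall>\<^sub>F n in sequentially. \<exists>f. pm f \<and> opt_dt_size n f = s n \<and>
      real (topdown_dt_size n f \<epsilon>) \<ge> real (s n) powr e (s n)"
  proof -
    define b0 where "b0 = nat \<lceil>d0\<rceil>"
    define B where "B n = C * (sqrt (real n) * log 2 (real n) ^ \<kappa>)" for n :: nat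
    have ev1: "\<forall>\<^sub>F n in sequentially. 3 * (real c)\<^sup>2 * real n powr (1/2) + 2 * real n powr (1/4) + 4 \<le> real n"
      by real_asymp
    have ev2: "\<forall>\<^sub>F n in sequentially. 3 * (real c)\<^sup>2 * (C * 4 ^ K)\<^sup>2 / log 2 (real n) ^ 4 \<le> 1/4"
      by real_asymp
    have ev3: "\<forall>\<^sub>F n in sequentially. 2 * B n + 4 \<le> real n / 2"
      unfolding B_def by real_asymp
    show ?thesis
      using C(2) ev1 ev2 ev3 eventually_ge_at_top[of "max 4 (2 * b0)"]
    proof eventually_elim
      case (elim n)
      have n: "4 \<le> n" "2 * b0 \<le> n" using elim(5) by auto
      define d where "d = log 2 (real (s n))"
      have s_eq: "real (s n) = 2 powr d" using s1[of n] by (simp add: d_def)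
      show ?case
      proof (cases "d < d0")
        case True
        have "real (s n) \<le> 2 powr real b0"
          unfolding s_eq using True by (simp add: b0_def) linarith
        then have "real (s n) \<le> real (2 ^ b0)" by (simp add: powr_realpow)
        then have "s n \<le> 2 ^ b0" by (simp only: of_nat_le_iff)
        then obtain f where f: "pm f" "opt_dt_size n f = s n"
          using opt_dt_size_attained[of "s n" b0 0 n] s1[of n] n(2) by auto
        obtain t :: bare_tree where "topdown_dt_size n f \<epsilon> = dt_size t"
          using topdown_dt_sizeE[OF f(1), of \<epsilon> n] \<epsilon> n by auto
        then have "1 \<le> real (topdown_dt_size n f \<epsilon>)" using dt_size_pos[of t] by simp
        moreover have "real (s n) powr e (s n) = 1" using True s1[of n] by (simp add: e_def d_def)
        ultimately show ?thesis using f by auto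
      next
        case False
        then have "d0 \<le> d" by simp
        note d = d0[OF this]
        define L where "L = log 2 d"
        have L: "1 \<le> L" "3 * real c \<le> L" using d by (auto simp: L_def)
        have \<psi>1: "1 \<le> \<psi> d" using d(2) one_le_power[of "2::real" "2 * c + 2"] by linarith
        have \<psi>d: "\<psi> d \<le> d" using d(1) L by (simp add: \<psi>_def L_def[symmetric] divide_le_eq mult_ge1_I)
        define w where "w = nat \<lfloor>log 2 (\<psi> d)\<rfloor>"
        have lp: "0 \<le> log 2 (\<psi> d)" using \<psi>1 by simp
        have w_le: "real w \<le> log 2 (\<psi> d)" and w_gt: "log 2 (\<psi> d) < real w + 1"
          using lp by (auto simp: w_def)
        have "2 powr real w \<le> 2 powr log 2 (\<psi> d)" "2 powr log 2 (\<psi> d) < 2 powr (real w + 1)"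
          using w_le w_gt by simp_all
        then have W: "2 ^ w \<le> \<psi> d" "\<psi> d < 2 * 2 ^ w"
          using \<psi>1 by (simp_all add: powr_realpow powr_add)
        have four: "(4::real) ^ w = (2 ^ w)\<^sup>2" by (simp add: power2_eq_square flip: power_mult_distrib)
        have "real (2 * c + 2) \<le> log 2 (\<psi> d)"
        proof (rule log_ge_if_powr_le)
          have "2 powr real (2 * c + 2) = (2::real) ^ (2 * c + 2)" by (rule powr_realpow) simp
          then show "2 powr real (2 * c + 2) \<le> \<psi> d" using d(2) by (simp only:)
        qed (use \<psi>1 in linarith)
        then have wc: "2 * c + 2 \<le> w" unfolding w_def using le_nat_floor by blast
        have size: "2 ^ (3 * c * w * 2 ^ w) \<le> s n"
        proof -
          have "real w \<le> L" using w_le \<psi>d \<psi>1 by (simp add: L_def) (smt (verit) log_le_cancel_iff)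
          then have "3 * real c * real w * 2 ^ w \<le> L * L * \<psi> d"
            using L W(1) by (intro mult_mono) auto
          also have "\<dots> \<le> L ^ K * \<psi> d"
          proof (rule mult_right_mono)
            have "L ^ 2 \<le> L ^ K" using L by (intro power_increasing) (auto simp: K_def)
            then show "L * L \<le> L ^ K" by (simp add: power2_eq_square)
          qed (use \<psi>1 in simp)
          also have "\<dots> = d" using L by (simp add: \<psi>_def L_def[symmetric])
          finally have "2 powr real (3 * c * w * 2 ^ w) \<le> 2 powr d" by simp
          then have "real (2 ^ (3 * c * w * 2 ^ w)) \<le> real (s n)"
            unfolding s_eq by (subst (asm) powr_realpow) auto
          then show ?thesis by (simp only: of_nat_le_iff)
        qed
        define b' where "b' = nat \<lceil>d\<rceil>"
        have b': "real b' \<le> d + 1" "d \<le> real b'" using d(1) unfolding b'_def by linarith+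
        have sb: "s n \<le> 2 ^ b'"
        proof -
          have "real (s n) \<le> 2 powr real b'" unfolding s_eq using b'(2) by simp
          then have "real (s n) \<le> real (2 ^ b')" by (simp add: powr_realpow)
          then show ?thesis by (simp only: of_nat_le_iff)
        qed
        have dB: "d \<le> B n"
        proof -
          have "2 powr d \<le> 2 powr b n" using b(2)[of n] s_eq by simp
          then have "d \<le> b n" by simp
          also have "\<dots> \<le> C * \<bar>sqrt (real n) * log 2 (sqrt (real n)) ^ \<kappa>\<bar>" using elim(1) by auto
          also have "\<dots> \<le> B n"
            unfolding B_def
          proof (intro mult_left_mono)
            have "0 \<le> log 2 (sqrt (real n))" using n by simp
            moreover have "log 2 (sqrt (real n)) \<le> log 2 (real n)"
              using n by (simp add: real_sqrt_le_iff sqrt_le_D real_le_lsqrt power2_eq_square)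
            ultimately have "log 2 (sqrt (real n)) ^ \<kappa> \<le> log 2 (real n) ^ \<kappa>" by (intro power_mono)
            then show "\<bar>sqrt (real n) * log 2 (sqrt (real n)) ^ \<kappa>\<bar> \<le> sqrt (real n) * log 2 (real n) ^ \<kappa>"
              using \<open>0 \<le> log 2 (sqrt (real n))\<close> by (simp add: abs_mult mult_left_mono)
          qed (use C(1) in simp)
          finally show ?thesis .
        qed
        \<comment> \<open>When \<open>d\<close> is tiny compared with \<open>n\<close>,
          \<open>log d\<close> is not comparable to \<open>log n\<close>, but then
          \<open>\<psi> d \<le> d\<close> suffices. Above \<open>n powr (1/4)\<close>,
          \<open>log d\<close> is at least a quarter of \<open>log n\<close>, so the logarithms in
          \<open>\<psi>\<close> cancel those in \<open>B n\<close>.\<close>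
        have fit: "3 * (real c)\<^sup>2 * (\<psi> d)\<^sup>2 + 2 * d + 2 \<le> real n"
        proof (cases "d \<le> real n powr (1/4)")
          case True
          have "(\<psi> d)\<^sup>2 \<le> (real n powr (1/4))\<^sup>2" using \<psi>1 \<psi>d True by (intro power_mono) auto
          also have "\<dots> = real n powr (1/2)" using n by (simp add: power2_eq_square flip: powr_add)
          finally have "3 * (real c)\<^sup>2 * (\<psi> d)\<^sup>2 \<le> 3 * (real c)\<^sup>2 * real n powr (1/2)" by (intro mult_left_mono) auto
          then show ?thesis using True elim(2) by linarith
        next
          case large: False
          define l where "l = log 2 (real n)"
          have l: "0 < l" using n by (simp add: l_def)
          have "log 2 (real n powr (1/4)) \<le> L" unfolding L_def using large n d(1) by (subst log_le_cancel_iff) auto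
          then have lL: "l / 4 \<le> L" using n by (simp add: l_def log_powr)
          have "\<psi> d = d / L ^ K" by (simp add: \<psi>_def L_def)
          also have "\<dots> \<le> B n / (l / 4) ^ K"
            using dB lL l d(1) by (intro frac_le power_mono) auto
          also have "\<dots> = C * 4 ^ K * sqrt (real n) / l\<^sup>2"
            using l by (simp add: B_def K_def l_def[symmetric] power_divide power_add field_simps power2_eq_square)
          finally have "(\<psi> d)\<^sup>2 \<le> (C * 4 ^ K * sqrt (real n) / l\<^sup>2)\<^sup>2"
            using \<psi>1 by (intro power_mono) auto
          also have "\<dots> = (C * 4 ^ K)\<^sup>2 * real n / l ^ 4"
            by (simp add: power_mult_distrib power_divide flip: power_mult)
          finally have "3 * (real c)\<^sup>2 * (\<psi> d)\<^sup>2 \<le> 3 * (real c)\<^sup>2 * ((C * 4 ^ K)\<^sup>2 * real n / l ^ 4)"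
            by (intro mult_left_mono) auto
          also have "\<dots> = 3 * (real c)\<^sup>2 * (C * 4 ^ K)\<^sup>2 / l ^ 4 * real n" by simp
          also have "\<dots> \<le> 1/4 * real n" unfolding l_def by (rule mult_right_mono[OF elim(3)]) simp
          finally show ?thesis using elim(4) dB by linarith
        qed
        have vars: "3 * c\<^sup>2 * 4 ^ w + 2 * b' \<le> n"
        proof -
          have "(2 ^ w)\<^sup>2 \<le> (\<psi> d)\<^sup>2" using W(1) by (intro power_mono) auto
          then have "3 * (real c)\<^sup>2 * 4 ^ w \<le> 3 * (real c)\<^sup>2 * (\<psi> d)\<^sup>2" unfolding four by (intro mult_left_mono) auto
          then have "3 * (real c)\<^sup>2 * 4 ^ w + 2 * real b' \<le> real n" using fit b'(1) by linarith
          then have "real (3 * c\<^sup>2 * 4 ^ w + 2 * b') \<le> real n" by simp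
          then show ?thesis by (simp only: of_nat_le_iff)
        qed
        obtain f where f: "pm f" "opt_dt_size n f = s n"
          and td: "real (topdown_dt_size n f \<epsilon>) \<ge> \<beta> * 2 ^ nat \<lfloor>\<beta> * 4 ^ w / 4 ^ (c + 1)\<rfloor>"
          using hard[OF wc size sb vars] by blast
        let ?D = "nat \<lfloor>\<beta> * 4 ^ w / 4 ^ (c + 1)\<rfloor>"
        have "real (s n) powr e (s n) = 2 powr (d * e (s n))" unfolding s_eq by (simp add: powr_powr)
        also have "d * e (s n) = e0 * (\<psi> d)\<^sup>2"
          using False by (simp add: e_def d_def[symmetric] \<psi>_def power_divide power2_eq_square power_mult mult_2 power_add)
        also have "2 powr (e0 * (\<psi> d)\<^sup>2) \<le> 2 powr (log 2 \<beta> + real ?D)"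
        proof -
          have "(\<psi> d)\<^sup>2 \<le> (2 * 2 ^ w)\<^sup>2" using W(2) \<psi>1 by (intro power_mono) auto
          then have "(\<psi> d)\<^sup>2 \<le> 4 * 4 ^ w" unfolding four by (simp add: power_mult_distrib)
          then have "2 * e0 * (\<psi> d)\<^sup>2 \<le> 2 * e0 * (4 * 4 ^ w)" using e0 by (intro mult_left_mono) auto
          also have "\<dots> = \<beta> * 4 ^ w / 4 ^ (c + 1)" by (simp add: e0_def)
          finally have D: "2 * e0 * (\<psi> d)\<^sup>2 - 1 \<le> real ?D" by linarith
          have "(1 - log 2 \<beta>) / e0 \<le> \<psi> d" using d(3) by linarith
          also have "\<psi> d \<le> (\<psi> d)\<^sup>2" using \<psi>1 by (simp add: power2_eq_square)
          finally have "1 - log 2 \<beta> \<le> e0 * (\<psi> d)\<^sup>2" using e0 by (simp add: field_simps)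
          then show ?thesis using D by simp
        qed
        also have "2 powr (log 2 \<beta> + real D) = \<beta> * 2 ^ D" for D
          using \<beta> by (simp add: powr_add powr_realpow)
        finally have "real (s n) powr e (s n) \<le> \<beta> * 2 ^ ?D" .
        then show ?thesis using f td by force
      qed
    qed
  qed
  ultimately show ?thesis by blast
qed

theorem theorem2p2:
  shows
    "(\<exists>(N :: nat set) (f :: nat \<Rightarrow> (nat \<Rightarrow> bool) \<Rightarrow> real).
        infinite N \<and>
        (\<forall>n\<in>N. f n \<in> cube n \<rightarrow> {-1, 1}) \<and>
        (\<lambda>n. real (opt_dt_size n (f n))) \<in> \<Theta>[sequentially \<sqinter> principal N](\<lambda>n. real n) \<and>
        (\<exists>c>0. \<forall>n\<in>N. real (topdown_dt_size n (f n) 0) \<ge> 2 powr (c * real (opt_dt_size n (f n)))))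
     \<and>
     (\<forall>\<epsilon>::real. 0 < \<epsilon> \<and> \<epsilon> < 1/2 \<longrightarrow>
       (\<forall>s :: nat \<Rightarrow> nat.
          (\<forall>n. s n \<ge> 1) \<and>
          (\<exists>b \<in> soft_O (\<lambda>n. sqrt (real n)). \<forall>n. real (s n) \<le> 2 powr b n) \<longrightarrow>
          (\<exists>e \<in> soft_Omega (\<lambda>m. log 2 (real m)).
             \<forall>\<^sub>F n in sequentially.
               \<exists>f \<in> cube n \<rightarrow> {-1, 1}.
                 opt_dt_size n f = s n \<and>
                 real (topdown_dt_size n f \<epsilon>) \<ge> real (s n) powr e (s n))))"
proof (intro conjI exact_lower_bound allI impI)
  fix \<epsilon> :: real and s :: "nat \<Rightarrow> nat"
  assume \<epsilon>: "0 < \<epsilon> \<and> \<epsilon> < 1/2"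
    and "(\<forall>n. s n \<ge> 1) \<and> (\<exists>b \<in> soft_O (\<lambda>n. sqrt (real n)). \<forall>n. real (s n) \<le> 2 powr b n)"
  then obtain b where s: "\<And>n. s n \<ge> 1"
    and b: "b \<in> soft_O (\<lambda>n. sqrt (real n))" "\<And>n. real (s n) \<le> 2 powr b n" by blast
  obtain e where e: "e \<in> soft_Omega (\<lambda>m. log 2 (real m))"
    and ev: "\<forall>\<^sub>F n in sequentially. \<exists>f. pm f \<and> opt_dt_size n f = s n \<and>
      real (topdown_dt_size n f \<epsilon>) \<ge> real (s n) powr e (s n)"
    using approximate_lower_bound[OF conjunct1[OF \<epsilon>] conjunct2[OF \<epsilon>] s b] by blast
  have cube: "f \<in> cube n \<rightarrow> {-1, 1}" if "pm f" for f n using that by (auto simp: pm_def)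
  have "\<forall>\<^sub>F n in sequentially. \<exists>f \<in> cube n \<rightarrow> {-1, 1}. opt_dt_size n f = s n \<and>
      real (topdown_dt_size n f \<epsilon>) \<ge> real (s n) powr e (s n)"
    using ev by eventually_elim (use cube in blast)
  then show "\<exists>e \<in> soft_Omega (\<lambda>m. log 2 (real m)). \<forall>\<^sub>F n in sequentially.
      \<exists>f \<in> cube n \<rightarrow> {-1, 1}. opt_dt_size n f = s n \<and>
        real (topdown_dt_size n f \<epsilon>) \<ge> real (s n) powr e (s n)"
    using e by blast
qed

end
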